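(* The following decision problem is undecidable: given a nonempty finite set $\mathcal{P}$ of processes with $|\mathcal{P}|\ge 2$ and a loop-connected HMSC $\mathcal{H}$ over $\mathcal{P}$, decide whether $L(\mathcal{H})\neq\emptyset$.
   Context: Let $\mathcal{P}$ be a nonempty finite set of processes, $\mathit{Ch}=\{(p,q)\in\mathcal{P}\times\mathcal{P}\mid p\neq q\}$, $\mathit{Act}_p=\{p!q\mid (p,q)\in\mathit{Ch}\}\cup\{p?q\mid (q,p)\in\mathit{Ch}\}$, $\mathit{Act}=\bigcup_p\mathit{Act}_p$, and $\mathit{Msg}$ a finite set of messages. A compositional MSC (cMSC) over $\mathcal{P}$ and $\mathit{Msg}$ is a tuple $M=(E,\le,\lhd,\lambda,\mu)$ where $E$ is a nonempty finite or countably infinite set of events, $\le$ a partial order on $E$, $\lambda\colon E\to\mathit{Act}$, $\mu\colon E\rightharpoonup\mathit{Msg}$ partial, such that: for each $p$, with $E_p=\{e\mid\lambda(e)\in\mathit{Act}_p\}$, the restriction $\le_p$ of $\le$ to $E_p$ is a total order, finite or isomorphic to $(\mathbb{N},\le)$; with ${\to}$ the union over $p$ of the direct-successor relations of $\le_p$, the relation ${\lhd}\subseteq{\le}$ satisfies (i) each $(e,f)\in\lhd$ has $\lambda(e)=p!q$, $\lambda(f)=q?p$ for some $(p,q)\in\mathit{Ch}$, (ii) FIFO: for $(e,f),(e',f')\in\lhd$ with $e,e'\in E_p$, $f,f'\in E_q$, $e\le_p e'$ iff $f\le_q f'$; $\le$ is the reflexive transitive closure of ${\to}\cup{\lhd}$;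 with $\mathrm{unm}(M)$ the set of events not related by $\lhd$ to any event, $\mathrm{dom}(\mu)=\mathrm{unm}(M)$; and for all $(e,f)\in\lhd$, $g\in\mathrm{unm}(M)$: $\lambda(g)=\lambda(e)\Rightarrow e<g$ and $\lambda(g)=\lambda(f)\Rightarrow g<f$. $M$ is an MSC if $\mathrm{unm}(M)=\emptyset$; $\mathbb{MSC}$ is the set of MSCs, $\mathrm{fc}\mathbb{MSC}$ the set of finite cMSCs. A cMSC is connected if the undirected graph $(E,{\le}\cup{\le}^{-1})$ is connected. Concatenation: for $M_1\in\mathrm{fc}\mathbb{MSC}$ and a cMSC $M_2$, $M_1\circ M_2$ is the set of all cMSCs $M$ with $E=E^1\uplus E^2$, ${\le_p}={\le^1_p}\cup{\le^2_p}\cup(E^1_p\times E^2_p)$ for all $p$, ${\lhd^1}\cup{\lhd^2}\subseteq{\lhd}$ and every other pair $(e,f)\in\lhd$ has $e\in E^1$, $f\in E^2$, $\mu^1(e)=\mu^2(f)$, and labels $\lambda$ (and $\mu$ on unmatched events of $M$) inherited from $M_1,M_2$. The infinite product $\prod_{i\ge1}M_i$ of finite cMSCs is defined analogously (new message edges go from $M_i$ to $M_j$ with $i<j$ and equal messages). An HMSC over $\mathcal{P}$ is $\mathcal{H}=(S,\iota,\mathit{Msg},R,F,F_\omega)$ with finite $S$, $\iota\in S$, finite $\mathit{Msg}$, finite $R\subseteq S\times\mathrm{fc}\mathbb{MSC}\times S$, and $F,F_\omega\subseteq S$. A finite path is $\rho=s_0M_1s_1\cdots M_ns_n$ ($n\ge1$,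 $(s_{i-1},M_i,s_i)\in R$), infinite paths analogous; $\mathit{cmscs}(\rho)=M_1\circ\cdots\circ M_n$ (resp. $\prod_i M_i$). A path is accepting if it starts at $\iota$ and is finite ending in $F$, or infinite visiting $F_\omega$ infinitely often. $L(\mathcal{H})=\bigcup\{\mathit{cmscs}(\rho)\mid\rho\text{ accepting}\}\cap\mathbb{MSC}$. $\mathcal{H}$ is loop-connected if for all $s\in S$ and all finite paths $\rho$ from $s$ to $s$, all cMSCs in $\mathit{cmscs}(\rho)$ are connected. *)

theory Defs
  imports Main "HOL-Library.FuncSet" "HOL-Library.Countable_Set" "HOL-Library.Infinite_Set" "HOL-Library.Disjoint_Sets"
    "HOL-Library.Nat_Bijection"
begin

section \<open>Compositional MSCs\<close>

text \<open>\<open>Send p q\<close> is the action \<open>p!q\<close> and \<open>Recv p q\<close> is the action \<open>p?q\<close>: in both cases the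
  first argument is the process that executes the action.\<close>

datatype 'p act = Send 'p 'p | Recv 'p 'p

definition Ch :: "'p set \<Rightarrow> ('p \<times> 'p) set" where
  "Ch P = {(p, q) \<in> P \<times> P. p \<noteq> q}"

definition Act_at :: "'p set \<Rightarrow> 'p \<Rightarrow> 'p act set" where
  "Act_at P p = {Send p q | q. (p, q) \<in> Ch P} \<union> {Recv p q | q. (q, p) \<in> Ch P}"

definition Act :: "'p set \<Rightarrow> 'p act set" where
  "Act P = (\<Union>p\<in>P. Act_at P p)"

record ('e, 'p, 'm) cmsc =
  events :: "'e set"
  le :: "('e \<times> 'e) set"
  lhd :: "('e \<times> 'e) set"
  lab :: "'e \<Rightarrow> 'p act"
  mark :: "'e \<Rightarrow> 'm option"

definition events_at :: "'p set \<Rightarrow> ('e, 'p, 'm) cmsc \<Rightarrow> 'p \<Rightarrow> 'e set" where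
  "events_at P M p = {e \<in> events M. lab M e \<in> Act_at P p}"

definition le_at :: "'p set \<Rightarrow> ('e, 'p, 'm) cmsc \<Rightarrow> 'p \<Rightarrow> ('e \<times> 'e) set" where
  "le_at P M p = Restr (le M) (events_at P M p)"

definition succ_at :: "'p set \<Rightarrow> ('e, 'p, 'm) cmsc \<Rightarrow> 'p \<Rightarrow> ('e \<times> 'e) set" where
  "succ_at P M p = {(e, f) \<in> le_at P M p. e \<noteq> f \<and>
     \<not> (\<exists>g. g \<noteq> e \<and> g \<noteq> f \<and> (e, g) \<in> le_at P M p \<and> (g, f) \<in> le_at P M p)}"

definition proc_succ :: "'p set \<Rightarrow> ('e, 'p, 'm) cmsc \<Rightarrow> ('e \<times> 'e) set" where
  "proc_succ P M = (\<Union>p\<in>P. succ_at P M p)"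

definition unm :: "('e, 'p, 'm) cmsc \<Rightarrow> 'e set" where
  "unm M = {e \<in> events M. \<not> (\<exists>f. (e, f) \<in> lhd M \<or> (f, e) \<in> lhd M)}"

text \<open>The labelling is required to be extensional (\<open>undefined\<close> outside the events), so that a
  record satisfying \<open>is_cmsc\<close> carries no information beyond the tuple it represents.\<close>

definition is_cmsc :: "'p set \<Rightarrow> 'm set \<Rightarrow> ('e, 'p, 'm) cmsc \<Rightarrow> bool" where
  "is_cmsc P Ms M \<longleftrightarrow>
     events M \<noteq> {} \<and> countable (events M) \<and>
     partial_order_on (events M) (le M) \<and>
     lab M \<in> events M \<rightarrow>\<^sub>E Act P \<and>
     dom (mark M) = unm M \<and> ran (mark M) \<subseteq> Ms \<and>
     (\<forall>p\<in>P. total_on (events_at P M p) (le_at P M p) \<and>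
        (finite (events_at P M p) \<or>
         (\<exists>h :: nat \<Rightarrow> 'e. bij_betw h UNIV (events_at P M p) \<and>
            (\<forall>i j. (h i, h j) \<in> le_at P M p \<longleftrightarrow> i \<le> j)))) \<and>
     lhd M \<subseteq> le M \<and>
     (\<forall>(e, f)\<in>lhd M. \<exists>(p, q)\<in>Ch P. lab M e = Send p q \<and> lab M f = Recv q p) \<and>
     (\<forall>p\<in>P. \<forall>q\<in>P. \<forall>(e, f)\<in>lhd M. \<forall>(e', f')\<in>lhd M.
        e \<in> events_at P M p \<longrightarrow> e' \<in> events_at P M p \<longrightarrow>
        f \<in> events_at P M q \<longrightarrow> f' \<in> events_at P M q \<longrightarrow>
        ((e, e') \<in> le_at P M p \<longleftrightarrow> (f, f') \<in> le_at P M q)) \<and>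
     le M = Restr ((proc_succ P M \<union> lhd M)\<^sup>*) (events M) \<and>
     (\<forall>(e, f)\<in>lhd M. \<forall>g\<in>unm M.
        (lab M g = lab M e \<longrightarrow> (e, g) \<in> le M \<and> e \<noteq> g) \<and>
        (lab M g = lab M f \<longrightarrow> (g, f) \<in> le M \<and> g \<noteq> f))"

definition MSC :: "'p set \<Rightarrow> 'm set \<Rightarrow> ('e, 'p, 'm) cmsc set" where
  "MSC P Ms = {M. is_cmsc P Ms M \<and> unm M = {}}"

definition fcMSC :: "'p set \<Rightarrow> 'm set \<Rightarrow> ('e, 'p, 'm) cmsc set" where
  "fcMSC P Ms = {M. is_cmsc P Ms M \<and> finite (events M)}"

definition connected_cmsc :: "('e, 'p, 'm) cmsc \<Rightarrow> bool" where
  "connected_cmsc M \<longleftrightarrow> (\<forall>e\<in>events M. \<forall>f\<in>events M. (e, f) \<in> (le M \<union> (le M)\<inverse>)\<^sup>*)"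


section \<open>Concatenation\<close>

definition cmsc_iso :: "('e, 'p, 'm) cmsc \<Rightarrow> ('e, 'p, 'm) cmsc \<Rightarrow> bool" where
  "cmsc_iso M M' \<longleftrightarrow> (\<exists>h. bij_betw h (events M) (events M') \<and>
     (\<forall>e\<in>events M. \<forall>f\<in>events M.
        ((e, f) \<in> le M \<longleftrightarrow> (h e, h f) \<in> le M') \<and>
        ((e, f) \<in> lhd M \<longleftrightarrow> (h e, h f) \<in> lhd M')) \<and>
     (\<forall>e\<in>events M. lab M' (h e) = lab M e \<and> mark M' (h e) = mark M e))"

text \<open>\<open>M\<close> is a concatenation of two cMSCs whose event sets are already disjoint.\<close>

definition is_conc ::
  "'p set \<Rightarrow> ('e, 'p, 'm) cmsc \<Rightarrow> ('e, 'p, 'm) cmsc \<Rightarrow> ('e, 'p, 'm) cmsc \<Rightarrow> bool" where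
  "is_conc P M1 M2 M \<longleftrightarrow>
     events M1 \<inter> events M2 = {} \<and> events M = events M1 \<union> events M2 \<and>
     (\<forall>p\<in>P. le_at P M p = le_at P M1 p \<union> le_at P M2 p \<union> events_at P M1 p \<times> events_at P M2 p) \<and>
     lhd M1 \<union> lhd M2 \<subseteq> lhd M \<and>
     (\<forall>(e, f)\<in>lhd M - (lhd M1 \<union> lhd M2). e \<in> events M1 \<and> f \<in> events M2 \<and>
        (\<exists>m. mark M1 e = Some m \<and> mark M2 f = Some m)) \<and>
     (\<forall>e\<in>events M1. lab M e = lab M1 e) \<and> (\<forall>e\<in>events M2. lab M e = lab M2 e) \<and>
     (\<forall>e\<in>events M1 \<inter> unm M. mark M e = mark M1 e) \<and>
     (\<forall>e\<in>events M2 \<inter> unm M. mark M e = mark M2 e)"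

text \<open>The disjoint union of event sets is rendered by first replacing the factors by isomorphic
  copies; concatenations are therefore closed under isomorphism.\<close>

definition conc ::
  "'p set \<Rightarrow> 'm set \<Rightarrow> ('e, 'p, 'm) cmsc \<Rightarrow> ('e, 'p, 'm) cmsc \<Rightarrow> ('e, 'p, 'm) cmsc set" where
  "conc P Ms M1 M2 = {M. is_cmsc P Ms M \<and>
     (\<exists>M1' M2'. is_cmsc P Ms M1' \<and> is_cmsc P Ms M2' \<and> cmsc_iso M1 M1' \<and> cmsc_iso M2 M2' \<and>
        is_conc P M1' M2' M)}"

text \<open>The left-associated product \<open>(M\<^sub>1 \<circ> M\<^sub>2) \<circ> \<dots> \<circ> M\<^sub>n\<close>, with \<open>\<circ>\<close> lifted to sets. A product
  with one factor consists of the isomorphic copies of that factor; the empty product is never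
  used.\<close>

fun fin_prod ::
  "'p set \<Rightarrow> 'm set \<Rightarrow> ('e, 'p, 'm) cmsc list \<Rightarrow> ('e, 'p, 'm) cmsc set" where
  "fin_prod P Ms [] = {}"
| "fin_prod P Ms (M # Ns) =
     foldl (\<lambda>X N. \<Union>K\<in>X. conc P Ms K N) {M'. is_cmsc P Ms M' \<and> cmsc_iso M M'} Ns"

definition is_inf_conc ::
  "'p set \<Rightarrow> (nat \<Rightarrow> ('e, 'p, 'm) cmsc) \<Rightarrow> ('e, 'p, 'm) cmsc \<Rightarrow> bool" where
  "is_inf_conc P Mf M \<longleftrightarrow>
     disjoint_family_on (\<lambda>i. events (Mf i)) UNIV \<and> events M = (\<Union>i. events (Mf i)) \<and>
     (\<forall>p\<in>P. le_at P M p =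
        (\<Union>i. le_at P (Mf i) p) \<union> (\<Union>i. \<Union>j\<in>{i<..}. events_at P (Mf i) p \<times> events_at P (Mf j) p)) \<and>
     (\<Union>i. lhd (Mf i)) \<subseteq> lhd M \<and>
     (\<forall>(e, f)\<in>lhd M - (\<Union>i. lhd (Mf i)). \<exists>i j. i < j \<and> e \<in> events (Mf i) \<and> f \<in> events (Mf j) \<and>
        (\<exists>m. mark (Mf i) e = Some m \<and> mark (Mf j) f = Some m)) \<and>
     (\<forall>i. \<forall>e\<in>events (Mf i). lab M e = lab (Mf i) e) \<and>
     (\<forall>i. \<forall>e\<in>events (Mf i) \<inter> unm M. mark M e = mark (Mf i) e)"

definition inf_prod ::
  "'p set \<Rightarrow> 'm set \<Rightarrow> (nat \<Rightarrow> ('e, 'p, 'm) cmsc) \<Rightarrow> ('e, 'p, 'm) cmsc set" where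
  "inf_prod P Ms Mf = {M. is_cmsc P Ms M \<and>
     (\<exists>Mf'. (\<forall>i. is_cmsc P Ms (Mf' i) \<and> cmsc_iso (Mf i) (Mf' i)) \<and> is_inf_conc P Mf' M)}"


section \<open>HMSCs\<close>

record ('s, 'e, 'p, 'm) hmsc =
  states :: "'s set"
  init :: "'s"
  msgs :: "'m set"
  trans_rel :: "('s \<times> ('e, 'p, 'm) cmsc \<times> 's) set"
  fin :: "'s set"
  fin_omega :: "'s set"

definition is_hmsc :: "'p set \<Rightarrow> ('s, 'e, 'p, 'm) hmsc \<Rightarrow> bool" where
  "is_hmsc P H \<longleftrightarrow>
     finite (states H) \<and> init H \<in> states H \<and> finite (msgs H) \<and> finite (trans_rel H) \<and>
     trans_rel H \<subseteq> states H \<times> fcMSC P (msgs H) \<times> states H \<and>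
     fin H \<subseteq> states H \<and> fin_omega H \<subseteq> states H"

text \<open>A path \<open>s\<^sub>0 M\<^sub>1 s\<^sub>1 \<dots>\<close> is represented by the sequence of its transitions
  \<open>(s\<^sub>i\<^sub>-\<^sub>1, M\<^sub>i, s\<^sub>i)\<close>.\<close>

definition src :: "'s \<times> 'c \<times> 's \<Rightarrow> 's" where "src t = fst t"
definition msc_of :: "'s \<times> 'c \<times> 's \<Rightarrow> 'c" where "msc_of t = fst (snd t)"
definition tgt :: "'s \<times> 'c \<times> 's \<Rightarrow> 's" where "tgt t = snd (snd t)"

definition fin_path ::
  "('s, 'e, 'p, 'm) hmsc \<Rightarrow> ('s \<times> ('e, 'p, 'm) cmsc \<times> 's) list \<Rightarrow> bool" where
  "fin_path H r \<longleftrightarrow> r \<noteq> [] \<and> set r \<subseteq> trans_rel H \<and> successively (\<lambda>t t'. tgt t = src t') r"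

definition inf_path ::
  "('s, 'e, 'p, 'm) hmsc \<Rightarrow> (nat \<Rightarrow> 's \<times> ('e, 'p, 'm) cmsc \<times> 's) \<Rightarrow> bool" where
  "inf_path H r \<longleftrightarrow> (\<forall>i. r i \<in> trans_rel H \<and> tgt (r i) = src (r (Suc i)))"

definition cmscs_fin ::
  "'p set \<Rightarrow> ('s, 'e, 'p, 'm) hmsc \<Rightarrow> ('s \<times> ('e, 'p, 'm) cmsc \<times> 's) list \<Rightarrow>
   ('e, 'p, 'm) cmsc set" where
  "cmscs_fin P H r = fin_prod P (msgs H) (map msc_of r)"

definition cmscs_inf ::
  "'p set \<Rightarrow> ('s, 'e, 'p, 'm) hmsc \<Rightarrow> (nat \<Rightarrow> 's \<times> ('e, 'p, 'm) cmsc \<times> 's) \<Rightarrow>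
   ('e, 'p, 'm) cmsc set" where
  "cmscs_inf P H r = inf_prod P (msgs H) (\<lambda>i. msc_of (r i))"

definition accepting_fin ::
  "('s, 'e, 'p, 'm) hmsc \<Rightarrow> ('s \<times> ('e, 'p, 'm) cmsc \<times> 's) list \<Rightarrow> bool" where
  "accepting_fin H r \<longleftrightarrow> fin_path H r \<and> src (hd r) = init H \<and> tgt (last r) \<in> fin H"

definition accepting_inf ::
  "('s, 'e, 'p, 'm) hmsc \<Rightarrow> (nat \<Rightarrow> 's \<times> ('e, 'p, 'm) cmsc \<times> 's) \<Rightarrow> bool" where
  "accepting_inf H r \<longleftrightarrow>
     inf_path H r \<and> src (r 0) = init H \<and> (\<exists>\<^sub>\<infinity>i. src (r i) \<in> fin_omega H)"

definition lang :: "'p set \<Rightarrow> ('s, 'e, 'p, 'm) hmsc \<Rightarrow> ('e, 'p, 'm) cmsc set" where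
  "lang P H =
     (\<Union> (cmscs_fin P H ` {r. accepting_fin H r}) \<union> \<Union> (cmscs_inf P H ` {r. accepting_inf H r}))
     \<inter> MSC P (msgs H)"

definition loop_connected :: "'p set \<Rightarrow> ('s, 'e, 'p, 'm) hmsc \<Rightarrow> bool" where
  "loop_connected P H \<longleftrightarrow>
     (\<forall>s\<in>states H. \<forall>r. fin_path H r \<longrightarrow> src (hd r) = s \<longrightarrow> tgt (last r) = s \<longrightarrow>
        (\<forall>M\<in>cmscs_fin P H r. connected_cmsc M))"


section \<open>Partial recursive functions and decidability\<close>

datatype recf = Zero | Succ | Proj nat | Comp recf "recf list" | PrimRec recf recf | Mu recf

text \<open>\<open>rec_eval f xs y\<close>: the partial recursive function denoted by \<open>f\<close> is defined on the argument
  list \<open>xs\<close>, with value \<open>y\<close>. The recursion variable of \<open>PrimRec\<close> and the search variable of \<open>Mu\<close>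
  come first in the argument list.\<close>

inductive rec_eval :: "recf \<Rightarrow> nat list \<Rightarrow> nat \<Rightarrow> bool" where
  zero: "rec_eval Zero xs 0"
| succ: "rec_eval Succ [x] (Suc x)"
| proj: "i < length xs \<Longrightarrow> rec_eval (Proj i) xs (xs ! i)"
| comp: "list_all2 (\<lambda>g y. rec_eval g xs y) gs ys \<Longrightarrow> rec_eval f ys z \<Longrightarrow>
    rec_eval (Comp f gs) xs z"
| prim_0: "rec_eval f xs y \<Longrightarrow> rec_eval (PrimRec f g) (0 # xs) y"
| prim_Suc: "rec_eval (PrimRec f g) (n # xs) y \<Longrightarrow> rec_eval g (n # y # xs) z \<Longrightarrow>
    rec_eval (PrimRec f g) (Suc n # xs) z"
| mu: "rec_eval f (n # xs) 0 \<Longrightarrow> (\<And>i. i < n \<Longrightarrow> \<exists>y. rec_eval f (i # xs) (Suc y)) \<Longrightarrow>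
    rec_eval (Mu f) xs n"

lemma rec_eval_functional: "rec_eval f xs y \<Longrightarrow> rec_eval f xs z \<Longrightarrow> y = z"
proof (induction f xs y arbitrary: z rule: rec_eval.induct)
  case (zero xs)
  then show ?case by cases simp
next
  case (succ x)
  then show ?case by cases simp
next
  case (proj i xs)
  from proj.prems show ?case by cases simp
next
  case (prim_0 f xs y g)
  from prim_0.prems have "rec_eval f xs z" by cases simp_all
  then show ?case by (rule prim_0.IH)
next
  case (prim_Suc f g n xs y z z')
  from prim_Suc.prems obtain y' where "rec_eval (PrimRec f g) (n # xs) y'"
    and "rec_eval g (n # y' # xs) z'"
    by cases auto
  then show ?case using prim_Suc.IH by blast
next
  case (comp xs gs ys f z z')
  from comp.prems obtain ys' where ys': "list_all2 (\<lambda>g y. rec_eval g xs y) gs ys'"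
    and f: "rec_eval f ys' z'"
    by (auto elim: rec_eval.cases)
  have "ys = ys'"
    using comp.IH(1) ys' by (auto simp: list_all2_conv_all_nth intro!: nth_equalityI)
  then show ?case using comp.IH(2) f by blast
next
  case (mu f n xs)
  from mu.prems have z0: "rec_eval f (z # xs) 0"
    and zl: "\<And>i. i < z \<Longrightarrow> \<exists>y. rec_eval f (i # xs) (Suc y)"
    by (auto elim: rec_eval.cases)
  have "\<not> n < z" using zl mu.IH(1) by fastforce
  moreover have "\<not> z < n" using mu.IH(2) z0 by fastforce
  ultimately show ?case by simp
qed

text \<open>The decision problem with instances \<open>I\<close>, presented to the algorithm as numbers via \<open>code\<close>,
  and with question \<open>Q\<close>. The algorithm may behave arbitrarily (even diverge) on numbers that
  are not codes of instances.\<close>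

definition decidable_on :: "('a \<Rightarrow> nat) \<Rightarrow> 'a set \<Rightarrow> ('a \<Rightarrow> bool) \<Rightarrow> bool" where
  "decidable_on code I Q \<longleftrightarrow> (\<exists>d. \<forall>x\<in>I. rec_eval d [code x] (if Q x then 1 else 0))"


section \<open>Coding HMSCs as numbers\<close>

text \<open>Since only finite objects are given as input, processes, messages, states and events of
  an instance are taken to be natural numbers. By \<open>hmsc_code_inj\<close> below, the code determines
  the instance.\<close>

fun act_code :: "nat act \<Rightarrow> nat" where
  "act_code (Send p q) = sum_encode (Inl (prod_encode (p, q)))"
| "act_code (Recv p q) = sum_encode (Inr (prod_encode (p, q)))"

definition cmsc_code :: "(nat, nat, nat) cmsc \<Rightarrow> nat" where
  "cmsc_code M = list_encode
     [set_encode (events M),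
      set_encode (prod_encode ` le M),
      set_encode (prod_encode ` lhd M),
      set_encode ((\<lambda>e. prod_encode (e, act_code (lab M e))) ` events M),
      set_encode (prod_encode ` Map.graph (mark M))]"

definition trans_code :: "nat \<times> (nat, nat, nat) cmsc \<times> nat \<Rightarrow> nat" where
  "trans_code t = list_encode [src t, cmsc_code (msc_of t), tgt t]"

definition hmsc_code :: "nat set \<times> (nat, nat, nat, nat) hmsc \<Rightarrow> nat" where
  "hmsc_code = (\<lambda>(P, H). list_encode
     [set_encode P,
      set_encode (states H),
      init H,
      set_encode (msgs H),
      set_encode (trans_code ` trans_rel H),
      set_encode (fin H),
      set_encode (fin_omega H)])"

lemma act_code_eq: "act_code a = act_code b \<longleftrightarrow> a = b"
  by (cases a; cases b) (auto simp: sum_encode_eq)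

lemma cmsc_code_inj:
  assumes "M \<in> fcMSC P Ms" "M' \<in> fcMSC P' Ms'" "cmsc_code M = cmsc_code M'"
  shows "M = M'"
proof -
  have fin: "finite (events N) \<and> finite (le N) \<and> finite (lhd N) \<and> finite (Map.graph (mark N))"
    and ext: "lab N \<in> extensional (events N)"
    if "N \<in> fcMSC Q Ns" for N :: "(nat, nat, nat) cmsc" and Q Ns
  proof -
    have fe: "finite (events N)" and le: "le N \<subseteq> events N \<times> events N" and lhd: "lhd N \<subseteq> le N"
      and dom: "dom (mark N) \<subseteq> events N" and l: "lab N \<in> events N \<rightarrow>\<^sub>E Act Q"
      using that by (auto simp: fcMSC_def is_cmsc_def unm_def partial_order_on_def preorder_on_def)
    have "finite (le N)" using fe le by (meson finite_SigmaI finite_subset)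
    moreover have "finite (Map.graph (mark N))"
      using fe dom by (simp add: finite_graph_iff_finite_dom finite_subset)
    ultimately show "finite (events N) \<and> finite (le N) \<and> finite (lhd N) \<and> finite (Map.graph (mark N))"
      using fe lhd finite_subset by blast
    show "lab N \<in> extensional (events N)" using l by (simp add: PiE_def)
  qed
  note f1 = fin[OF assms(1)] and f2 = fin[OF assms(2)]
  have inj: "prod_encode ` A = prod_encode ` B \<longleftrightarrow> A = B" for A B
    by (simp add: inj_image_eq_iff inj_prod_encode)
  have seteq: "A = B" if "set_encode A = set_encode B" "finite A" "finite B" for A B
    using that by (simp add: set_encode_eq)
  have c: "set_encode (events M) = set_encode (events M')"
    "set_encode (prod_encode ` le M) = set_encode (prod_encode ` le M')"
    "set_encode (prod_encode ` lhd M) = set_encode (prod_encode ` lhd M')"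
    "set_encode ((\<lambda>e. prod_encode (e, act_code (lab M e))) ` events M) =
       set_encode ((\<lambda>e. prod_encode (e, act_code (lab M' e))) ` events M')"
    "set_encode (prod_encode ` Map.graph (mark M)) = set_encode (prod_encode ` Map.graph (mark M'))"
    using assms(3) unfolding cmsc_code_def list_encode_eq list.inject by blast+
  have ev: "events M = events M'"
    using seteq[OF c(1)] f1 f2 by blast
  have le: "le M = le M'"
    using seteq[OF c(2)] f1 f2 inj by blast
  have lhd: "lhd M = lhd M'"
    using seteq[OF c(3)] f1 f2 inj by blast
  have lb: "(\<lambda>e. prod_encode (e, act_code (lab M e))) ` events M =
       (\<lambda>e. prod_encode (e, act_code (lab M' e))) ` events M'"
    using seteq[OF c(4)] f1 f2 by blast
  have gr: "Map.graph (mark M) = Map.graph (mark M')"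
    using seteq[OF c(5)] f1 f2 inj by blast
  have "lab M e = lab M' e" if "e \<in> events M" for e
  proof -
    have "prod_encode (e, act_code (lab M e)) \<in>
        (\<lambda>e. prod_encode (e, act_code (lab M' e))) ` events M'"
      using lb that by blast
    then show ?thesis by (auto simp: act_code_eq)
  qed
  then have lab: "lab M = lab M'"
    using ext[OF assms(1)] ext[OF assms(2)] ev by (auto intro: extensionalityI)
  have mark: "mark M = mark M'"
  proof
    fix e
    have "mark M e = Some m \<longleftrightarrow> mark M' e = Some m" for m
      using gr by (auto simp: Map.graph_def)
    then show "mark M e = mark M' e" by (metis option.exhaust)
  qed
  show ?thesis using ev le lhd lab mark by simp
qed

lemma hmsc_code_inj: "inj_on hmsc_code {(P, H). finite P \<and> is_hmsc P H}"
proof (rule inj_onI, clarify)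
  fix P P' and H H' :: "(nat, nat, nat, nat) hmsc"
  assume P: "finite P" "finite P'" and H: "is_hmsc P H" and H': "is_hmsc P' H'"
    and eq: "hmsc_code (P, H) = hmsc_code (P', H')"
  have f: "finite (states K)" "finite (msgs K)" "finite (trans_rel K)" "finite (fin K)"
      "finite (fin_omega K)" if "is_hmsc Q K" for Q and K :: "(nat, nat, nat, nat) hmsc"
    using that finite_subset by (auto simp: is_hmsc_def)
  have PP: "P = P'" and s: "states H = states H'" "init H = init H'" "msgs H = msgs H'"
    "fin H = fin H'" "fin_omega H = fin_omega H'"
    and t: "trans_code ` trans_rel H = trans_code ` trans_rel H'"
    using eq P f[OF H] f[OF H']
    by (simp_all add: hmsc_code_def list_encode_eq set_encode_eq del: list_encode.simps)
  have "inj_on trans_code (UNIV \<times> fcMSC P (msgs H) \<times> UNIV)"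
    by (rule inj_onI)
      (auto simp: trans_code_def src_def msc_of_def tgt_def list_encode_eq
        simp del: list_encode.simps intro: cmsc_code_inj)
  moreover have "trans_rel H \<subseteq> UNIV \<times> fcMSC P (msgs H) \<times> UNIV"
    and "trans_rel H' \<subseteq> UNIV \<times> fcMSC P (msgs H) \<times> UNIV"
    using H H' PP s by (auto simp: is_hmsc_def)
  ultimately have "trans_rel H = trans_rel H'"
    using t by (simp add: inj_on_image_eq_iff)
  then show "P = P' \<and> H = H'" using PP s by simp
qed

end

theory Submission
  imports Defs
begin

text \<open>Two processes suffice. Process \<open>0\<close> sends unmatched messages to process \<open>1\<close>, which are received later:
  by the FIFO condition, a path of the HMSC behaves like a run of a finite automaton with one queue,
  and a product without unmatched events corresponds to a run from the empty queue to the empty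
  queue. A matched message from \<open>1\<close> to \<open>0\<close> in every transition makes all loops connected.
  Queue automata simulate counter machines, and these compute all partial recursive functions.

  For the undecidability, let the control part \<open>A\<close> of an automaton be coded by the number \<open>n\<close> that its
  transitions contribute to \<open>hmsc_code\<close>. Prefixing \<open>A\<close> with transitions that write its own input \<open>n\<close>
  to the queue gives an HMSC whose code is a computable function \<open>h\<close> of \<open>n\<close> alone, so neither a
  universal function nor a computable compiler is needed. If \<open>d\<close> decided nonemptiness, an automaton \<open>A\<close>
  halting on \<open>n\<close> iff \<open>d (h n) = 0\<close>, started on its own number, would yield a contradiction.\<close>

section \<open>Nondeterministic programs and their automata\<close>

text \<open>A concatenation may leave any event unmatched, so the queue discipline has to be
  extracted from \<open>is_cmsc\<close>: matched sends precede unmatched sends of the same action,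
  hence a receive that gets a message takes the oldest pending one. New edges only lead to later
  factors, so a receive left pending can never be matched afterwards and spoils membership in
  \<open>MSC\<close>.

  The code of the diagonal HMSC depends on \<open>n\<close> alone for two reasons.
  \<open>set_encode\<close> is a sum of powers of two, so disjoint sets of transitions contribute
  independently. And a code bounds every number coded in it, so the sets of states and messages can
  be initial segments whose lengths are computed from \<open>n\<close>. Parity of the states
  separates the automaton from the transitions that write its input, both in runs and in
  codes.\<close>

datatype (rex_atoms: 'a) rex = Fail | Skip | Atom 'a | Seq "'a rex" "'a rex" | Alt "'a rex" "'a rex" | Star "'a rex"

text \<open>Relational semantics: choices are nondeterministic, and an atom that does not apply,
  such as a failing test, blocks. A loop with a condition is a \<open>Star\<close> combined with
  blocking tests.\<close>

primrec exec :: "('a \<Rightarrow> 's \<Rightarrow> 's \<Rightarrow> bool) \<Rightarrow> 'a rex \<Rightarrow> 's \<Rightarrow> 's \<Rightarrow> bool" where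
  "exec st Fail = (\<lambda>_ _. False)"
| "exec st Skip = (=)"
| "exec st (Atom a) = st a"
| "exec st (Seq r s) = exec st r OO exec st s"
| "exec st (Alt r s) = (\<lambda>x y. exec st r x y \<or> exec st s x y)"
| "exec st (Star r) = (exec st r)\<^sup>*\<^sup>*"

definition seqs :: "'a rex list \<Rightarrow> 'a rex" where
  "seqs rs = foldr Seq rs Skip"

definition alts :: "'a rex list \<Rightarrow> 'a rex" where
  "alts rs = foldr Alt rs Fail"

lemma exec_seqs_Nil [simp]: "exec st (seqs []) = (=)"
  by (simp add: seqs_def)

lemma exec_seqs_Cons [simp]: "exec st (seqs (r # rs)) = exec st r OO exec st (seqs rs)"
  by (simp add: seqs_def)

lemma exec_alts: "exec st (alts rs) x y \<longleftrightarrow> (\<exists>r\<in>set rs. exec st r x y)"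
  by (induction rs) (auto simp: alts_def)

primrec bind_rex :: "('a \<Rightarrow> 'b rex) \<Rightarrow> 'a rex \<Rightarrow> 'b rex" where
  "bind_rex f Fail = Fail"
| "bind_rex f Skip = Skip"
| "bind_rex f (Atom a) = f a"
| "bind_rex f (Seq r s) = Seq (bind_rex f r) (bind_rex f s)"
| "bind_rex f (Alt r s) = Alt (bind_rex f r) (bind_rex f s)"
| "bind_rex f (Star r) = Star (bind_rex f r)"

text \<open>Simulation lifts from atoms to programs, where \<open>rep x s\<close> says that the
  concrete state \<open>x\<close> represents \<open>s\<close>. Only atoms of \<open>r\<close> need a
  faithful implementation, so a representation of finitely many registers is enough.\<close>

lemma exec_bind_rex_sound:
  assumes "\<And>a x s x'. a \<in> rex_atoms r \<Longrightarrow> rep x s \<Longrightarrow> exec st (f a) x x' \<Longrightarrow> \<exists>s'. st' a s s' \<and> rep x' s'"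
    and "rep x s" and "exec st (bind_rex f r) x x'"
  shows "\<exists>s'. exec st' r s s' \<and> rep x' s'"
  using assms
proof (induction r arbitrary: x s x')
  case (Seq r1 r2)
  from Seq.prems(3) obtain y where y: "exec st (bind_rex f r1) x y" "exec st (bind_rex f r2) y x'"
    by auto
  obtain t where "exec st' r1 s t" "rep y t"
    using Seq.IH(1)[OF _ Seq.prems(2) y(1)] Seq.prems(1) by auto
  moreover obtain s' where "exec st' r2 t s'" "rep x' s'"
    using Seq.IH(2)[OF _ \<open>rep y t\<close> y(2)] Seq.prems(1) by auto
  ultimately show ?case by auto
next
  case (Alt r1 r2)
  then show ?case by simp metis
next
  case (Star r)
  have "(exec st (bind_rex f r))\<^sup>*\<^sup>* x x'" using Star.prems(3) by simp
  then show ?case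
  proof induction
    case base
    then show ?case using Star.prems(2) by auto
  next
    case (step y z)
    then obtain t where t: "exec st' (Star r) s t" "rep y t" by auto
    obtain t' where "exec st' r t t'" "rep z t'"
      using Star.IH[OF _ t(2) step(2)] Star.prems(1) by auto
    then show ?case using t(1) by (auto intro: rtranclp.rtrancl_into_rtrancl)
  qed
qed auto

lemma exec_bind_rex_complete:
  assumes "\<And>a x s s'. a \<in> rex_atoms r \<Longrightarrow> rep x s \<Longrightarrow> st' a s s' \<Longrightarrow> \<exists>x'. exec st (f a) x x' \<and> rep x' s'"
    and "rep x s" and "exec st' r s s'"
  shows "\<exists>x'. exec st (bind_rex f r) x x' \<and> rep x' s'"
  using assms
proof (induction r arbitrary: x s s')
  case (Seq r1 r2)
  from Seq.prems(3) obtain t where t: "exec st' r1 s t" "exec st' r2 t s'"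
    by auto
  obtain y where "exec st (bind_rex f r1) x y" "rep y t"
    using Seq.IH(1)[OF _ Seq.prems(2) t(1)] Seq.prems(1) by auto
  moreover obtain x' where "exec st (bind_rex f r2) y x'" "rep x' s'"
    using Seq.IH(2)[OF _ \<open>rep y t\<close> t(2)] Seq.prems(1) by auto
  ultimately show ?case by auto
next
  case (Alt r1 r2)
  then show ?case by simp metis
next
  case (Star r)
  have "(exec st' r)\<^sup>*\<^sup>* s s'" using Star.prems(3) by simp
  then show ?case
  proof induction
    case base
    then show ?case using Star.prems(2) by auto
  next
    case (step t u)
    then obtain y where y: "exec st (bind_rex f (Star r)) x y" "rep y t" by auto
    obtain z where "exec st (bind_rex f r) y z" "rep z u"
      using Star.IH[OF _ y(2) step(2)] Star.prems(1) by auto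
    then show ?case using y(1) by (auto intro: rtranclp.rtrancl_into_rtrancl)
  qed
qed auto

text \<open>The control states are the lists of programs that remain to be executed; only finitely many
  of them are reachable.\<close>

primrec rex_trans :: "'a rex \<Rightarrow> 'a rex list \<Rightarrow> ('a rex list \<times> 'a option \<times> 'a rex list) set" where
  "rex_trans Fail k = {}"
| "rex_trans Skip k = {(Skip # k, None, k)}"
| "rex_trans (Atom a) k = {(Atom a # k, Some a, k)}"
| "rex_trans (Seq r s) k =
     {(Seq r s # k, None, r # s # k)} \<union> rex_trans r (s # k) \<union> rex_trans s k"
| "rex_trans (Alt r s) k =
     {(Alt r s # k, None, r # k), (Alt r s # k, None, s # k)} \<union> rex_trans r k \<union> rex_trans s k"
| "rex_trans (Star r) k =
     {(Star r # k, None, k), (Star r # k, None, r # Star r # k)} \<union> rex_trans r (Star r # k)"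

section \<open>Runs of the automaton of a program\<close>

lemma finite_rex_trans [simp]: "finite (rex_trans r k)"
  by (induction r arbitrary: k) auto

primrec opt_step :: "('a \<Rightarrow> 's \<Rightarrow> 's \<Rightarrow> bool) \<Rightarrow> 'a option \<Rightarrow> 's \<Rightarrow> 's \<Rightarrow> bool" where
  "opt_step st None = (=)"
| "opt_step st (Some a) = st a"

definition conf_step ::
  "('a \<Rightarrow> 's \<Rightarrow> 's \<Rightarrow> bool) \<Rightarrow> ('q \<times> 'a option \<times> 'q) set \<Rightarrow> 'q \<times> 's \<Rightarrow> 'q \<times> 's \<Rightarrow> bool" where
  "conf_step st T = (\<lambda>(k, x) (k', x'). \<exists>a. (k, a, k') \<in> T \<and> opt_step st a x x')"

lemma conf_step_iff [simp]:
  "conf_step st T (k, x) (k', x') \<longleftrightarrow> (\<exists>a. (k, a, k') \<in> T \<and> opt_step st a x x')"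
  by (simp add: conf_step_def)

lemma conf_step_mono: "T \<subseteq> T' \<Longrightarrow> (conf_step st T)\<^sup>*\<^sup>* c c' \<Longrightarrow> (conf_step st T')\<^sup>*\<^sup>* c c'"
  by (erule mono_rtranclp[rule_format, rotated]) (fastforce simp: conf_step_def)

text \<open>Each transition is one unfolding of the semantics of the list of programs, so executions
  are assembled from the end of a run backwards.\<close>

lemma rex_trans_sound:
  assumes "(k, a, k') \<in> rex_trans r k0" and "opt_step st a x y" and "exec st (seqs k') y z"
  shows "exec st (seqs k) x z"
  using assms
proof (induction r arbitrary: k0)
  case (Star r)
  have "exec st (Star r) x u" if "exec st r x w" "exec st (Star r) w u" for w u
    using that by (auto intro: converse_rtranclp_into_rtranclp)
  then have unfold: "exec st (seqs (Star r # k0)) x z" if "exec st (seqs (r # Star r # k0)) x z"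
    using that by (auto simp del: exec.simps)
  from Star.prems(1) consider "(k, a, k') = (Star r # k0, None, k0)"
    | "(k, a, k') = (Star r # k0, None, r # Star r # k0)" | "(k, a, k') \<in> rex_trans r (Star r # k0)"
    by auto
  then show ?case
  proof cases
    case 1
    then show ?thesis using Star.prems by auto
  next
    case 2
    then show ?thesis using Star.prems unfold by (simp del: exec_seqs_Cons)
  qed (use Star in blast)
qed (auto simp: relcompp_assoc)

lemma conf_step_rex_sound:
  assumes "(conf_step st (rex_trans r k0))\<^sup>*\<^sup>* (k, x) ([], z)"
  shows "exec st (seqs k) x z"
  using assms
proof (induction "(k, x)" arbitrary: k x rule: converse_rtranclp_induct)
  case (step c)
  then show ?case by (cases c) (auto intro: rex_trans_sound)
qed simp

text \<open>The continuation \<open>k\<close> stays untouched below the program. It is kept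
  arbitrary because subprograms run on longer continuations; \<open>conf_step_mono\<close> embeds
  their transition sets.\<close>

lemma conf_step_rex_complete:
  assumes "exec st r x z"
  shows "(conf_step st (rex_trans r k))\<^sup>*\<^sup>* (r # k, x) (k, z)"
  using assms
proof (induction r arbitrary: k x z)
  case (Seq r s)
  let ?R = "conf_step st (rex_trans (Seq r s) k)"
  from Seq.prems obtain y where y: "exec st r x y" "exec st s y z" by auto
  have "?R\<^sup>*\<^sup>* (r # s # k, x) (s # k, y)"
    by (rule conf_step_mono[OF _ Seq.IH(1)[OF y(1)]]) auto
  moreover have "?R\<^sup>*\<^sup>* (s # k, y) (k, z)"
    by (rule conf_step_mono[OF _ Seq.IH(2)[OF y(2)]]) auto
  moreover have "?R (Seq r s # k, x) (r # s # k, x)" by (auto intro!: exI[of _ None])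
  ultimately show ?case by (meson converse_rtranclp_into_rtranclp rtranclp_trans)
next
  case (Alt r s)
  let ?R = "conf_step st (rex_trans (Alt r s) k)"
  have r: "?R (Alt r s # k, x) (r # k, x)" and s: "?R (Alt r s # k, x) (s # k, x)"
    by (auto intro!: exI[of _ None])
  from Alt.prems consider "exec st r x z" | "exec st s x z" by auto
  then show ?case
  proof cases
    case 1
    have "?R\<^sup>*\<^sup>* (r # k, x) (k, z)"
      by (rule conf_step_mono[OF _ Alt.IH(1)[OF 1]]) auto
    then show ?thesis using r by (meson converse_rtranclp_into_rtranclp)
  next
    case 2
    have "?R\<^sup>*\<^sup>* (s # k, x) (k, z)"
      by (rule conf_step_mono[OF _ Alt.IH(2)[OF 2]]) auto
    then show ?thesis using s by (meson converse_rtranclp_into_rtranclp)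
  qed
next
  case (Star r)
  let ?R = "conf_step st (rex_trans (Star r) k)"
  have "(exec st r)\<^sup>*\<^sup>* x z" using Star.prems by simp
  then have "?R\<^sup>*\<^sup>* (Star r # k, x) (Star r # k, z)"
  proof induction
    case (step y z)
    have "?R\<^sup>*\<^sup>* (r # Star r # k, y) (Star r # k, z)"
      by (rule conf_step_mono[OF _ Star.IH[OF step(2)]]) auto
    moreover have "?R (Star r # k, y) (r # Star r # k, y)" by (auto intro!: exI[of _ None])
    ultimately show ?case using step(3) by (meson converse_rtranclp_into_rtranclp rtranclp_trans)
  qed simp
  moreover have "?R (Star r # k, z) (k, z)" by (auto intro!: exI[of _ None])
  ultimately show ?case by (meson rtranclp.rtrancl_into_rtrancl)
qed (auto intro!: r_into_rtranclp exI[of _ None] exI[of _ "Some _"])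

section \<open>Counter programs for partial recursive functions\<close>

datatype ctr_act = Inc nat | Dec nat | IsZero nat

fun ctr_step :: "ctr_act \<Rightarrow> (nat \<Rightarrow> nat) \<Rightarrow> (nat \<Rightarrow> nat) \<Rightarrow> bool" where
  "ctr_step (Inc r) s s' \<longleftrightarrow> s' = s(r := Suc (s r))"
| "ctr_step (Dec r) s s' \<longleftrightarrow> s r > 0 \<and> s' = s(r := s r - 1)"
| "ctr_step (IsZero r) s s' \<longleftrightarrow> s r = 0 \<and> s' = s"

abbreviation cexec :: "ctr_act rex \<Rightarrow> (nat \<Rightarrow> nat) \<Rightarrow> (nat \<Rightarrow> nat) \<Rightarrow> bool" where
  "cexec \<equiv> exec ctr_step"

text \<open>A while loop over a counter: leaving \<open>Star\<close> too early is blocked by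
  \<open>IsZero\<close>, going on at zero by \<open>Dec\<close>.\<close>

definition loop_dec :: "nat \<Rightarrow> ctr_act rex \<Rightarrow> ctr_act rex" where
  "loop_dec r p = Seq (Star (Seq (Atom (Dec r)) p)) (Atom (IsZero r))"

text \<open>Induction on the value of \<open>r\<close>: a body that acts as a function
  \<open>F\<close> and leaves \<open>r\<close> alone is iterated exactly \<open>s r\<close>
  times.\<close>

lemma cexec_loop_dec:
  assumes step: "\<And>s s'. I s \<Longrightarrow> cexec p s s' \<longleftrightarrow> s' = F s"
    and inv: "\<And>s. I s \<Longrightarrow> 0 < s r \<Longrightarrow> I (s(r := s r - 1)) \<and> I (F (s(r := s r - 1)))"
    and dec: "\<And>s. I s \<Longrightarrow> F s r = s r"
    and "I s"
  shows "cexec (loop_dec r p) s s' \<longleftrightarrow> s' = ((\<lambda>s. F (s(r := s r - 1))) ^^ s r) s"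
  using \<open>I s\<close>
proof (induction "s r" arbitrary: s)
  case 0
  have "(ctr_step (Dec r) OO cexec p)\<^sup>*\<^sup>* s t \<longleftrightarrow> t = s" for t
    using 0(1) by (auto elim: converse_rtranclpE)
  then show ?case using 0(1)[symmetric] by (auto simp: loop_dec_def OO_def)
next
  case (Suc m)
  let ?G = "\<lambda>s. F (s(r := s r - 1))"
  have m: "m = ?G s r" using Suc(2) dec inv[OF Suc(3)] by simp
  have "cexec (loop_dec r p) s s' \<longleftrightarrow> cexec (loop_dec r p) (?G s) s'"
    using Suc(2) inv[OF Suc(3)] step[of "s(r := s r - 1)"]
    by (auto simp: loop_dec_def OO_def elim: converse_rtranclpE intro: converse_rtranclp_into_rtranclp)
  also have "\<dots> \<longleftrightarrow> s' = (?G ^^ (?G s r)) (?G s)"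
  proof (rule Suc(1)[of "?G s"])
    have "0 < s r" using Suc(2) by linarith
    then show "I (?G s)" using inv[OF Suc(3)] by blast
  qed (fact m)
  also have "(?G ^^ (?G s r)) (?G s) = (?G ^^ Suc m) s"
    by (simp only: m[symmetric] funpow_Suc_right comp_apply)
  also have "(?G ^^ Suc m) s = (?G ^^ s r) s"
    by (simp only: Suc(2))
  finally show ?case .
qed

definition clear :: "nat \<Rightarrow> ctr_act rex" where
  "clear r = loop_dec r Skip"

definition move :: "nat \<Rightarrow> nat \<Rightarrow> ctr_act rex" where
  "move r t = loop_dec r (Atom (Inc t))"

text \<open>A counter is read by emptying it: \<open>r\<close> is poured into \<open>t\<close> and
  \<open>u\<close> at once, then \<open>u\<close> is poured back into \<open>r\<close>.\<close>

definition copy :: "nat \<Rightarrow> nat \<Rightarrow> nat \<Rightarrow> ctr_act rex" where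
  "copy r t u = Seq (loop_dec r (Seq (Atom (Inc t)) (Atom (Inc u)))) (move u r)"

lemma cexec_clear [simp]: "cexec (clear r) s s' \<longleftrightarrow> s' = s(r := 0)"
proof -
  have "((\<lambda>s. s(r := s r - 1)) ^^ n) s = s(r := s r - n)" for n
    by (induction n) auto
  then show ?thesis
    unfolding clear_def
    by (subst cexec_loop_dec[where I = "\<lambda>_. True" and F = "\<lambda>s. s"]) auto
qed

lemma cexec_move:
  assumes "r \<noteq> t"
  shows "cexec (move r t) s s' \<longleftrightarrow> s' = s(r := 0, t := s t + s r)"
proof -
  let ?F = "\<lambda>s. s(t := Suc (s t))"
  have "((\<lambda>s. ?F (s(r := s r - 1))) ^^ n) s = s(r := s r - n, t := s t + n)" for n
    using assms by (induction n) (auto simp: fun_eq_iff)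
  then show ?thesis
    unfolding move_def using assms
    by (subst cexec_loop_dec[where I = "\<lambda>_. True" and F = ?F]) auto
qed

lemma cexec_copy:
  assumes "r \<noteq> t" "r \<noteq> u" "t \<noteq> u" "s u = 0"
  shows "cexec (copy r t u) s s' \<longleftrightarrow> s' = s(t := s t + s r)"
proof -
  let ?F = "\<lambda>s. s(t := Suc (s t), u := Suc (s u))"
  have "((\<lambda>s. ?F (s(r := s r - 1))) ^^ n) s = s(r := s r - n, t := s t + n, u := s u + n)" for n
    using assms by (induction n) (auto simp: fun_eq_iff)
  then have "cexec (loop_dec r (Seq (Atom (Inc t)) (Atom (Inc u)))) s s' \<longleftrightarrow>
      s' = s(r := 0, t := s t + s r, u := s u + s r)" for s'
    using assms
    by (subst cexec_loop_dec[where I = "\<lambda>_. True" and F = ?F]) (auto simp: OO_def)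
  moreover have "s(r := 0, t := s t + s r, u := 0, r := s r) = s(t := s t + s r)"
    using assms by (auto simp: fun_eq_iff)
  ultimately show ?thesis
    using assms by (simp add: copy_def OO_def cexec_move)
qed

\<comment> \<open>Compilation of recursive functions to counter programs\<close>
inductive_simps rec_eval_Zero [simp]: "rec_eval Zero xs y"
inductive_simps rec_eval_Succ: "rec_eval Succ xs y"
inductive_simps rec_eval_Proj [simp]: "rec_eval (Proj i) xs y"
inductive_simps rec_eval_Comp: "rec_eval (Comp f gs) xs y"
inductive_simps rec_eval_PrimRec_Nil [simp]: "rec_eval (PrimRec f g) [] y"
inductive_simps rec_eval_PrimRec_0 [simp]: "rec_eval (PrimRec f g) (0 # xs) y"
inductive_simps rec_eval_PrimRec_Suc [simp]: "rec_eval (PrimRec f g) (Suc n # xs) y"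
inductive_simps rec_eval_Mu: "rec_eval (Mu f) xs y"

text \<open>\<open>compile f ins out b\<close> reads its arguments from the registers \<open>ins\<close> and writes the result to
  \<open>out\<close>; registers from \<open>b\<close> upwards are scratch space, which is zero before and after.\<close>

fun compile :: "recf \<Rightarrow> nat list \<Rightarrow> nat \<Rightarrow> nat \<Rightarrow> ctr_act rex"
  and compiles :: "recf list \<Rightarrow> nat list \<Rightarrow> nat \<Rightarrow> nat \<Rightarrow> ctr_act rex" where
  "compile Zero ins out b = Skip"
| "compile Succ ins out b = (case ins of [r] \<Rightarrow> Seq (copy r out b) (Atom (Inc out)) | _ \<Rightarrow> Fail)"
| "compile (Proj i) ins out b = (if i < length ins then copy (ins ! i) out b else Fail)"
| "compile (Comp f gs) ins out b =
     (let c = b + length gs in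
      seqs (compiles gs ins b c # compile f [b..<c] out c # map clear [b..<c]))"
| "compile (PrimRec f g) ins out b = (case ins of [] \<Rightarrow> Fail | r # xs \<Rightarrow>
     seqs [copy r b (Suc b), compile f xs (b + 2) (b + 4),
       Star (seqs [Atom (Dec b), compile g ((b + 1) # (b + 2) # xs) (b + 3) (b + 4),
         clear (b + 2), move (b + 3) (b + 2), Atom (Inc (b + 1))]),
       Atom (IsZero b), clear (b + 1), move (b + 2) out])"
| "compile (Mu f) ins out b =
     seqs [Star (seqs [compile f (b # ins) (b + 1) (b + 2), Atom (Dec (b + 1)), clear (b + 1), Atom (Inc b)]),
       compile f (b # ins) (b + 1) (b + 2), Atom (IsZero (b + 1)), move b out]"
| "compiles [] ins t b = Skip"
| "compiles (g # gs) ins t b = Seq (compile g ins t b) (compiles gs ins (Suc t) b)"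

definition upds :: "(nat \<Rightarrow> nat) \<Rightarrow> nat \<Rightarrow> nat list \<Rightarrow> nat \<Rightarrow> nat" where
  "upds s t ys = (\<lambda>j. if t \<le> j \<and> j < t + length ys then ys ! (j - t) else s j)"

lemma upds_Nil [simp]: "upds s t [] = s"
  by (auto simp: upds_def)

lemma upds_Cons: "upds s t (y # ys) = upds (s(t := y)) (Suc t) ys"
  by (auto simp: upds_def fun_eq_iff nth_Cons split: nat.split) (metis Suc_diff_le Suc_diff_Suc diff_Suc_Suc le_eq_less_or_eq old.nat.inject)

lemma cexec_clears:
  "cexec (seqs (map clear [b..<c])) s s' \<longleftrightarrow> s' = (\<lambda>j. if b \<le> j \<and> j < c then 0 else s j)"
proof (induction "c - b" arbitrary: b s)
  case 0
  then show ?case by (auto simp: fun_eq_iff)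
next
  case (Suc n)
  then have "[b..<c] = b # [Suc b..<c]" by (simp add: upt_conv_Cons)
  moreover have "(\<lambda>j. if Suc b \<le> j \<and> j < c then 0 else (s(b := 0)) j) =
      (\<lambda>j. if b \<le> j \<and> j < c then 0 else s j)"
    using Suc.hyps(2) by (auto simp: fun_eq_iff)
  ultimately show ?case using Suc.hyps(1)[of "Suc b"] Suc.hyps(2)
    by (simp add: OO_def)
qed

lemma cexec_step_tail:
  assumes "r1 \<noteq> r2" "r1 \<noteq> r3" "r2 \<noteq> r3"
  shows "cexec (seqs [clear r2, move r3 r2, Atom (Inc r1)]) s u \<longleftrightarrow>
    u = s(r2 := s r3, r3 := 0, r1 := Suc (s r1))"
proof -
  have "s(r2 := 0, r3 := 0, r2 := s r3, r1 := Suc (s r1)) = s(r2 := s r3, r3 := 0, r1 := Suc (s r1))"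
    using assms by (auto simp: fun_eq_iff)
  then show ?thesis using assms by (auto simp: OO_def cexec_move)
qed

text \<open>An equivalence: blocked or endless executions reach no final state, so the existence of
  a final state says that \<open>f\<close> is defined. Everything except \<open>out\<close> is
  restored, which lets subprograms share the scratch area. The second half stores the values of
  \<open>gs\<close> in \<open>t\<close>, \<open>t + 1\<close> and so on, below the scratch
  area.\<close>

lemma cexec_compile:
  "\<lbrakk>\<And>j. b \<le> j \<Longrightarrow> s j = 0; s out = 0; out < b; set ins \<subseteq> {..<b}; out \<notin> set ins\<rbrakk> \<Longrightarrow>
    cexec (compile f ins out b) s s' \<longleftrightarrow> (\<exists>y. rec_eval f (map s ins) y \<and> s' = s(out := y))"
  "\<lbrakk>\<And>j. t \<le> j \<Longrightarrow> s j = 0; t + length gs \<le> b; set ins \<subseteq> {..<t}\<rbrakk> \<Longrightarrow>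
    cexec (compiles gs ins t b) s s' \<longleftrightarrow>
      (\<exists>ys. list_all2 (\<lambda>g y. rec_eval g (map s ins) y) gs ys \<and> s' = upds s t ys)"
proof (induction f ins out b and gs ins t b arbitrary: s s' and s s' rule: compile_compiles.induct)
  case (1 ins out b)
  then show ?case by auto
next
  case (2 ins out b)
  show ?case
  proof (cases "\<exists>r. ins = [r]")
    case True
    then obtain r where r: "ins = [r]" by blast
    show ?thesis using 2 unfolding r
      by (auto simp: OO_def cexec_copy rec_eval_Succ)
  next
    case False
    then show ?thesis by (auto simp: rec_eval_Succ split: list.split)
  qed
next
  case (3 i ins out b)
  show ?case
  proof (cases "i < length ins")
    case True
    then have "ins ! i \<in> set ins" by simp
    then have "ins ! i < b" "ins ! i \<noteq> out" using 3 by auto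
    then show ?thesis using 3 True by (simp add: cexec_copy fun_upd_def)
  qed auto
next
  case (4 f gs ins out b)
  \<comment> \<open>The values of \<open>gs\<close> occupy the registers from \<open>b\<close> to
    \<open>c - 1\<close>, where \<open>f\<close> reads them; the scratch area of all these calls
    begins at \<open>c\<close>.\<close>
  define c where "c = b + length gs"
  have gs: "cexec (compiles gs ins b c) s u \<longleftrightarrow>
      (\<exists>ys. list_all2 (\<lambda>g y. rec_eval g (map s ins) y) gs ys \<and> u = upds s b ys)" for u
    using 4 by (intro "4.IH"(1)) (auto simp: c_def)
  have f: "cexec (compile f [b..<c] out c) (upds s b ys) u \<longleftrightarrow>
      (\<exists>y. rec_eval f ys y \<and> u = (upds s b ys)(out := y))"
    if "length ys = length gs" for ys u
  proof -
    have "map (upds s b ys) [b..<c] = ys"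
      using that by (intro nth_equalityI) (auto simp: upds_def c_def)
    moreover have "cexec (compile f [b..<c] out c) (upds s b ys) u \<longleftrightarrow>
      (\<exists>y. rec_eval f (map (upds s b ys) [b..<c]) y \<and> u = (upds s b ys)(out := y))"
      using 4 that by (intro "4.IH"(2)) (auto simp: c_def upds_def)
    ultimately show ?thesis by simp
  qed
  have cl: "(\<lambda>j. if b \<le> j \<and> j < c then 0 else ((upds s b ys)(out := y)) j) = s(out := y)"
    if "length ys = length gs" for ys y
    using that 4(3,5) by (auto simp: fun_eq_iff upds_def c_def)
  have "cexec (compile (Comp f gs) ins out b) s s' \<longleftrightarrow>
    (\<exists>ys. list_all2 (\<lambda>g y. rec_eval g (map s ins) y) gs ys \<and>
      (\<exists>u. cexec (compile f [b..<c] out c) (upds s b ys) u \<and>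
        s' = (\<lambda>j. if b \<le> j \<and> j < c then 0 else u j)))"
    unfolding compile.simps Let_def c_def[symmetric]
    by (auto simp: OO_def gs cexec_clears)
  also have "\<dots> \<longleftrightarrow>
    (\<exists>ys. list_all2 (\<lambda>g y. rec_eval g (map s ins) y) gs ys \<and>
      (\<exists>y. rec_eval f ys y \<and> s' = s(out := y)))"
  proof (intro ex_cong1 conj_cong refl)
    fix ys
    assume "list_all2 (\<lambda>g y. rec_eval g (map s ins) y) gs ys"
    then have len: "length ys = length gs" by (simp add: list_all2_lengthD)
    show "(\<exists>u. cexec (compile f [b..<c] out c) (upds s b ys) u \<and>
        s' = (\<lambda>j. if b \<le> j \<and> j < c then 0 else u j)) \<longleftrightarrow> (\<exists>y. rec_eval f ys y \<and> s' = s(out := y))"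
      unfolding f[OF len] using cl[OF len] by auto
  qed
  finally show ?case unfolding rec_eval_Comp by blast
next
  case (5 f g ins out b)
  show ?case
  proof (cases ins)
    case Nil
    then show ?thesis by simp
  next
    case (Cons r xs)
    let ?vs = "map s xs" and ?n = "s r"
    \<comment> \<open>Register \<open>b\<close> counts the remaining rounds, \<open>b + 1\<close>
      the finished ones, and \<open>b + 2\<close> holds the current value; \<open>b + 3\<close>
      receives the next value.\<close>
    define S where "S c i y = s(b := c, b + 1 := i, b + 2 := y)" for c i y
    have xs: "b \<notin> set xs" "b + 1 \<notin> set xs" "b + 2 \<notin> set xs" "b + 3 \<notin> set xs" and rb: "r < b" "out < b"
      "out \<noteq> r"
      using 5(6,7,5) Cons by auto
    have z: "s j = 0" if "b \<le> j" for j using 5(3) that by blast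
    have map_S: "map (S c i y) xs = ?vs" for c i y
      using xs by (auto simp: S_def)
    have S_simps: "S c i y (b+1) = i" "S c i y (Suc b) = i" "S c i y (b + 2) = y" "S c i y (Suc (Suc b)) = y" "S c i y b = c" "S c i y (b + 3) = 0" for c i y
      by (auto simp: S_def z)
    define p where "p = seqs [Atom (Dec b), compile g ((b + 1) # (b + 2) # xs) (b + 3) (b + 4),
         clear (b + 2), move (b + 3) (b + 2), Atom (Inc (b + 1))]"
    have g: "cexec (compile g ((b + 1) # (b + 2) # xs) (b + 3) (b + 4)) (S c i y) u \<longleftrightarrow>
        (\<exists>z. rec_eval g (i # y # ?vs) z \<and> u = (S c i y)(b + 3 := z))" for c i y u
    proof -
      have "cexec (compile g ((b + 1) # (b + 2) # xs) (b + 3) (b + 4)) (S c i y) u \<longleftrightarrow>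
        (\<exists>z. rec_eval g (map (S c i y) ((b + 1) # (b + 2) # xs)) z \<and> u = (S c i y)(b + 3 := z))"
        using 5(6) xs Cons z by (intro "5.IH"(2)[OF Cons]) (auto simp: S_def)
      then show ?thesis by (simp add: map_S S_simps)
    qed
    have dec: "(S c i y)(b := c - 1) = S (c - 1) i y" for c i y
      by (auto simp: S_def)
    have p: "cexec p (S c i y) u \<longleftrightarrow> 0 < c \<and> (\<exists>z. rec_eval g (i # y # ?vs) z \<and> u = S (c - 1) (Suc i) z)"
      for c i y u
    proof -
      let ?t = "seqs [clear (b + 2), move (b + 3) (b + 2), Atom (Inc (b + 1))]"
      have t: "cexec ?t ((S c i y)(b + 3 := z)) u \<longleftrightarrow> u = S c (Suc i) z" for c z
      proof -
        have "((S c i y)(b + 3 := z))(b + 2 := ((S c i y)(b + 3 := z)) (b + 3), b + 3 := 0,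
            b + 1 := Suc (((S c i y)(b + 3 := z)) (b + 1))) = S c (Suc i) z"
          using z[of "b + 3"] by (auto simp: S_def fun_eq_iff)
        then show ?thesis by (subst cexec_step_tail) simp_all
      qed
      have "cexec p (S c i y) u \<longleftrightarrow> (\<exists>v w. ctr_step (Dec b) (S c i y) v \<and>
         cexec (compile g ((b + 1) # (b + 2) # xs) (b + 3) (b + 4)) v w \<and> cexec ?t w u)"
        unfolding p_def exec_seqs_Cons[of _ "Atom (Dec b)"] exec_seqs_Cons[of _ "compile _ _ _ _"]
          exec.simps(3) by blast
      also have "\<dots> \<longleftrightarrow> 0 < c \<and>
         (\<exists>w. cexec (compile g ((b + 1) # (b + 2) # xs) (b + 3) (b + 4)) (S (c - 1) i y) w \<and> cexec ?t w u)"
        using dec[of c i y] S_simps(5)[of c i y] by (simp only: ctr_step.simps) blast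
      also have "\<dots> \<longleftrightarrow> 0 < c \<and> (\<exists>z. rec_eval g (i # y # ?vs) z \<and> u = S (c - 1) (Suc i) z)"
        unfolding g using t[of "c - 1"] by blast
      finally show ?thesis .
    qed
    \<comment> \<open>\<open>Star\<close> may stop after any number \<open>k\<close> of rounds,
      holding the value of the recursion at \<open>k\<close>; the test \<open>IsZero b\<close> that
      follows leaves only \<open>k = ?n\<close>.\<close>
    have loop: "(cexec p)\<^sup>*\<^sup>* (S ?n 0 y0) u \<longleftrightarrow>
       (\<exists>k\<le>?n. \<exists>y. rec_eval (PrimRec f g) (k # ?vs) y \<and> u = S (?n - k) k y)"
      if y0: "rec_eval f ?vs y0" for y0 u
    proof
      assume "(cexec p)\<^sup>*\<^sup>* (S ?n 0 y0) u"
      then show "\<exists>k\<le>?n. \<exists>y. rec_eval (PrimRec f g) (k # ?vs) y \<and> u = S (?n - k) k y"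
      proof induction
        case base
        then show ?case using y0 by (intro exI[of _ 0]) auto
      next
        case (step u w)
        then obtain k y where k: "k \<le> ?n" "rec_eval (PrimRec f g) (k # ?vs) y" "u = S (?n - k) k y"
          by blast
        obtain z where z: "0 < ?n - k" "rec_eval g (k # y # ?vs) z" "w = S (?n - k - 1) (Suc k) z"
          using step(2) unfolding k(3) p by blast
        then show ?case using k by (intro exI[of _ "Suc k"]) auto
      qed
    next
      have "(cexec p)\<^sup>*\<^sup>* (S ?n 0 y0) (S (?n - k) k y)"
        if "k \<le> ?n" "rec_eval (PrimRec f g) (k # ?vs) y" for k y
        using that
      proof (induction k arbitrary: y)
        case 0
        then show ?case using y0 rec_eval_functional by fastforce
      next
        case (Suc k)
        then obtain y' where y': "rec_eval (PrimRec f g) (k # ?vs) y'" "rec_eval g (k # y' # ?vs) y"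
          by auto
        have "cexec p (S (?n - k) k y') (S (?n - Suc k) (Suc k) y)"
          using y' Suc.prems by (auto simp: p)
        then show ?case using Suc.IH[OF _ y'(1)] Suc.prems
          by (meson Suc_leD rtranclp.rtrancl_into_rtrancl)
      qed
      moreover assume "\<exists>k\<le>?n. \<exists>y. rec_eval (PrimRec f g) (k # ?vs) y \<and> u = S (?n - k) k y"
      ultimately show "(cexec p)\<^sup>*\<^sup>* (S ?n 0 y0) u" by blast
    qed
    have f: "cexec (compile f xs (b + 2) (b + 4)) (s(b := ?n)) u \<longleftrightarrow>
       (\<exists>y. rec_eval f ?vs y \<and> u = S ?n 0 y)" for u
    proof -
      have "map (s(b := ?n)) xs = ?vs" using xs by auto
      moreover have "(s(b := ?n))(b + 2 := y) = S ?n 0 y" for y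
        using z by (auto simp: S_def fun_eq_iff)
      moreover have "cexec (compile f xs (b + 2) (b + 4)) (s(b := ?n)) u \<longleftrightarrow>
        (\<exists>y. rec_eval f (map (s(b := ?n)) xs) y \<and> u = (s(b := ?n))(b + 2 := y))"
        using 5(6) xs Cons z by (intro "5.IH"(1)[OF Cons]) auto
      ultimately show ?thesis by (simp only:)
    qed
    have fin: "(S 0 k y)(b + 1 := 0, b + 2 := 0, out := y) = s(out := y)" for k y
      using z by (auto simp: S_def fun_eq_iff)
    have c: "cexec (copy r b (Suc b)) s u \<longleftrightarrow> u = s(b := ?n)" for u
      using rb z by (subst cexec_copy) auto
    have move: "cexec (move (b + 2) out) ((S 0 k y)(b + 1 := 0)) u \<longleftrightarrow> u = s(out := y)" for u k y
    proof -
      have "cexec (move (b + 2) out) ((S 0 k y)(b + 1 := 0)) u \<longleftrightarrow>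
         u = (S 0 k y)(b + 1 := 0, b + 2 := 0, out := y)"
        using rb 5(4) by (subst cexec_move) (auto simp: S_def)
      then show ?thesis unfolding fin .
    qed
    have "compile (PrimRec f g) ins out b = seqs [copy r b (Suc b), compile f xs (b + 2) (b + 4),
        Star p, Atom (IsZero b), clear (b + 1), move (b + 2) out]"
      by (simp add: Cons p_def)
    then have "cexec (compile (PrimRec f g) ins out b) s s' \<longleftrightarrow>
      (\<exists>y0 u. rec_eval f ?vs y0 \<and> (cexec p)\<^sup>*\<^sup>* (S ?n 0 y0) u \<and> u b = 0 \<and>
        cexec (move (b + 2) out) (u(b + 1 := 0)) s')"
      by (simp only: exec_seqs_Cons exec_seqs_Nil exec.simps OO_def c f ctr_step.simps cexec_clear simp_thms) blast
    also have "\<dots> \<longleftrightarrow> (\<exists>y. rec_eval (PrimRec f g) (?n # ?vs) y \<and> s' = s(out := y))" (is "?l \<longleftrightarrow> ?r")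
    proof
      assume ?l
      then obtain y0 k y where *: "rec_eval f ?vs y0" "k \<le> ?n" "rec_eval (PrimRec f g) (k # ?vs) y"
        "?n - k = 0" "cexec (move (b + 2) out) ((S (?n - k) k y)(b + 1 := 0)) s'"
        by (auto simp: loop S_simps)
      then have "k = ?n" by simp
      then show ?r using * move[of k y] by auto
    next
      assume ?r
      then obtain y where y: "rec_eval (PrimRec f g) (?n # ?vs) y" "s' = s(out := y)" by blast
      have "\<exists>y0. rec_eval f ?vs y0" if "rec_eval (PrimRec f g) (k # ?vs) y" for k y
        using that by (induction k arbitrary: y) auto
      then obtain y0 where y0: "rec_eval f ?vs y0" using y(1) by blast
      have "(cexec p)\<^sup>*\<^sup>* (S ?n 0 y0) (S 0 ?n y)" unfolding loop[OF y0] using y(1)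
        by (intro exI[of _ ?n] conjI exI[of _ y]) auto
      then show ?l using y0 y(2) move[of ?n y] S_simps(5)[of 0 ?n y] by blast
    qed
    finally show ?thesis unfolding Cons by (simp only: list.map)
  qed
next
  case (6 f ins out b)
  let ?vs = "map s ins"
  define S where "S i = s(b := i)" for i
  have ins: "b \<notin> set ins" "b + 1 \<notin> set ins"
    using "6.prems"(4) by auto
  have z: "s j = 0" if "b \<le> j" for j
    using "6.prems"(1) that by auto
  have bo: "b \<noteq> out" using "6.prems"(3) by simp
  have f: "cexec (compile f (b # ins) (b + 1) (b + 2)) (S i) u \<longleftrightarrow>
     (\<exists>y. rec_eval f (i # ?vs) y \<and> u = (S i)(b + 1 := y))" for i u
  proof -
    have "map (S i) (b # ins) = i # ?vs" using ins by (auto simp: S_def)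
    moreover have "cexec (compile f (b # ins) (b + 1) (b + 2)) (S i) u \<longleftrightarrow>
     (\<exists>y. rec_eval f (map (S i) (b # ins)) y \<and> u = (S i)(b + 1 := y))"
      using "6.prems"(4) ins z by (intro "6.IH") (auto simp: S_def)
    ultimately show ?thesis by (simp only:)
  qed
  define p where "p = seqs [compile f (b # ins) (b + 1) (b + 2), Atom (Dec (b + 1)), clear (b + 1), Atom (Inc b)]"
  have S1: "(S i)(b + 1 := 0, b := Suc i) = S (Suc i)" "(S i)(b + 1 := 0) = S i" "S i b = i" for i
    using z by (auto simp: S_def fun_eq_iff)
  have p: "cexec p (S i) u \<longleftrightarrow> (\<exists>y. rec_eval f (i # ?vs) (Suc y)) \<and> u = S (Suc i)" for i u
  proof -
    have "cexec p (S i) u \<longleftrightarrow>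
       (\<exists>y. rec_eval f (i # ?vs) y \<and> 0 < y \<and> u = (S i)(b + 1 := 0, b := Suc i))"
      unfolding p_def
      by (simp only: exec_seqs_Cons exec_seqs_Nil exec.simps OO_def f ctr_step.simps cexec_clear simp_thms)
        (auto simp: S_def)
    then show ?thesis unfolding S1(1) by (simp only: gr0_conv_Suc) blast
  qed
  \<comment> \<open>A round gets past \<open>Dec\<close> only if the value at \<open>i\<close> is
    positive, and the test after the loop requires the value zero at \<open>k\<close>: these are the
    two premises of the rule for \<open>Mu\<close>.\<close>
  have loop: "(cexec p)\<^sup>*\<^sup>* (S 0) u \<longleftrightarrow> (\<exists>k. (\<forall>i<k. \<exists>y. rec_eval f (i # ?vs) (Suc y)) \<and> u = S k)" for u
  proof
    assume "(cexec p)\<^sup>*\<^sup>* (S 0) u"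
    then show "\<exists>k. (\<forall>i<k. \<exists>y. rec_eval f (i # ?vs) (Suc y)) \<and> u = S k"
    proof induction
      case base
      show ?case by (intro exI[of _ 0]) simp
    next
      case (step u w)
      then obtain k where k: "\<forall>i<k. \<exists>y. rec_eval f (i # ?vs) (Suc y)" "u = S k" by blast
      then show ?case using step(2)
        by (intro exI[of _ "Suc k"]) (auto simp: p less_Suc_eq)
    qed
  next
    have "(\<forall>i<k. \<exists>y. rec_eval f (i # ?vs) (Suc y)) \<Longrightarrow> (cexec p)\<^sup>*\<^sup>* (S 0) (S k)" for k
      by (induction k) (auto simp: p intro: rtranclp.rtrancl_into_rtrancl)
    then show "\<exists>k. (\<forall>i<k. \<exists>y. rec_eval f (i # ?vs) (Suc y)) \<and> u = S k \<Longrightarrow> (cexec p)\<^sup>*\<^sup>* (S 0) u"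
      by blast
  qed
  have S0: "s = S 0" using z[of b] by (auto simp: S_def)
  have fin: "cexec (move b out) ((S k)(b + 1 := 0)) s' \<longleftrightarrow> s' = s(out := k)" for k
  proof -
    have "(S k)(b + 1 := 0, b := 0, out := k) = s(out := k)"
      using z by (auto simp: S_def fun_eq_iff)
    moreover have "cexec (move b out) ((S k)(b + 1 := 0)) s' \<longleftrightarrow>
       s' = (S k)(b + 1 := 0, b := 0, out := k)"
      using bo "6.prems"(2) z by (subst cexec_move) (auto simp: S_def)
    ultimately show ?thesis by simp
  qed
  have z1: "(S k)(b + 1 := y) = (S k)(b + 1 := 0)" if "((S k)(b + 1 := y)) (b + 1) = 0" for k y
    using that by simp
  have "compile (Mu f) ins out b = seqs [Star p, compile f (b # ins) (b + 1) (b + 2),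
      Atom (IsZero (b + 1)), move b out]"
    by (simp add: p_def)
  then have "cexec (compile (Mu f) ins out b) (S 0) s' \<longleftrightarrow>
     (\<exists>u v. (cexec p)\<^sup>*\<^sup>* (S 0) u \<and> cexec (compile f (b # ins) (b + 1) (b + 2)) u v \<and>
        v (b + 1) = 0 \<and> cexec (move b out) v s')"
    by (simp only: exec_seqs_Cons exec_seqs_Nil exec.simps OO_def ctr_step.simps simp_thms) blast
  also have "\<dots> \<longleftrightarrow>
     (\<exists>k. (\<forall>i<k. \<exists>y. rec_eval f (i # ?vs) (Suc y)) \<and> rec_eval f (k # ?vs) 0 \<and>
        cexec (move b out) ((S k)(b + 1 := 0)) s')" (is "?l \<longleftrightarrow> ?r")
  proof
    assume ?l
    then obtain u v where uv: "(cexec p)\<^sup>*\<^sup>* (S 0) u" "cexec (compile f (b # ins) (b + 1) (b + 2)) u v"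
      "v (b + 1) = 0" "cexec (move b out) v s'" by blast
    obtain k where k: "\<forall>i<k. \<exists>y. rec_eval f (i # ?vs) (Suc y)" "u = S k"
      using uv(1) unfolding loop by blast
    obtain y where y: "rec_eval f (k # ?vs) y" "v = (S k)(b + 1 := y)"
      using uv(2) unfolding k(2) f by blast
    have "y = 0" using uv(3) unfolding y(2) by simp
    then show ?r using k(1) y uv(4) by blast
  next
    assume ?r
    then obtain k where k: "\<forall>i<k. \<exists>y. rec_eval f (i # ?vs) (Suc y)" "rec_eval f (k # ?vs) 0"
      "cexec (move b out) ((S k)(b + 1 := 0)) s'" by blast
    have "(cexec p)\<^sup>*\<^sup>* (S 0) (S k)" unfolding loop using k(1) by blast
    moreover have "cexec (compile f (b # ins) (b + 1) (b + 2)) (S k) ((S k)(b + 1 := 0))"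
      unfolding f using k(2) by blast
    moreover have "((S k)(b + 1 := 0)) (b + 1) = 0" by simp
    ultimately show ?l using k(3) by blast
  qed
  finally show ?case unfolding fin S0[symmetric] rec_eval_Mu by blast
next
  case (7 ins t b)
  then show ?case by auto
next
  case (8 g gs ins t b)
  have g: "cexec (compile g ins t b) s u \<longleftrightarrow> (\<exists>y. rec_eval g (map s ins) y \<and> u = s(t := y))" for u
    using 8 by (intro "8.IH"(1)) auto
  have gs: "cexec (compiles gs ins (Suc t) b) (s(t := y)) u \<longleftrightarrow>
      (\<exists>ys. list_all2 (\<lambda>g y. rec_eval g (map s ins) y) gs ys \<and> u = upds (s(t := y)) (Suc t) ys)" for y u
  proof -
    have "map (s(t := y)) ins = map s ins" using 8(5) by auto
    moreover have "cexec (compiles gs ins (Suc t) b) (s(t := y)) u \<longleftrightarrow>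
      (\<exists>ys. list_all2 (\<lambda>g y'. rec_eval g (map (s(t := y)) ins) y') gs ys \<and> u = upds (s(t := y)) (Suc t) ys)"
      using 8 by (intro "8.IH"(2)) auto
    ultimately show ?thesis by (simp only:)
  qed
  have "cexec (compiles (g # gs) ins t b) s s' \<longleftrightarrow>
      (\<exists>y. rec_eval g (map s ins) y \<and> cexec (compiles gs ins (Suc t) b) (s(t := y)) s')"
    by (simp only: compiles.simps exec.simps OO_def g) blast
  then show ?case
    unfolding gs upds_Cons[symmetric] list_all2_Cons1 by blast
qed

section \<open>Counters in a queue\<close>

datatype q_act = Read nat | Write nat

fun q_step :: "q_act \<Rightarrow> nat list \<Rightarrow> nat list \<Rightarrow> bool" where
  "q_step (Read a) q q' \<longleftrightarrow> q = a # q'"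
| "q_step (Write a) q q' \<longleftrightarrow> q' = q @ [a]"

abbreviation qexec :: "q_act rex \<Rightarrow> nat list \<Rightarrow> nat list \<Rightarrow> bool" where
  "qexec \<equiv> exec q_step"

definition cycle :: "nat \<Rightarrow> q_act rex" where
  "cycle a = Seq (Atom (Read a)) (Atom (Write a))"

lemma qexec_cycle [simp]: "qexec (cycle a) q q' \<longleftrightarrow> (\<exists>v. q = a # v \<and> q' = v @ [a])"
  by (auto simp: cycle_def OO_def)

text \<open>Only the front of the queue can be read, so rotation gives access to every position and
  preserves all letter counts. Restricting the letters \<open>as\<close> turns rotation into a
  test.\<close>

definition cycles :: "nat list \<Rightarrow> q_act rex" where
  "cycles as = Star (alts (map cycle as))"

lemma qexec_cycles_sound:
  assumes "qexec (cycles as) q q'"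
  shows "set q' = set q" and "count_list q' x = count_list q x"
proof -
  have "set q' = set q \<and> count_list q' x = count_list q x"
    using assms unfolding cycles_def exec.simps
  proof induction
    case (step y z)
    then obtain a w where "y = a # w" "z = w @ [a]" by (auto simp: exec_alts)
    then have "set z = set y" "count_list z x = count_list y x" by simp_all
    then show ?case using step.IH by simp
  qed simp
  then show "set q' = set q" and "count_list q' x = count_list q x" by auto
qed

lemma qexec_cycles:
  assumes "set u \<subseteq> set as"
  shows "qexec (cycles as) (u @ v) (v @ u)"
  using assms
proof (induction u arbitrary: v)
  case Nil
  then show ?case by (simp add: cycles_def)
next
  case (Cons a u)
  have "exec q_step (alts (map cycle as)) (a # u @ v) (u @ v @ [a])"
    using Cons.prems by (auto simp: exec_alts)
  moreover have "qexec (cycles as) (u @ v @ [a]) (v @ a # u)"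
    using Cons.IH[of "v @ [a]"] Cons.prems by simp
  ultimately show ?case
    unfolding cycles_def exec.simps append_Cons by (rule converse_rtranclp_into_rtranclp)
qed

text \<open>Letter \<open>0\<close> is an end marker, which occurs once; \<open>Suc r\<close> is a unit of register \<open>r\<close>. The order
  of the letters is irrelevant: an empty register is recognised by rotating the queue once around,
  from marker to marker.\<close>

definition queue_rep :: "nat \<Rightarrow> nat list \<Rightarrow> (nat \<Rightarrow> nat) \<Rightarrow> bool" where
  "queue_rep B q s \<longleftrightarrow> count_list q 0 = 1 \<and> (\<forall>r<B. count_list q (Suc r) = s r) \<and> set q \<subseteq> {..B}"

fun queue_impl :: "nat \<Rightarrow> ctr_act \<Rightarrow> q_act rex" where
  "queue_impl B (Inc r) = Atom (Write (Suc r))"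
| "queue_impl B (Dec r) = Seq (cycles [0..<Suc B]) (Atom (Read (Suc r)))"
| "queue_impl B (IsZero r) = seqs [cycles [0..<Suc B], cycle 0,
     cycles (filter (\<lambda>a. a \<noteq> 0 \<and> a \<noteq> Suc r) [0..<Suc B]), cycle 0]"

fun ctr_reg :: "ctr_act \<Rightarrow> nat" where
  "ctr_reg (Inc r) = r" | "ctr_reg (Dec r) = r" | "ctr_reg (IsZero r) = r"

text \<open>A decrement removes a letter \<open>Suc r\<close> wherever it stands, since only counts
  matter. For \<open>IsZero\<close>, the second rotation can pass neither the marker nor a letter
  \<open>Suc r\<close>, so the marker comes back to the front only if no unit of \<open>r\<close> is
  present.\<close>

lemma queue_impl_sound:
  assumes r: "ctr_reg a < B" and rep: "queue_rep B q s" and ex: "qexec (queue_impl B a) q q'"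
  shows "\<exists>s'. ctr_step a s s' \<and> queue_rep B q' s'"
proof (cases a)
  case (Inc r)
  then show ?thesis using assms by (auto simp: queue_rep_def)
next
  case (Dec r)
  then obtain y where y: "qexec (cycles [0..<Suc B]) q y" "y = Suc r # q'"
    using ex by (auto simp: OO_def)
  note m = qexec_cycles_sound[OF y(1)]
  have "s r = Suc (count_list q' (Suc r))"
    using rep r Dec m(2)[of "Suc r"] y(2) by (auto simp: queue_rep_def)
  moreover have "count_list q x = (if x = Suc r then 1 else 0) + count_list q' x" for x
    using m(2)[of x] y(2) by (auto split: if_splits)
  ultimately show ?thesis using rep m(1) y(2) Dec
    by (auto simp: queue_rep_def)
next
  case (IsZero r)
  obtain v y1 y2 where y: "qexec (cycles [0..<Suc B]) q (0 # v)"
     "qexec (cycles (filter (\<lambda>a. a \<noteq> 0 \<and> a \<noteq> Suc r) [0..<Suc B])) (v @ [0]) (0 # y2)" "q' = y2 @ [0]"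
    using ex IsZero by (auto simp: OO_def simp del: upt_Suc)
  note m = qexec_cycles_sound[OF y(1)]
  have v0: "0 \<notin> set v" using rep m(2)[of 0] by (auto simp: queue_rep_def count_list_0_iff)
  \<comment> \<open>\<open>v1\<close> is the part rotated since the marker was put at the back. Once
    the marker is in front again, \<open>v2\<close> is empty because \<open>v\<close> contains no
    marker, so all of \<open>v\<close> has been inspected.\<close>
  have gen: "\<exists>v1 v2. v = v1 @ v2 \<and> w = v2 @ 0 # v1 \<and> Suc r \<notin> set v1"
    if "qexec (cycles (filter (\<lambda>a. a \<noteq> 0 \<and> a \<noteq> Suc r) [0..<Suc B])) (v @ [0]) w" for w
    using that unfolding cycles_def exec.simps
  proof induction
    case base
    show ?case by (intro exI[of _ "[]"] exI[of _ v]) simp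
  next
    case (step w w')
    then obtain v1 v2 where v: "v = v1 @ v2" "w = v2 @ 0 # v1" "Suc r \<notin> set v1" by blast
    obtain b z where b: "w = b # z" "w' = z @ [b]" "b \<noteq> 0" "b \<noteq> Suc r"
      using step(2) by (auto simp: exec_alts simp del: upt_Suc)
    then obtain v2' where "v2 = b # v2'" using v(2) by (cases v2) auto
    then show ?case using v b by (intro exI[of _ "v1 @ [b]"] exI[of _ v2']) auto
  qed
  obtain v1 v2 where v: "v = v1 @ v2" "0 # y2 = v2 @ 0 # v1" "Suc r \<notin> set v1"
    using gen[OF y(2)] by blast
  then have v2: "v2 = []" using v0 by (cases v2) auto
  then have "set q' = set q" "\<And>x. count_list q' x = count_list q x"
    using v y(3) m(1) m(2)[symmetric] by auto
  moreover have "s r = 0"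
    using rep r IsZero m(2)[of "Suc r"] v v2 by (auto simp: queue_rep_def count_list_0_iff)
  ultimately show ?thesis using rep IsZero by (auto simp: queue_rep_def)
qed

lemma queue_impl_complete:
  assumes r: "ctr_reg a < B" and rep: "queue_rep B q s" and st: "ctr_step a s s'"
  shows "\<exists>q'. qexec (queue_impl B a) q q' \<and> queue_rep B q' s'"
proof (cases a)
  case (Inc r)
  then show ?thesis using assms by (auto simp: queue_rep_def)
next
  case (Dec r)
  have "count_list q (Suc r) \<noteq> 0" using assms Dec by (auto simp: queue_rep_def)
  then have "Suc r \<in> set q" by (simp add: count_list_0_iff)
  then obtain u v where q: "q = u @ Suc r # v" by (meson split_list)
  have "qexec (cycles [0..<Suc B]) (u @ Suc r # v) ((Suc r # v) @ u)"
    using rep q by (intro qexec_cycles) (auto simp: queue_rep_def)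
  then have "qexec (queue_impl B a) q (v @ u)" using Dec q by (auto simp: OO_def)
  moreover have "count_list q (Suc r) = s r" using rep r Dec by (auto simp: queue_rep_def)
  then have "Suc (count_list (v @ u) (Suc r)) = s r" using q by simp
  then have "queue_rep B (v @ u) s'" using rep q st Dec by (auto simp: queue_rep_def)
  ultimately show ?thesis by blast
next
  case (IsZero r)
  have "0 \<in> set q" using rep by (metis count_list_0_iff queue_rep_def zero_neq_one)
  then obtain u v where q: "q = u @ 0 # v" by (meson split_list)
  have "qexec (cycles [0..<Suc B]) (u @ 0 # v) ((0 # v) @ u)"
    using rep q by (intro qexec_cycles) (auto simp: queue_rep_def)
  moreover have "qexec (cycles (filter (\<lambda>a. a \<noteq> 0 \<and> a \<noteq> Suc r) [0..<Suc B])) ((v @ u) @ [0]) ([0] @ v @ u)"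
  proof (rule qexec_cycles)
    have "count_list (v @ u) 0 = 0" using rep q by (simp add: queue_rep_def)
    then have "0 \<notin> set (v @ u)" by (simp only: count_list_0_iff not_False_eq_True)
    moreover have "count_list (v @ u) (Suc r) = 0"
      using rep q r st IsZero by (auto simp: queue_rep_def)
    then have "Suc r \<notin> set (v @ u)" by (simp only: count_list_0_iff not_False_eq_True)
    moreover have "set (v @ u) \<subseteq> {..B}" using rep q by (auto simp: queue_rep_def)
    ultimately show "set (v @ u) \<subseteq> set (filter (\<lambda>a. a \<noteq> 0 \<and> a \<noteq> Suc r) [0..<Suc B])"
      by (auto simp del: upt_Suc simp: less_Suc_eq_le intro!: gr0I)
  qed
  ultimately have "qexec (queue_impl B a) q (v @ u @ [0])"
    unfolding IsZero q queue_impl.simps exec_seqs_Cons exec_seqs_Nil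
    by (intro relcomppI[where b = "0 # v @ u"] relcomppI[where b = "(v @ u) @ [0]"]
      relcomppI[where b = "0 # v @ u"] relcomppI[where b = "v @ u @ [0]"] refl) simp_all
  moreover have "queue_rep B (v @ u @ [0]) s'" using rep q st IsZero by (auto simp: queue_rep_def)
  ultimately show ?thesis by blast
qed

text \<open>A halting computation leaves units and the marker in the queue, but membership in
  \<open>MSC\<close> forbids pending messages; the rest is discarded before acceptance.\<close>

definition drain :: "nat \<Rightarrow> q_act rex" where
  "drain B = Star (alts (map (\<lambda>a. Atom (Read a)) [0..<Suc B]))"

lemma qexec_drain: "set q \<subseteq> {..B} \<Longrightarrow> qexec (drain B) q []"
proof (induction q)
  case Nil
  then show ?case by (simp add: drain_def)
next
  case (Cons a q)
  have "qexec (alts (map (\<lambda>a. Atom (Read a)) [0..<Suc B])) (a # q) q"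
    using Cons.prems by (auto simp: exec_alts simp del: upt_Suc)
  moreover have "qexec (drain B) q []" using Cons by simp
  ultimately show ?case
    unfolding drain_def exec.simps by (rule converse_rtranclp_into_rtranclp)
qed

section \<open>Building finite cMSCs event by event\<close>

fun proc :: "'p act \<Rightarrow> 'p" where
  "proc (Send p q) = p"
| "proc (Recv p q) = p"

lemma Act_at_iff: "a \<in> Act P \<Longrightarrow> a \<in> Act_at P p \<longleftrightarrow> proc a = p"
  by (cases a) (auto simp: Act_def Act_at_def)

lemma proc_in: "a \<in> Act P \<Longrightarrow> proc a \<in> P"
  by (cases a) (auto simp: Act_def Act_at_def)

lemma Act_Send [simp]: "Send p q \<in> Act P \<longleftrightarrow> (p, q) \<in> Ch P"
  by (auto simp: Act_def Act_at_def Ch_def)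

lemma Act_Recv [simp]: "Recv q p \<in> Act P \<longleftrightarrow> (p, q) \<in> Ch P"
  by (auto simp: Act_def Act_at_def Ch_def)

text \<open>A larger generating set than \<open>proc_succ\<close>, with the same closure for finite
  event sets. Adding a last event only enlarges it, so no direct successors have to be
  tracked.\<close>

definition same_proc :: "('e, 'p, 'm) cmsc \<Rightarrow> ('e \<times> 'e) set" where
  "same_proc M = {(e, f) \<in> le M. proc (lab M e) = proc (lab M f)}"

text \<open>For finite event sets, \<open>pre_cmsc\<close> is \<open>is_cmsc\<close> without the requirement that there be an event.\<close>

definition pre_cmsc :: "'p set \<Rightarrow> 'm set \<Rightarrow> ('e, 'p, 'm) cmsc \<Rightarrow> bool" where
  "pre_cmsc P Ms M \<longleftrightarrow> finite (events M) \<and> partial_order_on (events M) (le M) \<and>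
     lab M \<in> events M \<rightarrow>\<^sub>E Act P \<and> dom (mark M) = unm M \<and> ran (mark M) \<subseteq> Ms \<and>
     (\<forall>e\<in>events M. \<forall>f\<in>events M. proc (lab M e) = proc (lab M f) \<longrightarrow> (e, f) \<in> le M \<or> (f, e) \<in> le M) \<and>
     lhd M \<subseteq> le M \<and> (\<forall>(e, f)\<in>lhd M. \<exists>p q. lab M e = Send p q \<and> lab M f = Recv q p) \<and>
     (\<forall>(e, f)\<in>lhd M. \<forall>(e', f')\<in>lhd M. lab M e = lab M e' \<longrightarrow> ((e, e') \<in> le M \<longleftrightarrow> (f, f') \<in> le M)) \<and>
     le M \<subseteq> (same_proc M \<union> lhd M)\<^sup>* \<and>
     (\<forall>(e, f)\<in>lhd M. \<forall>g\<in>unm M.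
        (lab M g = lab M e \<longrightarrow> (e, g) \<in> le M \<and> e \<noteq> g) \<and>
        (lab M g = lab M f \<longrightarrow> (g, f) \<in> le M \<and> g \<noteq> f))"

lemma pre_cmscD:
  assumes "pre_cmsc P Ms M"
  shows "finite (events M)"
    and "partial_order_on (events M) (le M)"
    and "lab M \<in> events M \<rightarrow>\<^sub>E Act P"
    and "dom (mark M) = unm M"
    and "ran (mark M) \<subseteq> Ms"
    and "\<forall>e\<in>events M. \<forall>f\<in>events M. proc (lab M e) = proc (lab M f) \<longrightarrow> (e, f) \<in> le M \<or> (f, e) \<in> le M"
    and "lhd M \<subseteq> le M"
    and "\<forall>(e, f)\<in>lhd M. \<exists>p q. lab M e = Send p q \<and> lab M f = Recv q p"
    and "\<forall>(e, f)\<in>lhd M. \<forall>(e', f')\<in>lhd M. lab M e = lab M e' \<longrightarrow> ((e, e') \<in> le M \<longleftrightarrow> (f, f') \<in> le M)"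
    and "le M \<subseteq> (same_proc M \<union> lhd M)\<^sup>*"
    and "\<forall>(e, f)\<in>lhd M. \<forall>g\<in>unm M.
        (lab M g = lab M e \<longrightarrow> (e, g) \<in> le M \<and> e \<noteq> g) \<and>
        (lab M g = lab M f \<longrightarrow> (g, f) \<in> le M \<and> g \<noteq> f)"
  using assms unfolding pre_cmsc_def by - (elim conjE, assumption)+

lemma partial_order_on_iff:
  "partial_order_on A r \<longleftrightarrow> r \<subseteq> A \<times> A \<and> (\<forall>x\<in>A. (x, x) \<in> r) \<and>
     (\<forall>x y z. (x, y) \<in> r \<longrightarrow> (y, z) \<in> r \<longrightarrow> (x, z) \<in> r) \<and>
     (\<forall>x y. (x, y) \<in> r \<longrightarrow> (y, x) \<in> r \<longrightarrow> x = y)"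
  unfolding partial_order_on_def preorder_on_def refl_on_def trans_def antisym_def by blast

lemma pre_cmsc_le:
  assumes "pre_cmsc P Ms M"
  shows "le M \<subseteq> events M \<times> events M"
    and "\<And>x. x \<in> events M \<Longrightarrow> (x, x) \<in> le M"
    and "\<And>x y z. (x, y) \<in> le M \<Longrightarrow> (y, z) \<in> le M \<Longrightarrow> (x, z) \<in> le M"
    and "\<And>x y. (x, y) \<in> le M \<Longrightarrow> (y, x) \<in> le M \<Longrightarrow> x = y"
  using pre_cmscD(2)[OF assms] unfolding partial_order_on_iff by - (elim conjE, blast)+

lemma events_at_eq:
  assumes "lab M \<in> events M \<rightarrow>\<^sub>E Act P"
  shows "events_at P M p = {e \<in> events M. proc (lab M e) = p}"
  using assms by (auto simp: events_at_def PiE_iff Act_at_iff)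

text \<open>Induction on the size of the interval: a pair that is no covering pair has an
  intermediate \<open>g\<close>, and both halves are strictly smaller intervals.\<close>

lemma finite_order_succ:
  fixes r :: "('e \<times> 'e) set"
  assumes "finite A" and r: "partial_order_on A r" and "(x, y) \<in> r"
  defines "s \<equiv> {(e, f) \<in> r. e \<noteq> f \<and> \<not> (\<exists>g. g \<noteq> e \<and> g \<noteq> f \<and> (e, g) \<in> r \<and> (g, f) \<in> r)}"
  shows "(x, y) \<in> s\<^sup>*"
  using \<open>(x, y) \<in> r\<close>
proof (induction "card {g. (x, g) \<in> r \<and> (g, y) \<in> r}" arbitrary: x y rule: less_induct)
  case less
  note po = r[unfolded partial_order_on_iff]
  have fin: "finite {g. (x, g) \<in> r \<and> (g, y) \<in> r}"
    by (rule finite_subset[OF _ \<open>finite A\<close>]) (use po in blast)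
  consider "x = y" | "(x, y) \<in> s" | g where "g \<noteq> x" "g \<noteq> y" "(x, g) \<in> r" "(g, y) \<in> r"
    using less.prems unfolding s_def by blast
  then show ?case
  proof cases
    case 3
    have "{h. (x, h) \<in> r \<and> (h, g) \<in> r} \<subset> {h. (x, h) \<in> r \<and> (h, y) \<in> r}"
      using 3 po less.prems by blast
    moreover have "{h. (g, h) \<in> r \<and> (h, y) \<in> r} \<subset> {h. (x, h) \<in> r \<and> (h, y) \<in> r}"
      using 3 po less.prems by blast
    ultimately have "(x, g) \<in> s\<^sup>*" "(g, y) \<in> s\<^sup>*"
      using less.hyps 3 fin by (meson psubset_card_mono)+
    then show ?thesis by simp
  qed auto
qed

text \<open>Direct successors generate each finite process order by
  \<open>finite_order_succ\<close>. The FIFO clause for two processes reduces to one per sending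
  action, since the processes of the two ends of an edge determine the action of its source.\<close>

lemma is_cmsc_if_pre_cmsc:
  assumes pre: "pre_cmsc P Ms M" and ne: "events M \<noteq> {}"
  shows "is_cmsc P Ms M"
proof -
  note D = pre_cmscD[OF pre]
  have fin: "finite (events M)" and po: "partial_order_on (events M) (le M)"
    and lab: "lab M \<in> events M \<rightarrow>\<^sub>E Act P" and dom: "dom (mark M) = unm M" and ran: "ran (mark M) \<subseteq> Ms"
    and lhd: "lhd M \<subseteq> le M" and gen: "le M \<subseteq> (same_proc M \<union> lhd M)\<^sup>*"
    by (fact D)+
  have tot: "\<And>e f. e \<in> events M \<Longrightarrow> f \<in> events M \<Longrightarrow> proc (lab M e) = proc (lab M f) \<Longrightarrow>
       (e, f) \<in> le M \<or> (f, e) \<in> le M"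
    using D(6) by blast
  have edge: "\<And>e f. (e, f) \<in> lhd M \<Longrightarrow> \<exists>p q. lab M e = Send p q \<and> lab M f = Recv q p"
    using D(8) by blast
  have fifo: "\<And>e f e' f'. (e, f) \<in> lhd M \<Longrightarrow> (e', f') \<in> lhd M \<Longrightarrow> lab M e = lab M e' \<Longrightarrow>
       (e, e') \<in> le M \<longleftrightarrow> (f, f') \<in> le M"
    using D(9) by blast
  note unm = D(11)
  note po' = pre_cmsc_le[OF pre]
  have ev: "events_at P M p = {e \<in> events M. proc (lab M e) = p}" for p
    by (rule events_at_eq[OF lab])
  have inE: "e \<in> events M" "f \<in> events M" if "(e, f) \<in> lhd M" for e f
    using that lhd po' by blast+
  have act: "lab M e \<in> Act P" if "e \<in> events M" for e
    using lab that by auto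
  have ch: "\<exists>(p, q)\<in>Ch P. lab M e = Send p q \<and> lab M f = Recv q p" if "(e, f) \<in> lhd M" for e f
    using edge[OF that] act[OF inE(1)[OF that]] by auto
  have total: "total_on (events_at P M p) (le_at P M p)" for p
    unfolding ev le_at_def total_on_def using tot by auto
  have "le_at P M p \<subseteq> (succ_at P M p)\<^sup>*" for p
  proof
    fix x assume x: "x \<in> le_at P M p"
    obtain e f where e: "x = (e, f)" by force
    have "partial_order_on (events_at P M p) (le_at P M p)"
      unfolding partial_order_on_iff
    proof (intro conjI allI impI ballI)
      show "le_at P M p \<subseteq> events_at P M p \<times> events_at P M p" by (auto simp: le_at_def)
      show "(x, x) \<in> le_at P M p" if "x \<in> events_at P M p" for x
        using that po'(2) by (auto simp: le_at_def events_at_def)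
      show "(x, z) \<in> le_at P M p" if "(x, y) \<in> le_at P M p" "(y, z) \<in> le_at P M p" for x y z
        using that po'(3) unfolding le_at_def by blast
      show "x = y" if "(x, y) \<in> le_at P M p" "(y, x) \<in> le_at P M p" for x y
        using that po'(4) unfolding le_at_def by blast
    qed
    then show "x \<in> (succ_at P M p)\<^sup>*"
      using finite_order_succ[of "events_at P M p" "le_at P M p" e f] fin x
      unfolding e succ_at_def by (simp add: events_at_def)
  qed
  moreover have "same_proc M \<subseteq> (\<Union>p\<in>P. le_at P M p)"
  proof
    fix u assume u: "u \<in> same_proc M"
    obtain e f where ef: "u = (e, f)" by force
    have "(e, f) \<in> le M" "proc (lab M e) = proc (lab M f)"
      using u unfolding ef same_proc_def by auto
    moreover from this have "e \<in> events M" "f \<in> events M" using po'(1) by auto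
    moreover from this have "proc (lab M e) \<in> P" using act proc_in by blast
    ultimately show "u \<in> (\<Union>p\<in>P. le_at P M p)" unfolding ef le_at_def ev by auto
  qed
  moreover have "(succ_at P M p)\<^sup>* \<subseteq> (proc_succ P M \<union> lhd M)\<^sup>*" if "p \<in> P" for p
    by (rule rtrancl_mono) (use that in \<open>auto simp: proc_succ_def\<close>)
  ultimately have "same_proc M \<subseteq> (proc_succ P M \<union> lhd M)\<^sup>*" by blast
  then have "same_proc M \<union> lhd M \<subseteq> (proc_succ P M \<union> lhd M)\<^sup>*" by auto
  then have 1: "le M \<subseteq> (proc_succ P M \<union> lhd M)\<^sup>*"
    using gen by (metis rtrancl_idemp rtrancl_mono subset_trans)
  have sub: "proc_succ P M \<union> lhd M \<subseteq> le M"
    using lhd by (auto simp: proc_succ_def succ_at_def le_at_def)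
  have 2: "(x, y) \<in> le M" if "(x, y) \<in> (proc_succ P M \<union> lhd M)\<^sup>*" "x \<in> events M" for x y
    using that
  proof (induction rule: rtrancl_induct)
    case base
    then show ?case using po'(2) by blast
  next
    case (step y z)
    then show ?case using po'(3) sub by blast
  qed
  have le: "le M = Restr ((proc_succ P M \<union> lhd M)\<^sup>*) (events M)"
    using 1 2 po' by blast
  have fifo': "\<forall>p\<in>P. \<forall>q\<in>P. \<forall>(e, f)\<in>lhd M. \<forall>(e', f')\<in>lhd M.
        e \<in> events_at P M p \<longrightarrow> e' \<in> events_at P M p \<longrightarrow>
        f \<in> events_at P M q \<longrightarrow> f' \<in> events_at P M q \<longrightarrow>
        ((e, e') \<in> le_at P M p \<longleftrightarrow> (f, f') \<in> le_at P M q)"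
  proof (intro ballI, clarify)
    fix p q e f e' f'
    assume *: "(e, f) \<in> lhd M" "(e', f') \<in> lhd M" "e \<in> events_at P M p" "e' \<in> events_at P M p"
        "f \<in> events_at P M q" "f' \<in> events_at P M q"
    then have "lab M e = lab M e'"
      using edge[OF *(1)] edge[OF *(2)] unfolding ev by auto
    then show "(e, e') \<in> le_at P M p \<longleftrightarrow> (f, f') \<in> le_at P M q"
      using fifo * unfolding le_at_def by auto
  qed
  have fin': "finite (events_at P M p)" for p using fin by (simp add: events_at_def)
  show ?thesis
    unfolding is_cmsc_def
    using ne fin po lab dom ran total lhd ch fifo' le unm fin'
    by (auto simp: countable_finite split_beta)
qed

text \<open>Not a cMSC, having no event, but a common starting point: the cMSC of a single operation
  arises from it by the same function that extends a product.\<close>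

definition empty_cmsc :: "('e, 'p, 'm) cmsc" where
  "empty_cmsc = \<lparr>events = {}, le = {}, lhd = {}, lab = \<lambda>_. undefined, mark = Map.empty\<rparr>"

lemma pre_cmsc_empty: "pre_cmsc P Ms empty_cmsc"
  by (auto simp: pre_cmsc_def empty_cmsc_def partial_order_on_iff unm_def same_proc_def)

text \<open>The new event \<open>x\<close> is the last one on its process; it receives the message sent by \<open>y\<close> if
  \<open>sender = Some y\<close>, and is unmatched with message \<open>m\<close> if \<open>sender = None\<close>.\<close>

definition add_event ::
  "('e, 'p, 'm) cmsc \<Rightarrow> 'e \<Rightarrow> 'p act \<Rightarrow> 'e option \<Rightarrow> 'm \<Rightarrow> ('e, 'p, 'm) cmsc" where
  "add_event M x a sender m = \<lparr>events = insert x (events M),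
     le = le M \<union> {(z, x) | z y. (z, y) \<in> le M \<and> (proc (lab M y) = proc a \<or> sender = Some y)} \<union> {(x, x)},
     lhd = lhd M \<union> {(y, x) | y. sender = Some y},
     lab = (lab M)(x := a),
     mark = (case sender of None \<Rightarrow> (mark M)(x \<mapsto> m) | Some y \<Rightarrow> (mark M)(y := None))\<rparr>"

lemma unm_add_event:
  assumes "pre_cmsc P Ms M" "x \<notin> events M" "\<And>y. sender = Some y \<Longrightarrow> y \<in> unm M"
  shows "unm (add_event M x a sender m) = (case sender of None \<Rightarrow> insert x (unm M) | Some y \<Rightarrow> unm M - {y})"
proof -
  have "lhd M \<subseteq> events M \<times> events M"
    using pre_cmscD(7)[OF assms(1)] pre_cmsc_le(1)[OF assms(1)] by blast
  then show ?thesis using assms(2,3)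
    by (auto simp: unm_def add_event_def split: option.splits)
qed

text \<open>The side conditions are what the clause on unmatched events demands of a last event: a
  receive takes the least pending send of its action, and an unmatched event does not follow a
  matched receive of its own action.\<close>

lemma pre_cmsc_add_event:
  assumes pre: "pre_cmsc P Ms M" and x: "x \<notin> events M" and a: "a \<in> Act P" and m: "m \<in> Ms"
    and src_None: "\<And>e f. sender = None \<Longrightarrow> (e, f) \<in> lhd M \<Longrightarrow> lab M f \<noteq> a"
    and src_Some: "\<And>y. sender = Some y \<Longrightarrow> y \<in> unm M \<and> (\<exists>p q. lab M y = Send p q \<and> a = Recv q p) \<and>
       (\<forall>z\<in>unm M. lab M z = lab M y \<longrightarrow> (y, z) \<in> le M)"
  shows "pre_cmsc P Ms (add_event M x a sender m)"
proof -
  let ?M = "add_event M x a sender m"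
  note D = pre_cmscD[OF pre]
  have fin: "finite (events M)" and po: "partial_order_on (events M) (le M)"
    and lab: "lab M \<in> events M \<rightarrow>\<^sub>E Act P" and dom: "dom (mark M) = unm M" and ran: "ran (mark M) \<subseteq> Ms"
    and lhd: "lhd M \<subseteq> le M" and gen: "le M \<subseteq> (same_proc M \<union> lhd M)\<^sup>*"
    by (fact D)+
  have tot: "\<And>e f. e \<in> events M \<Longrightarrow> f \<in> events M \<Longrightarrow> proc (lab M e) = proc (lab M f) \<Longrightarrow>
       (e, f) \<in> le M \<or> (f, e) \<in> le M"
    using D(6) by blast
  have edge: "\<And>e f. (e, f) \<in> lhd M \<Longrightarrow> \<exists>p q. lab M e = Send p q \<and> lab M f = Recv q p"
    using D(8) by blast
  have fifo: "\<And>e f e' f'. (e, f) \<in> lhd M \<Longrightarrow> (e', f') \<in> lhd M \<Longrightarrow> lab M e = lab M e' \<Longrightarrow>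
       (e, e') \<in> le M \<longleftrightarrow> (f, f') \<in> le M"
    using D(9) by blast
  have unm: "\<And>e f g. (e, f) \<in> lhd M \<Longrightarrow> g \<in> unm M \<Longrightarrow>
        (lab M g = lab M e \<longrightarrow> (e, g) \<in> le M \<and> e \<noteq> g) \<and>
        (lab M g = lab M f \<longrightarrow> (g, f) \<in> le M \<and> g \<noteq> f)"
    using D(11) by blast
  note po' = pre_cmsc_le[OF pre]
  have inE: "e \<in> events M" "f \<in> events M" "e \<noteq> x" "f \<noteq> x" if "(e, f) \<in> lhd M" for e f
    using that lhd po' x by blast+
  have inE': "e \<in> events M" "f \<in> events M" "e \<noteq> x" "f \<noteq> x" if "(e, f) \<in> le M" for e f
    using that po' x by blast+
  have unm_in: "y \<in> events M" "y \<noteq> x" if "y \<in> unm M" for y using that x by (auto simp: unm_def)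
  have sender: "y \<in> unm M" "y \<in> events M" "y \<noteq> x" if "sender = Some y" for y
    using src_Some[OF that] unm_in by auto
  have le: "(e, f) \<in> le ?M \<longleftrightarrow> (e, f) \<in> le M \<or> f = x \<and> (e = x \<or>
      (\<exists>y. (e, y) \<in> le M \<and> (proc (lab M y) = proc a \<or> sender = Some y)))" for e f
    by (auto simp: add_event_def)
  have lhd': "(e, f) \<in> lhd ?M \<longleftrightarrow> (e, f) \<in> lhd M \<or> f = x \<and> sender = Some e" for e f
    by (auto simp: add_event_def)
  have lab': "lab ?M e = (if e = x then a else lab M e)" for e
    by (simp add: add_event_def)
  have ev: "events ?M = insert x (events M)" by (simp add: add_event_def)
  note unm' = unm_add_event[OF pre x sender(1), of sender a m, simplified]
  have 1: "finite (events ?M)" using fin ev by simp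
  have 2: "partial_order_on (events ?M) (le ?M)"
    unfolding partial_order_on_iff
  proof (intro conjI allI impI ballI subsetI)
    fix u assume "u \<in> le ?M"
    then show "u \<in> events ?M \<times> events ?M" using po' by (cases u) (auto simp: le ev)
  next
    fix u assume "u \<in> events ?M"
    then show "(u, u) \<in> le ?M" using po' by (auto simp: le ev)
  next
    fix u v w assume uv: "(u, v) \<in> le ?M" and vw: "(v, w) \<in> le ?M"
    show "(u, w) \<in> le ?M"
    proof (cases "w = x")
      case True
      show ?thesis
      proof (cases "v = x")
        case False
        then obtain y where "(v, y) \<in> le M" "proc (lab M y) = proc a \<or> sender = Some y"
          using vw True inE'(4) unfolding le by blast
        moreover have "(u, v) \<in> le M" using uv False unfolding le by blast
        ultimately show ?thesis using po'(3) True unfolding le by blast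
      qed (use uv True in simp)
    next
      case False
      then have "(v, w) \<in> le M" using vw unfolding le by blast
      moreover from this have "(u, v) \<in> le M" using uv inE'(3) unfolding le by blast
      ultimately show ?thesis using po'(3) unfolding le by blast
    qed
  next
    fix u v assume "(u, v) \<in> le ?M" "(v, u) \<in> le ?M"
    then show "u = v" unfolding le using po'(4) inE'(3,4) by blast
  qed
  have 3: "lab ?M \<in> events ?M \<rightarrow>\<^sub>E Act P"
    using lab a by (auto simp: add_event_def PiE_iff extensional_def)
  have 4: "dom (mark ?M) = unm ?M"
    unfolding unm' using dom by (auto simp: add_event_def split: option.splits)
  have 5: "ran (mark ?M) \<subseteq> Ms"
    using ran m by (auto simp: add_event_def ran_def split: option.splits if_splits)
  have 6: "\<forall>e\<in>events ?M. \<forall>f\<in>events ?M. proc (lab ?M e) = proc (lab ?M f) \<longrightarrow> (e, f) \<in> le ?M \<or> (f, e) \<in> le ?M"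
  proof (intro ballI impI)
    fix e f assume *: "e \<in> events ?M" "f \<in> events ?M" "proc (lab ?M e) = proc (lab ?M f)"
    then show "(e, f) \<in> le ?M \<or> (f, e) \<in> le ?M"
      using tot[of e f] po'(2) x unfolding le lab' ev by (cases "e = x"; cases "f = x") auto
  qed
  have 7: "lhd ?M \<subseteq> le ?M"
  proof (intro subrelI)
    fix e f assume "(e, f) \<in> lhd ?M"
    then show "(e, f) \<in> le ?M" using lhd sender(2) po'(2) unfolding lhd' le by blast
  qed
  have 8: "\<forall>(e, f)\<in>lhd ?M. \<exists>p q. lab ?M e = Send p q \<and> lab ?M f = Recv q p"
    using edge src_Some sender(3) inE(3,4) by (fastforce simp: lhd' lab')
  have last: "(e, x) \<in> le ?M" if "e \<in> events M" "proc (lab M e) = proc a" for e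
    using that po' unfolding le by blast
  have nlast: "(x, e) \<notin> le ?M" if "e \<noteq> x" for e
    using that inE' unfolding le by blast
  have 9: "(e, e') \<in> le ?M \<longleftrightarrow> (f, f') \<in> le ?M"
    if ef: "(e, f) \<in> lhd ?M" "(e', f') \<in> lhd ?M" "lab ?M e = lab ?M e'" for e f e' f'
  proof -
    \<comment> \<open>An earlier edge with the same sending action: its source lies before
      \<open>y\<close> because \<open>y\<close> was still unmatched, its target before
      \<open>x\<close> because \<open>x\<close> is last on that process.\<close>
    have old_new: "(e, y) \<in> le ?M \<and> (y, e) \<notin> le ?M \<and> (f, x) \<in> le ?M \<and> (x, f) \<notin> le ?M"
      if "(e, f) \<in> lhd M" "sender = Some y" "lab M e = lab M y" for e f y
    proof -
      have "(e, y) \<in> le M" "e \<noteq> y" using unm[OF that(1) sender(1)[OF that(2)]] that(3) by auto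
      moreover from this have "(y, e) \<notin> le M" using po' by blast
      moreover have "e \<noteq> x" using inE that by blast
      moreover have "proc (lab M f) = proc a" using edge[OF that(1)] src_Some[OF that(2)] that(3) by auto
      ultimately show ?thesis using last[of f] nlast[of f] inE[OF that(1)] by (auto simp: le)
    qed
    consider "(e, f) \<in> lhd M" "(e', f') \<in> lhd M" | "(e, f) \<in> lhd M" "f' = x" "sender = Some e'"
      | "f = x" "sender = Some e" "(e', f') \<in> lhd M" | "f = x" "f' = x" "e = e'" "sender = Some e"
      using ef unfolding lhd' by auto
    then show ?thesis
    proof cases
      case 1
      then have "lab M e = lab M e'" using ef(3) inE by (auto simp: lab')
      then show ?thesis using fifo[OF 1] inE[OF 1(1)] inE[OF 1(2)] by (auto simp: le)
    next
      case 2
      have "lab M e = lab M e'" using ef(3) inE(3)[OF 2(1)] sender(3)[OF 2(3)] by (simp add: lab')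
      then show ?thesis using old_new[OF 2(1,3)] 2(2) by simp
    next
      case 3
      have "lab M e' = lab M e" using ef(3) inE(3)[OF 3(3)] sender(3)[OF 3(2)] by (simp add: lab')
      then show ?thesis using old_new[OF 3(3,2)] 3(1) by simp
    next
      case 4
      then show ?thesis using sender(2)[OF 4(4)] po'(2) unfolding 4(1-3) le by blast
    qed
  qed
  have sub: "same_proc M \<union> lhd M \<subseteq> same_proc ?M \<union> lhd ?M"
  proof (intro subrelI)
    fix e f assume ef: "(e, f) \<in> same_proc M \<union> lhd M"
    then have "(e, f) \<in> le M" using lhd unfolding same_proc_def by blast
    then have "e \<noteq> x" "f \<noteq> x" using inE'(3,4) by blast+
    then show "(e, f) \<in> same_proc ?M \<union> lhd ?M"
      using ef by (auto simp: same_proc_def le lhd' lab')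
  qed
  have 10: "le ?M \<subseteq> (same_proc ?M \<union> lhd ?M)\<^sup>*"
  proof (intro subrelI)
    fix e f assume ef: "(e, f) \<in> le ?M"
    have mono: "le M \<subseteq> (same_proc ?M \<union> lhd ?M)\<^sup>*"
      using gen rtrancl_mono[OF sub] by blast
    have "(y, x) \<in> same_proc ?M \<union> lhd ?M" if "proc (lab M y) = proc a \<or> sender = Some y" "y \<in> events M" for y
      using that last x by (auto simp: same_proc_def lhd' lab')
    then show "(e, f) \<in> (same_proc ?M \<union> lhd ?M)\<^sup>*"
      using ef mono inE' unfolding le by (blast intro: rtrancl_into_rtrancl)
  qed
  have 11: "(lab ?M g = lab ?M e \<longrightarrow> (e, g) \<in> le ?M \<and> e \<noteq> g) \<and> (lab ?M g = lab ?M f \<longrightarrow> (g, f) \<in> le ?M \<and> g \<noteq> f)"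
    if ef: "(e, f) \<in> lhd ?M" and g: "g \<in> unm ?M" for e f g
  proof (cases sender)
    case None
    then have ef': "(e, f) \<in> lhd M" using ef unfolding lhd' by simp
    show ?thesis
    proof (cases "g = x")
      case True
      then show ?thesis using ef' inE[OF ef'] last src_None[OF None ef'] by (auto simp: lab')
    next
      case False
      then have "g \<in> unm M" using g None unfolding unm' by simp
      then show ?thesis using unm[OF ef'] inE[OF ef'] False unfolding lab' le by auto
    qed
  next
    case (Some y)
    then have g': "g \<in> unm M" "g \<noteq> y" "g \<noteq> x" using g unm_in Some unfolding unm' by auto
    show ?thesis
    proof (cases "(e, f) \<in> lhd M")
      case True
      then show ?thesis using unm[OF True g'(1)] inE[OF True] g' unfolding lab' le by auto
    next
      case False
      then have "e = y" "f = x" using ef Some unfolding lhd' by auto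
      then show ?thesis using src_Some[OF Some] g' sender(3)[OF Some] last[OF unm_in(1)[OF g'(1)]]
        by (auto simp: lab' le)
    qed
  qed
  show ?thesis
    unfolding pre_cmsc_def using 1 2 3 4 5 6 7 8 9 10 11 by blast
qed

lemma events_at_add_event:
  assumes "x \<notin> events M" "a \<in> Act P"
  shows "events_at P (add_event M x a sender m) p = events_at P M p \<union> (if proc a = p then {x} else {})"
  using assms by (auto simp: events_at_def add_event_def Act_at_iff)

lemma le_at_add_event:
  assumes "pre_cmsc P Ms M" "x \<notin> events M" "a \<in> Act P"
  shows "le_at P (add_event M x a sender m) p = le_at P M p \<union> (if proc a = p then insert x (events_at P M p) \<times> {x} else {})"
proof -
  have po: "le M \<subseteq> events M \<times> events M" "\<And>e. e \<in> events M \<Longrightarrow> (e, e) \<in> le M"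
    and lab: "lab M \<in> events M \<rightarrow>\<^sub>E Act P"
    using pre_cmsc_le(1,2)[OF assms(1)] pre_cmscD(3)[OF assms(1)] by auto
  have ev: "x \<notin> events_at P M p" using assms(2) by (simp add: events_at_def)
  show ?thesis
    unfolding le_at_def events_at_add_event[OF assms(2,3)]
    using po ev assms(2) unfolding events_at_eq[OF lab] add_event_def by auto
qed

section \<open>Queue operations as cMSCs\<close>

lemma add_event_simps [simp]:
  "events (add_event M x a sender m) = insert x (events M)"
  "lab (add_event M x a sender m) = (lab M)(x := a)"
  "lhd (add_event M x a sender m) = lhd M \<union> {(y, x) | y. sender = Some y}"
  by (auto simp: add_event_def)

lemma mark_add_event [simp]:
  "mark (add_event M x a None m) = (mark M)(x \<mapsto> m)"
  "mark (add_event M x a (Some y) m) = (mark M)(y := None)"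
  by (auto simp: add_event_def)

lemma le_add_event: "le M \<subseteq> le (add_event M x a sender m)"
  by (auto simp: add_event_def)

lemma empty_cmsc_simps [simp]:
  "events empty_cmsc = {}" "le empty_cmsc = {}" "lhd empty_cmsc = {}"
  "mark empty_cmsc = Map.empty" "unm empty_cmsc = {}"
  by (auto simp: empty_cmsc_def unm_def)

text \<open>Process \<open>0\<close> sends the letters of the queue to process \<open>1\<close>. Every transition also carries a matched
  message from \<open>1\<close> to \<open>0\<close>, which connects its events.\<close>

definition add_sync :: "('e, nat, nat) cmsc \<Rightarrow> 'e \<Rightarrow> 'e \<Rightarrow> ('e, nat, nat) cmsc" where
  "add_sync K e0 e1 = add_event (add_event K e0 (Send 1 0) None 0) e1 (Recv 0 1) (Some e0) 0"

text \<open>\<open>e0\<close> and \<open>e1\<close> form the connecting message; \<open>e2\<close>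
  carries the letter and joins the process of \<open>e0\<close> for a read, of \<open>e1\<close> for
  a write. On \<open>empty_cmsc\<close> without a sender this is the label of a transition, where a
  read is an unmatched receive; on a product it yields the concatenation with that label.\<close>

fun add_op ::
  "q_act option \<Rightarrow> 'e \<times> 'e \<times> 'e \<Rightarrow> 'e option \<Rightarrow> ('e, nat, nat) cmsc \<Rightarrow> ('e, nat, nat) cmsc" where
  "add_op None (e0, e1, e2) sender K = add_sync K e0 e1"
| "add_op (Some (Read a)) (e0, e1, e2) sender K = add_event (add_sync K e0 e1) e2 (Recv 1 0) sender a"
| "add_op (Some (Write a)) (e0, e1, e2) sender K = add_event (add_sync K e0 e1) e2 (Send 0 1) None a"

abbreviation op_cmsc :: "q_act option \<Rightarrow> 'e \<times> 'e \<times> 'e \<Rightarrow> ('e, nat, nat) cmsc" where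
  "op_cmsc x es \<equiv> add_op x es None empty_cmsc"

fun letters :: "q_act option \<Rightarrow> nat set" where
  "letters None = {}"
| "letters (Some (Read a)) = {a}"
| "letters (Some (Write a)) = {a}"

text \<open>The queue is read off the pending sends in their order. That all unmatched events are
  such sends excludes receives without a message.\<close>

definition unm_rep :: "('e, nat, nat) cmsc \<Rightarrow> 'e list \<Rightarrow> nat list \<Rightarrow> bool" where
  "unm_rep K es q \<longleftrightarrow> set es = unm K \<and> sorted_wrt (\<lambda>e f. (e, f) \<in> le K \<and> e \<noteq> f) es \<and>
     (\<forall>e\<in>set es. lab K e = Send 0 1) \<and> map (mark K) es = map Some q"

abbreviation procs :: "nat set" where
  "procs \<equiv> {0, 1}"

declare One_nat_def [simp del]

lemma Ch_procs [simp]: "Ch procs = {(0, 1), (1, 0)}"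
  by (auto simp: Ch_def)

text \<open>For a moment \<open>e0\<close> is unmatched with the dummy message 0, whence
  \<open>0 \<in> Ms\<close>. All other pending sends go from 0 to 1, so \<open>e0\<close> is the
  only candidate for \<open>e1\<close>, and the queue is unaffected.\<close>

lemma pre_cmsc_add_sync:
  assumes K: "pre_cmsc procs Ms K" and e: "e0 \<notin> events K" "e1 \<notin> events K" "e0 \<noteq> e1" and "0 \<in> Ms"
    and unm: "\<And>e. e \<in> unm K \<Longrightarrow> lab K e = Send 0 1"
  shows "pre_cmsc procs Ms (add_sync K e0 e1)" "unm (add_sync K e0 e1) = unm K"
proof -
  let ?K = "add_event K e0 (Send 1 0) None 0"
  have K1: "pre_cmsc procs Ms ?K"
    by (rule pre_cmsc_add_event[OF K]) (use e \<open>0 \<in> Ms\<close> pre_cmscD(8)[OF K] in auto)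
  have u: "unm ?K = insert e0 (unm K)" by (subst unm_add_event[OF K]) (use e in auto)
  have e0: "e0 \<notin> unm K" using e by (auto simp: unm_def)
  show "pre_cmsc procs Ms (add_sync K e0 e1)"
    unfolding add_sync_def
    by (rule pre_cmsc_add_event[OF K1]) (use e \<open>0 \<in> Ms\<close> unm u pre_cmsc_le(2)[OF K1, of e0] in auto)
  show "unm (add_sync K e0 e1) = unm K"
    unfolding add_sync_def by (subst unm_add_event[OF K1]) (use e u e0 in auto)
qed

lemma le_add_sync: "le K \<subseteq> le (add_sync K e0 e1)"
  unfolding add_sync_def by (rule order_trans[OF le_add_event le_add_event])

lemma add_sync_simps [simp]:
  "events (add_sync K e0 e1) = {e0, e1} \<union> events K"
  "lab (add_sync K e0 e1) = (lab K)(e0 := Send 1 0, e1 := Recv 0 1)"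
  "lhd (add_sync K e0 e1) = insert (e0, e1) (lhd K)"
  "mark (add_sync K e0 e1) = (mark K)(e0 := None)"
  by (auto simp: add_sync_def)

lemma le_at_add_sync:
  assumes K: "pre_cmsc procs Ms K" and e: "e0 \<notin> events K" "e1 \<notin> events K" "e0 \<noteq> e1" and "0 \<in> Ms"
  shows "le_at procs (add_sync K e0 e1) p = le_at procs K p \<union>
    (if p = 1 then insert e0 (events_at procs K 1) \<times> {e0} else {}) \<union>
    (if p = 0 then insert e1 (events_at procs K 0) \<times> {e1} else {})"
    "events_at procs (add_sync K e0 e1) p = events_at procs K p \<union> (if p = 1 then {e0} else {}) \<union> (if p = 0 then {e1} else {})"
proof -
  let ?K = "add_event K e0 (Send 1 0) None 0"
  have K1: "pre_cmsc procs Ms ?K"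
    by (rule pre_cmsc_add_event[OF K]) (use e \<open>0 \<in> Ms\<close> pre_cmscD(8)[OF K] in auto)
  show "le_at procs (add_sync K e0 e1) p = le_at procs K p \<union>
    (if p = 1 then insert e0 (events_at procs K 1) \<times> {e0} else {}) \<union>
    (if p = 0 then insert e1 (events_at procs K 0) \<times> {e1} else {})"
    using e unfolding add_sync_def
    by (subst le_at_add_event[OF K1]) (simp_all add: le_at_add_event[OF K] events_at_add_event)
  show "events_at procs (add_sync K e0 e1) p = events_at procs K p \<union> (if p = 1 then {e0} else {}) \<union> (if p = 0 then {e1} else {})"
    unfolding add_sync_def using e by (simp add: events_at_add_event)
qed

definition first_unm :: "'e list \<Rightarrow> 'e option" where
  "first_unm es = (case es of [] \<Rightarrow> None | e # _ \<Rightarrow> Some e)"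

text \<open>A read is matched with the head of the pending sends. If there is none, it stays
  unmatched; by \<open>rd\<close> this happens only on the empty structure, where no receive of the
  same action has been matched before.\<close>

lemma pre_cmsc_add_op:
  assumes K: "pre_cmsc procs Ms K" and e: "e0 \<notin> events K" "e1 \<notin> events K" "e2 \<notin> events K" "distinct [e0, e1, e2]"
    and Ms: "0 \<in> Ms" "letters x \<subseteq> Ms" and rep: "unm_rep K es q"
    and rd: "\<And>a. x = Some (Read a) \<Longrightarrow> es = [] \<Longrightarrow> events K = {}"
  shows "pre_cmsc procs Ms (add_op x (e0, e1, e2) (first_unm es) K)"
proof -
  have unm: "lab K e = Send 0 1" if "e \<in> unm K" for e
    using rep that by (auto simp: unm_rep_def)
  note S = pre_cmsc_add_sync[OF K e(1,2) _ Ms(1) unm]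
  have K1: "pre_cmsc procs Ms (add_sync K e0 e1)" and u: "unm (add_sync K e0 e1) = unm K"
    using S e by auto
  have inE: "y \<in> events K" "y \<noteq> e0" "y \<noteq> e1" if "y \<in> unm K" for y
    using that e by (auto simp: unm_def)
  consider "x = None" | a where "x = Some (Read a)" | a where "x = Some (Write a)"
    by (metis option.exhaust q_act.exhaust)
  then show ?thesis
  proof cases
    case 1
    then show ?thesis using K1 by simp
  next
    case (2 a)
    show ?thesis
    proof (cases es)
      case Nil
      then have "lhd K = {}" using rd[OF 2] pre_cmscD(7)[OF K] pre_cmsc_le(1)[OF K] by auto
      then show ?thesis unfolding 2 add_op.simps
        by (intro pre_cmsc_add_event[OF K1]) (use 2 e Ms Nil in \<open>auto simp: first_unm_def\<close>)
    next
      case (Cons y ys)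
      then have y: "y \<in> unm K" "\<And>z. z \<in> unm K \<Longrightarrow> z = y \<or> (y, z) \<in> le K"
        using rep by (auto simp: unm_rep_def)
      have "(y, z) \<in> le (add_sync K e0 e1)" if "z \<in> unm K" for z
        using y(2)[OF that] pre_cmsc_le(2)[OF K1, of y] inE[OF y(1)] le_add_sync[of K e0 e1] by auto
      then show ?thesis unfolding 2 add_op.simps
        by (intro pre_cmsc_add_event[OF K1])
          (use 2 e Ms Cons u y(1) inE[OF y(1)] unm in \<open>auto simp: first_unm_def\<close>)
    qed
  next
    case (3 a)
    show ?thesis unfolding 3 add_op.simps
      by (intro pre_cmsc_add_event[OF K1]) (use 3 e Ms pre_cmscD(8)[OF K] in auto)
  qed
qed

lemma unm_rep_add_op:
  assumes K: "pre_cmsc procs Ms K" and e: "e0 \<notin> events K" "e1 \<notin> events K" "e2 \<notin> events K" "distinct [e0, e1, e2]"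
    and Ms: "0 \<in> Ms" and rep: "unm_rep K es q"
    and st: "opt_step q_step x q q'"
  shows "\<exists>es'. unm_rep (add_op x (e0, e1, e2) (first_unm es) K) es' q'"
proof -
  have unm: "lab K e = Send 0 1" if "e \<in> unm K" for e
    using rep that by (auto simp: unm_rep_def)
  note S = pre_cmsc_add_sync[OF K e(1,2) _ Ms(1) unm]
  have K1: "pre_cmsc procs Ms (add_sync K e0 e1)" and u: "unm (add_sync K e0 e1) = unm K"
    using S e by auto
  have inE: "y \<in> events K" "y \<noteq> e0" "y \<noteq> e1" "y \<noteq> e2" if "y \<in> unm K" for y
    using that e by (auto simp: unm_def)
  have "map (mark (add_sync K e0 e1)) es = map (mark K) es"
    using inE rep by (intro map_cong) (auto simp: unm_rep_def)
  then have rep1: "unm_rep (add_sync K e0 e1) es q"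
    using rep inE unfolding unm_rep_def u
    by (auto simp: subsetD[OF le_add_sync] elim!: sorted_wrt_mono_rel[rotated])
  consider "x = None" | a where "x = Some (Read a)" | a where "x = Some (Write a)"
    by (metis option.exhaust q_act.exhaust)
  then show ?thesis
  proof cases
    case 1
    then show ?thesis using rep1 st by auto
  next
    case (2 a)
    then have q: "q = a # q'" using st by simp
    then obtain y ys where es: "es = y # ys" using rep by (cases es) (auto simp: unm_rep_def)
    have y: "y \<in> unm K" "y \<notin> set ys" using rep es by (auto simp: unm_rep_def)
    let ?K = "add_event (add_sync K e0 e1) e2 (Recv 1 0) (Some y) a"
    have u2: "unm ?K = unm K - {y}"
      by (subst unm_add_event[OF K1]) (use e u y in auto)
     have "set ys = unm K - {y}" using rep y(2) unfolding es unm_rep_def by auto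
    moreover have "map (mark ?K) ys = map (mark (add_sync K e0 e1)) ys"
      using y(2) by (intro map_cong) auto
    ultimately have "unm_rep ?K ys q'"
      using rep1 inE q y(2) unfolding unm_rep_def u2 es
      by (auto simp: subsetD[OF le_add_event] elim!: sorted_wrt_mono_rel[rotated])
    then show ?thesis using 2 es by (auto simp: first_unm_def)
  next
    case (3 a)
    let ?K = "add_event (add_sync K e0 e1) e2 (Send 0 1) None a"
    have u2: "unm ?K = insert e2 (unm K)"
      by (subst unm_add_event[OF K1]) (use e u in auto)
    have last: "(y, e2) \<in> le ?K" if "y \<in> unm K" for y
      using pre_cmsc_le(2)[OF K1, of y] inE[OF that] unm[OF that]
      by (force simp: add_event_def[of "add_sync K e0 e1"])
    have "sorted_wrt (\<lambda>e f. (e, f) \<in> le ?K \<and> e \<noteq> f) es"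
      using rep1 unfolding unm_rep_def
      by (auto simp: subsetD[OF le_add_event] elim!: sorted_wrt_mono_rel[rotated])
    moreover have "set es = unm K" using rep by (simp add: unm_rep_def)
    moreover have "map (mark ?K) es = map (mark (add_sync K e0 e1)) es"
      using inE \<open>set es = unm K\<close> by (intro map_cong) auto
    then have "map (mark ?K) es = map Some q" using rep1 unfolding unm_rep_def by (simp only:)
    ultimately have "unm_rep ?K (es @ [e2]) (q @ [a])"
      using last inE unm unfolding unm_rep_def u2
      by (auto simp: sorted_wrt_append)
    then show ?thesis using 3 st by auto
  qed
qed

lemma unm_rep_empty: "unm_rep empty_cmsc [] []"
  by (simp add: unm_rep_def)

text \<open>The same operation, built alone on the same events, is the second factor. The only new
  edge comes from a read, and its two messages agree because \<open>q_step\<close> requires the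
  letter read to be the head of the queue.\<close>

lemma is_conc_add_op:
  assumes K: "pre_cmsc procs Ms K" and e: "e0 \<notin> events K" "e1 \<notin> events K" "e2 \<notin> events K" "distinct [e0, e1, e2]"
    and Ms: "0 \<in> Ms" and rep: "unm_rep K es q" and st: "opt_step q_step x q q'"
  shows "is_conc procs K (op_cmsc x (e0, e1, e2)) (add_op x (e0, e1, e2) (first_unm es) K)"
proof -
  have unm: "lab K e = Send 0 1" if "e \<in> unm K" for e
    using rep that by (auto simp: unm_rep_def)
  have K1: "pre_cmsc procs Ms (add_sync K e0 e1)" and u: "unm (add_sync K e0 e1) = unm K"
    using pre_cmsc_add_sync[OF K e(1,2) _ Ms(1) unm] e by auto
  have N1: "pre_cmsc procs Ms (add_sync empty_cmsc e0 e1)"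
    using pre_cmsc_add_sync[OF pre_cmsc_empty, of e0 e1 Ms] e Ms by auto
  have [simp]: "events_at procs empty_cmsc p = {}" "le_at procs empty_cmsc p = {}" for p
    by (auto simp: events_at_def le_at_def)
  note simps = le_at_add_sync(1)[OF K e(1,2) _ Ms] le_at_add_sync(2)[OF K e(1,2) _ Ms]
    le_at_add_sync(1)[OF pre_cmsc_empty _ _ _ Ms, simplified] le_at_add_sync(2)[OF pre_cmsc_empty _ _ _ Ms, simplified]
    le_at_add_event[OF K1] le_at_add_event[OF N1] events_at_add_event
  have ne: "e0 \<noteq> e1" "e0 \<noteq> e2" "e1 \<noteq> e2" using e by auto
  have em: "x \<notin> unm K" if "x \<notin> events K" for x using that by (auto simp: unm_def)
  consider "x = None" | a where "x = Some (Read a)" | a where "x = Some (Write a)"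
    by (metis option.exhaust q_act.exhaust)
  then show ?thesis
  proof cases
    case 1
    show ?thesis
      unfolding is_conc_def 1 add_op.simps using ne e
      by (simp add: simps u em) (auto simp: em)
  next
    case (2 a)
    then have q: "q = a # q'" using st by simp
    then obtain y ys where es: "es = y # ys" using rep by (cases es) (auto simp: unm_rep_def)
    have y: "y \<in> unm K" "mark K y = Some a" using rep es q by (auto simp: unm_rep_def)
    have yE: "y \<in> events K" using y(1) by (auto simp: unm_def)
    have fu: "first_unm es = Some y" by (simp add: es first_unm_def)
    show ?thesis
      unfolding is_conc_def 2 add_op.simps fu using ne e y yE
      by (simp add: simps u em) (auto simp: em unm_def)
  next
    case (3 a)
    show ?thesis
      unfolding is_conc_def 3 add_op.simps using ne e
      by (simp add: simps u em) (auto simp: em unm_def)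
  qed
qed

section \<open>Products of queue operations\<close>

lemma is_cmscD:
  assumes "is_cmsc P Ms M"
  shows "events M \<noteq> {}" "partial_order_on (events M) (le M)" "lab M \<in> events M \<rightarrow>\<^sub>E Act P"
    "dom (mark M) = unm M" "lhd M \<subseteq> le M"
    "\<forall>(e, f)\<in>lhd M. \<exists>(p, q)\<in>Ch P. lab M e = Send p q \<and> lab M f = Recv q p"
    "\<forall>p\<in>P. \<forall>q\<in>P. \<forall>(e, f)\<in>lhd M. \<forall>(e', f')\<in>lhd M.
        e \<in> events_at P M p \<longrightarrow> e' \<in> events_at P M p \<longrightarrow>
        f \<in> events_at P M q \<longrightarrow> f' \<in> events_at P M q \<longrightarrow>
        ((e, e') \<in> le_at P M p \<longleftrightarrow> (f, f') \<in> le_at P M q)"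
    "le M = Restr ((proc_succ P M \<union> lhd M)\<^sup>*) (events M)"
    "\<forall>(e, f)\<in>lhd M. \<forall>g\<in>unm M.
        (lab M g = lab M e \<longrightarrow> (e, g) \<in> le M \<and> e \<noteq> g) \<and>
        (lab M g = lab M f \<longrightarrow> (g, f) \<in> le M \<and> g \<noteq> f)"
  using assms unfolding is_cmsc_def by - (elim conjE, assumption)+

lemma is_cmsc_le:
  assumes "is_cmsc P Ms M"
  shows "le M \<subseteq> events M \<times> events M"
    and "\<And>x. x \<in> events M \<Longrightarrow> (x, x) \<in> le M"
    and "\<And>x y z. (x, y) \<in> le M \<Longrightarrow> (y, z) \<in> le M \<Longrightarrow> (x, z) \<in> le M"
    and "\<And>x y. (x, y) \<in> le M \<Longrightarrow> (y, x) \<in> le M \<Longrightarrow> x = y"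
  using is_cmscD(2)[OF assms] unfolding partial_order_on_iff by - (elim conjE, blast)+

text \<open>FIFO applied to two edges into \<open>x\<close> compares their sources in both
  directions, as \<open>x\<close> is below itself.\<close>

lemma is_cmsc_unique_source:
  assumes M: "is_cmsc P Ms M" and "(e, x) \<in> lhd M" "(e', x) \<in> lhd M"
  shows "e = e'"
proof -
  obtain p q where pq: "(p, q) \<in> Ch P" "lab M e = Send p q" "lab M x = Recv q p"
    using is_cmscD(6)[OF M] assms(2) by blast
  have e': "lab M e' = Send p q"
    using is_cmscD(6)[OF M] assms(3) pq(3) by force
  have in_P: "p \<in> P" "q \<in> P" using pq(1) by (auto simp: Ch_def)
  have ev: "e \<in> events M" "e' \<in> events M" "x \<in> events M"
    using assms(2,3) is_cmscD(5)[OF M] is_cmsc_le(1)[OF M] by blast+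
  have at: "e \<in> events_at P M p" "e' \<in> events_at P M p" "x \<in> events_at P M q"
    using ev e' pq unfolding events_at_eq[OF is_cmscD(3)[OF M]] by auto
  have "(x, x) \<in> le_at P M q"
    using at(3) ev is_cmsc_le(2)[OF M] by (auto simp: le_at_def)
  moreover have "(e, e') \<in> le_at P M p \<longleftrightarrow> (x, x) \<in> le_at P M q"
    using is_cmscD(7)[OF M, THEN bspec, OF in_P(1), THEN bspec, OF in_P(2)] assms(2,3) at by blast
  moreover have "(e', e) \<in> le_at P M p \<longleftrightarrow> (x, x) \<in> le_at P M q"
    using is_cmscD(7)[OF M, THEN bspec, OF in_P(1), THEN bspec, OF in_P(2)] assms(2,3) at by blast
  ultimately show ?thesis using is_cmsc_le(4)[OF M] by (auto simp: le_at_def)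
qed

text \<open>Isomorphisms preserve marks, and the marked events are exactly the unmatched ones, so
  \<open>unm\<close> is mapped onto \<open>unm\<close>.\<close>

lemma cmsc_iso_unm:
  assumes iso: "cmsc_iso M M'" and M: "is_cmsc P Ms M" and M': "is_cmsc P Ms M'"
  obtains h where "inj_on h (events M)" "events M' = h ` events M" "unm M' = h ` unm M"
    "\<And>e f. e \<in> events M \<Longrightarrow> f \<in> events M \<Longrightarrow> (e, f) \<in> le M \<longleftrightarrow> (h e, h f) \<in> le M'"
    "\<And>e. e \<in> events M \<Longrightarrow> lab M' (h e) = lab M e \<and> mark M' (h e) = mark M e"
proof -
  obtain h where h: "bij_betw h (events M) (events M')"
     "\<forall>e\<in>events M. \<forall>f\<in>events M.
        ((e, f) \<in> le M \<longleftrightarrow> (h e, h f) \<in> le M') \<and> ((e, f) \<in> lhd M \<longleftrightarrow> (h e, h f) \<in> lhd M')"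
     "\<forall>e\<in>events M. lab M' (h e) = lab M e \<and> mark M' (h e) = mark M e"
    using iso unfolding cmsc_iso_def by blast
  have ev: "events M' = h ` events M" using h(1) by (simp add: bij_betw_def)
  have "unm M' = h ` unm M"
  proof -
    have "e' \<in> dom (mark M') \<longleftrightarrow> e' \<in> h ` dom (mark M)" if e': "e' \<in> events M'" for e'
    proof -
      obtain e where e: "e' = h e" "e \<in> events M" using e' ev by auto
      have "e = u" if "h e = h u" "u \<in> events M" for u
        using that h(1) e(2) by (auto simp: bij_betw_def inj_on_def)
      moreover have "dom (mark M) \<subseteq> events M" using is_cmscD(4)[OF M] by (auto simp: unm_def)
      ultimately show ?thesis using e h(3) by (auto simp: image_iff)
    qed
    moreover have "h ` dom (mark M) \<subseteq> events M'" "dom (mark M') \<subseteq> events M'"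
      using is_cmscD(4)[OF M] is_cmscD(4)[OF M'] ev by (auto simp: unm_def)
    ultimately have "dom (mark M') = h ` dom (mark M)" by blast
    then show ?thesis using is_cmscD(4)[OF M] is_cmscD(4)[OF M'] by simp
  qed
  then show ?thesis using that[of h] h ev by (auto simp: bij_betw_def)
qed

lemma unm_rep_iso:
  assumes iso: "cmsc_iso M M'" and M: "is_cmsc P Ms M" "is_cmsc P Ms M'" and rep: "unm_rep M es q"
  shows "\<exists>es'. unm_rep M' es' q"
proof -
  obtain h where h: "inj_on h (events M)" "events M' = h ` events M" "unm M' = h ` unm M"
    "\<And>e f. e \<in> events M \<Longrightarrow> f \<in> events M \<Longrightarrow> (e, f) \<in> le M \<longleftrightarrow> (h e, h f) \<in> le M'"
    "\<And>e. e \<in> events M \<Longrightarrow> lab M' (h e) = lab M e \<and> mark M' (h e) = mark M e"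
    by (rule cmsc_iso_unm[OF iso M]) blast
  have es: "set es = unm M" "set es \<subseteq> events M" using rep by (auto simp: unm_rep_def unm_def)
  have "sorted_wrt (\<lambda>e f. (h e, h f) \<in> le M' \<and> h e \<noteq> h f) es"
    by (rule sorted_wrt_mono_rel[of _ "\<lambda>e f. (e, f) \<in> le M \<and> e \<noteq> f"])
      (use rep es h(1,4) in \<open>auto simp: unm_rep_def inj_on_def subset_iff\<close>)
  moreover have "map (mark M') (map h es) = map (mark M) es"
    using es h(5) by auto
  ultimately have "unm_rep M' (map h es) q"
    using rep es h(3,5) unfolding unm_rep_def by (auto simp: sorted_wrt_map simp del: map_map)
  then show ?thesis by blast
qed

text \<open>The trace of an operation that survives isomorphism: its unmatched event, if any, with
  action and message.\<close>

fun op_unm :: "q_act option \<Rightarrow> ('e, nat, nat) cmsc \<Rightarrow> bool" where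
  "op_unm None M \<longleftrightarrow> unm M = {}"
| "op_unm (Some (Read a)) M \<longleftrightarrow> (\<exists>x. unm M = {x} \<and> lab M x = Recv 1 0 \<and> mark M x = Some a)"
| "op_unm (Some (Write a)) M \<longleftrightarrow> (\<exists>x. unm M = {x} \<and> lab M x = Send 0 1 \<and> mark M x = Some a)"

lemma q_act_option_cases:
  obtains "x = None" | a where "x = Some (Read a)" | a where "x = Some (Write a)"
  by (metis option.exhaust q_act.exhaust)

lemma op_unm_op_cmsc:
  assumes "distinct [e0, e1, e2]"
  shows "op_unm x (op_cmsc x (e0, e1, e2))"
  by (cases x rule: q_act_option_cases) (use assms in \<open>auto simp: unm_def\<close>)

lemma op_unm_iso:
  assumes "cmsc_iso M M'" "is_cmsc P Ms M" "is_cmsc P Ms M'" "op_unm x M"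
  shows "op_unm x M'"
proof -
  obtain h where h: "unm M' = h ` unm M"
    "\<And>e. e \<in> events M \<Longrightarrow> lab M' (h e) = lab M e \<and> mark M' (h e) = mark M e"
    by (rule cmsc_iso_unm[OF assms(1-3)]) blast
  have "unm M \<subseteq> events M" by (auto simp: unm_def)
  then show ?thesis using assms(4) h by (cases x rule: q_act_option_cases) auto
qed

text \<open>\<open>is_conc\<close> only speaks of process orders and message edges; the order of a
  factor is contained in that of \<open>M\<close> because these generate it.\<close>

lemma is_conc_le:
  assumes M: "is_cmsc P Ms M" and M12: "is_cmsc P Ms M1" "is_cmsc P Ms M2" and conc: "is_conc P M1 M2 M"
  shows "le M1 \<subseteq> le M" "le M2 \<subseteq> le M"
proof -
  have *: "le N \<subseteq> le M" if N: "is_cmsc P Ms N" "events N \<subseteq> events M" "lhd N \<subseteq> lhd M"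
    "\<And>p. p \<in> P \<Longrightarrow> le_at P N p \<subseteq> le_at P M p" for N
  proof (intro subrelI)
    fix x y assume xy: "(x, y) \<in> le N"
    have sub: "proc_succ P N \<union> lhd N \<subseteq> le M"
      using N(3,4) is_cmscD(5)[OF M] by (fastforce simp: proc_succ_def succ_at_def le_at_def)
    have "(x, y) \<in> (proc_succ P N \<union> lhd N)\<^sup>*" "x \<in> events M"
      using xy N(2) is_cmscD(8)[OF N(1)] by blast+
    then show "(x, y) \<in> le M"
    proof (induction rule: rtrancl_induct)
      case base
      then show ?case using is_cmsc_le(2)[OF M] by blast
    next
      case (step y z)
      then show ?case using sub is_cmsc_le(3)[OF M] by blast
    qed
  qed
  show "le M1 \<subseteq> le M"
    by (rule *[OF M12(1)]) (use conc in \<open>auto simp: is_conc_def\<close>)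
  show "le M2 \<subseteq> le M"
    by (rule *[OF M12(2)]) (use conc in \<open>auto simp: is_conc_def\<close>)
qed

text \<open>The core of soundness: whatever edges a concatenation adds, the pending sends change as
  the queue does. New edges lead from unmatched events of \<open>M1\<close> to unmatched events of
  \<open>M2\<close>, and the latter has at most one. A receive pending in \<open>M1\<close> could
  not become a source, which gives the first claim.\<close>

lemma is_conc_unm:
  assumes M: "is_cmsc procs Ms M" "is_cmsc procs Ms M1" "is_cmsc procs Ms M2"
    and conc: "is_conc procs M1 M2 M"
    and unm: "\<And>e. e \<in> unm M \<Longrightarrow> lab M e = Send 0 1"
    and op: "op_unm x M2"
  shows "\<And>e. e \<in> unm M1 \<Longrightarrow> lab M1 e = Send 0 1"
    and "unm_rep M1 es q \<Longrightarrow> \<exists>q' es'. opt_step q_step x q q' \<and> unm_rep M es' q'"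
proof -
  have dis: "events M1 \<inter> events M2 = {}" and evs: "events M = events M1 \<union> events M2"
    and le_at: "\<And>p. p \<in> procs \<Longrightarrow> le_at procs M p = le_at procs M1 p \<union> le_at procs M2 p \<union>
        events_at procs M1 p \<times> events_at procs M2 p"
    and lhd: "lhd M1 \<union> lhd M2 \<subseteq> lhd M"
    and new: "\<And>e f. (e, f) \<in> lhd M \<Longrightarrow> (e, f) \<notin> lhd M1 \<Longrightarrow> (e, f) \<notin> lhd M2 \<Longrightarrow> e \<in> events M1 \<and> f \<in> events M2 \<and>
        (\<exists>m. mark M1 e = Some m \<and> mark M2 f = Some m)"
    and lab: "\<And>e. e \<in> events M1 \<Longrightarrow> lab M e = lab M1 e" "\<And>e. e \<in> events M2 \<Longrightarrow> lab M e = lab M2 e"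
    and mark: "\<And>e. e \<in> events M1 \<Longrightarrow> e \<in> unm M \<Longrightarrow> mark M e = mark M1 e"
       "\<And>e. e \<in> events M2 \<Longrightarrow> e \<in> unm M \<Longrightarrow> mark M e = mark M2 e"
    using conc unfolding is_conc_def by blast+
  have edge: "\<exists>p q. lab M e = Send p q \<and> lab M f = Recv q p" if "(e, f) \<in> lhd M" for e f
    using is_cmscD(6)[OF M(1)] that by blast
  have lhd_in: "e \<in> events M1" "f \<in> events M1" if "(e, f) \<in> lhd M1" for e f
    using that is_cmscD(5)[OF M(2)] is_cmsc_le(1)[OF M(2)] by blast+
  have lhd_in2: "e \<in> events M2" "f \<in> events M2" if "(e, f) \<in> lhd M2" for e f
    using that is_cmscD(5)[OF M(3)] is_cmsc_le(1)[OF M(3)] by blast+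
  have new_target: "f \<in> unm M2 \<and> lab M2 f \<noteq> Send 0 1 \<and> e \<in> unm M1"
    if "(e, f) \<in> lhd M" "(e, f) \<notin> lhd M1" "(e, f) \<notin> lhd M2" for e f
    using new[OF that] edge[OF that(1)] lab is_cmscD(4)[OF M(2)] is_cmscD(4)[OF M(3)] by (auto simp: dom_def)
  have unm_in: "e \<in> events M1" if "e \<in> unm M1" for e using that by (auto simp: unm_def)
  have unm_in2: "e \<in> events M2" if "e \<in> unm M2" for e using that by (auto simp: unm_def)
  note le_sub = is_conc_le[OF M conc]
  show lab1: "lab M1 e = Send 0 1" if e: "e \<in> unm M1" for e
  proof (cases "e \<in> unm M")
    case True
    then show ?thesis using unm e lab(1) unm_in by metis
  next
    case False
    have e1: "e \<in> events M1" using e unm_in by blast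
    then obtain f where f: "(e, f) \<in> lhd M \<or> (f, e) \<in> lhd M"
      using False evs by (auto simp: unm_def)
    moreover have "(e, f) \<notin> lhd M1" "(f, e) \<notin> lhd M1" using e by (auto simp: unm_def)
    moreover have "(e, f) \<notin> lhd M2" "(f, e) \<notin> lhd M2" using e1 dis lhd_in2 by blast+
    ultimately have ef: "(e, f) \<in> lhd M" and f2: "f \<in> unm M2" "lab M2 f \<noteq> Send 0 1"
      using new_target new e1 dis by blast+
    have "lab M2 f = Recv 1 0" using f2 op by (cases x rule: q_act_option_cases) auto
    then show ?thesis using edge[OF ef] lab e1 unm_in2[OF f2(1)] by auto
  qed
  have unmM: "e \<in> unm M \<longleftrightarrow> e \<in> unm M1 \<union> unm M2 \<and> \<not> (\<exists>f. ((e, f) \<in> lhd M \<or> (f, e) \<in> lhd M))" for e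
    using evs lhd by (auto simp: unm_def)
  have sorted: "sorted_wrt (\<lambda>e f. (e, f) \<in> le M \<and> e \<noteq> f) es" if "unm_rep M1 es q" for es q
    by (rule sorted_wrt_mono_rel[of _ "\<lambda>e f. (e, f) \<in> le M1 \<and> e \<noteq> f"])
      (use that le_sub in \<open>auto simp: unm_rep_def\<close>)
  have keep: "unm M1 \<subseteq> unm M" if no: "\<And>f. f \<in> unm M2 \<Longrightarrow> lab M2 f = Send 0 1"
  proof
    fix e assume e: "e \<in> unm M1"
    have "(e, f) \<notin> lhd M \<and> (f, e) \<notin> lhd M" for f
    proof -
      have "(e, f) \<notin> lhd M1" "(f, e) \<notin> lhd M1" using e by (auto simp: unm_def)
      moreover have "(e, f) \<notin> lhd M2" "(f, e) \<notin> lhd M2" using unm_in[OF e] dis lhd_in2 by blast+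
      ultimately show ?thesis using new_target no by metis
    qed
    then show "e \<in> unm M" using e unmM by blast
  qed
  assume rep: "unm_rep M1 es q"
  have es: "set es = unm M1" "map (mark M1) es = map Some q" using rep by (auto simp: unm_rep_def)
  show "\<exists>q' es'. opt_step q_step x q q' \<and> unm_rep M es' q'"
  proof (cases x rule: q_act_option_cases)
    case 1
    then have u: "unm M2 = {}" using op by simp
    then have "unm M1 \<subseteq> unm M" using keep by blast
    then have "unm M = unm M1" using u unmM by blast
    moreover from this have "map (mark M) es = map (mark M1) es"
      using mark(1) unm_in es by (intro map_cong) auto
    ultimately have "unm_rep M es q" using sorted[OF rep] es unm by (simp add: unm_rep_def)
    then show ?thesis using 1 by auto
  next
    case (3 a)
    then obtain y where y: "unm M2 = {y}" "lab M2 y = Send 0 1" "mark M2 y = Some a" using op by auto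
    have y2: "y \<in> events M2" using y(1) unm_in2 by blast
    have sub: "unm M1 \<subseteq> unm M" using keep y by simp
    have "y \<in> unm M"
    proof -
      have "(y, f) \<notin> lhd M \<and> (f, y) \<notin> lhd M" for f
      proof -
        have "(y, f) \<notin> lhd M2" "(f, y) \<notin> lhd M2" using y(1) by (auto simp: unm_def)
        moreover have "(y, f) \<notin> lhd M1" "(f, y) \<notin> lhd M1" using y2 dis lhd_in by blast+
        ultimately show ?thesis using new_target[of y f] new_target[of f y] y unm_in y2 dis by auto
      qed
      then show ?thesis using y(1) unmM by blast
    qed
    then have u: "unm M = insert y (unm M1)" using sub unmM y(1) by blast
    have last: "(e, y) \<in> le M \<and> e \<noteq> y" if "e \<in> unm M1" for e
    proof
      have "e \<in> events_at procs M1 0"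
        using lab1[OF that] unm_in[OF that] unfolding events_at_eq[OF is_cmscD(3)[OF M(2)]] by simp
      moreover have "y \<in> events_at procs M2 0"
        using y y2 unfolding events_at_eq[OF is_cmscD(3)[OF M(3)]] by simp
      ultimately have "(e, y) \<in> le_at procs M 0" using le_at[of 0] by blast
      then show "(e, y) \<in> le M" by (simp add: le_at_def)
      show "e \<noteq> y" using unm_in[OF that] y2 dis by blast
    qed
    have "map (mark M) es = map (mark M1) es"
      using mark(1) unm_in es u by (intro map_cong) auto
    moreover have "mark M y = Some a" using mark(2)[OF y2 \<open>y \<in> unm M\<close>] y(3) by simp
    ultimately have "unm_rep M (es @ [y]) (q @ [a])"
      using sorted[OF rep] es unm u last by (auto simp: unm_rep_def sorted_wrt_append)
    then show ?thesis using 3 by auto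
  next
    case (2 a)
    then obtain y where y: "unm M2 = {y}" "lab M2 y = Recv 1 0" "mark M2 y = Some a" using op by auto
    have y2: "y \<in> events M2" using y(1) unm_in2 by blast
    then have "lab M y = Recv 1 0" using lab y by simp
    \<comment> \<open>The assumption excludes unmatched receives, so the concatenation must have
      matched \<open>y\<close>.\<close>
    then have "y \<notin> unm M" using unm by fastforce
    then obtain e where "(e, y) \<in> lhd M \<or> (y, e) \<in> lhd M" using y2 evs by (auto simp: unm_def)
    then have ey: "(e, y) \<in> lhd M" using edge[of y e] \<open>lab M y = Recv 1 0\<close> by auto
    moreover have "(e, y) \<notin> lhd M1" using y2 dis lhd_in by blast
    moreover have "(e, y) \<notin> lhd M2" using y(1) by (auto simp: unm_def)
    ultimately have "e \<in> unm M1" "\<exists>m. mark M1 e = Some m \<and> mark M2 y = Some m"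
      using new_target[of e y] new[of e y] by blast+
    then have e: "e \<in> unm M1" "mark M1 e = Some a" using y(3) by simp_all
    have labe: "lab M e = Send 0 1" using lab1[OF e(1)] lab(1) unm_in[OF e(1)] by simp
    have enM: "e \<notin> unm M" using ey by (auto simp: unm_def)
    \<comment> \<open>All other pending sends stay pending: a new edge from \<open>g\<close> could
      only lead to \<open>y\<close>, which already has a source.\<close>
    have rest: "g \<in> unm M" if g: "g \<in> unm M1" "g \<noteq> e" for g
    proof (rule ccontr)
      assume "g \<notin> unm M"
      then obtain f where f: "(g, f) \<in> lhd M \<or> (f, g) \<in> lhd M" using g(1) unmM by blast
      moreover have "(g, f) \<notin> lhd M1" "(f, g) \<notin> lhd M1" using g by (auto simp: unm_def)
      moreover have "g \<notin> events M2" using unm_in[OF g(1)] dis by blast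
      moreover from this have "(g, f) \<notin> lhd M2" "(f, g) \<notin> lhd M2"
        using lhd_in2[of g f] lhd_in2[of f g] by blast+
      ultimately have "(g, f) \<in> lhd M" "f \<in> unm M2"
        using new_target[of g f] new[of f g] by blast+
      then have "(g, y) \<in> lhd M" using y(1) by simp
      then show False using is_cmsc_unique_source[OF M(1) ey] g(2) by blast
    qed
    have "unm M \<subseteq> unm M1 \<union> {y}" using unmM y(1) by auto
    then have u: "unm M = unm M1 - {e}"
      using rest enM \<open>y \<notin> unm M\<close> by auto
    \<comment> \<open>A matched send precedes the unmatched sends of its action. This makes
      \<open>e\<close> the oldest pending send, hence the head of \<open>es\<close>.\<close>
    have first: "(e, g) \<in> le M \<and> e \<noteq> g" if "g \<in> unm M" for g
    proof -
      have "lab M g = lab M e \<longrightarrow> (e, g) \<in> le M \<and> e \<noteq> g"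
        using is_cmscD(9)[OF M(1)] ey that by blast
      then show ?thesis using unm[OF that] labe by simp
    qed
    obtain z zs where zs: "es = z # zs" using e(1) es by (cases es) auto
    have z: "z \<notin> set zs" "\<And>g. g \<in> set zs \<Longrightarrow> (z, g) \<in> le M"
      using sorted[OF rep] unfolding zs by auto
    have "e = z"
    proof (rule ccontr)
      assume ne: "e \<noteq> z"
      have "z \<in> unm M1" using es zs by auto
      then have "(e, z) \<in> le M" using rest[of z] first ne by blast
      moreover have "(z, e) \<in> le M" using z(2) ne es e(1) zs by auto
      ultimately show False using is_cmsc_le(4)[OF M(1)] ne by blast
    qed
    then obtain q' where q: "q = a # q'" "map (mark M1) zs = map Some q'"
      using es zs e(2) by auto
    have uz: "set zs = unm M" using u es zs \<open>e = z\<close> z(1) by auto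
    have "map (mark M) zs = map (mark M1) zs"
      using mark(1) unm_in es zs uz by (intro map_cong) auto
    then have "unm_rep M zs q'"
      using sorted[OF rep] q unm uz unfolding zs by (simp add: unm_rep_def)
    then show ?thesis using 2 q by auto
  qed
qed

section \<open>Products of operations and runs of the queue\<close>

lemma fin_prod_snoc:
  "xs \<noteq> [] \<Longrightarrow> fin_prod P Ms (xs @ [N]) = (\<Union>K\<in>fin_prod P Ms xs. conc P Ms K N)"
  by (cases xs) auto

lemma fin_prod_is_cmsc: "M \<in> fin_prod P Ms xs \<Longrightarrow> is_cmsc P Ms M"
proof (cases xs rule: rev_cases)
  case (snoc ys N)
  then show "M \<in> fin_prod P Ms xs \<Longrightarrow> is_cmsc P Ms M"
    by (cases "ys = []") (auto simp: fin_prod_snoc conc_def)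
qed simp

abbreviation std_op :: "q_act option \<Rightarrow> (nat, nat, nat) cmsc" where
  "std_op x \<equiv> op_cmsc x (0, 1, 2)"

primrec q_run :: "q_act option list \<Rightarrow> nat list \<Rightarrow> nat list \<Rightarrow> bool" where
  "q_run [] = (=)"
| "q_run (x # w) = opt_step q_step x OO q_run w"

lemma q_run_append: "q_run (v @ w) = q_run v OO q_run w"
  by (induction v) (auto simp: relcompp_assoc OO_def)

lemma cmsc_iso_refl: "cmsc_iso M M"
  unfolding cmsc_iso_def by (intro exI[of _ id]) auto

lemma cmsc_iso_op_cmsc:
  assumes "distinct [e0, e1, e2]"
  shows "cmsc_iso (std_op x) (op_cmsc x (e0, e1, e2))"
proof -
  let ?h = "(\<lambda>_. e0)(1::nat := e1, 2 := e2)"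
  have h: "?h (0::nat) = e0" "?h 1 = e1" "?h 2 = e2" by auto
  show ?thesis
    unfolding cmsc_iso_def
    by (intro exI[of _ ?h], cases x rule: q_act_option_cases)
      (use assms in \<open>auto simp: bij_betw_def inj_on_def add_sync_def add_event_def\<close>)
qed

lemma pre_cmsc_op_cmsc:
  assumes "0 \<in> Ms" "letters x \<subseteq> Ms" "distinct [e0, e1, e2]"
  shows "pre_cmsc procs Ms (op_cmsc x (e0, e1, e2))"
  using pre_cmsc_add_op[OF pre_cmsc_empty _ _ _ assms(3,1,2) unm_rep_empty]
  by (simp add: first_unm_def)

lemma is_cmsc_op_cmsc:
  assumes "0 \<in> Ms" "letters x \<subseteq> Ms" "distinct [e0, e1, e2]"
  shows "is_cmsc procs Ms (op_cmsc x (e0, e1, e2))"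
  by (rule is_cmsc_if_pre_cmsc[OF pre_cmsc_op_cmsc[OF assms]])
    (cases x rule: q_act_option_cases; simp)

text \<open>The condition on \<open>unm M\<close>, weaker than emptiness, is what the prefixes of a
  product inherit: they may have pending sends, but no pending receives. The induction starts with
  one factor, as \<open>fin_prod\<close> of the empty list is empty.\<close>

lemma fin_prod_ops_sound:
  assumes "w \<noteq> []" and "M \<in> fin_prod procs Ms (map std_op w)" and "0 \<in> Ms"
    and "\<And>x. x \<in> set w \<Longrightarrow> letters x \<subseteq> Ms"
    and "\<And>e. e \<in> unm M \<Longrightarrow> lab M e = Send 0 1"
  shows "\<exists>q es. q_run w [] q \<and> unm_rep M es q"
  using assms
proof (induction w arbitrary: M rule: rev_nonempty_induct)
  case (single x)
  then have iso: "cmsc_iso (std_op x) M" and M: "is_cmsc procs Ms M" by auto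
  have N: "is_cmsc procs Ms (std_op x)" by (rule is_cmsc_op_cmsc) (use single(2) single(3) in auto)
  have op: "op_unm x M"
    by (rule op_unm_iso[OF iso N M]) (simp add: op_unm_op_cmsc)
  show ?case
  proof (cases x rule: q_act_option_cases)
    case 1
    then show ?thesis using op by (auto simp: unm_rep_def)
  next
    case (2 a)
    then show ?thesis using op single(4) by fastforce
  next
    case (3 a)
    then obtain y where "unm M = {y}" "lab M y = Send 0 1" "mark M y = Some a" using op by auto
    then have "unm_rep M [y] [a]" by (simp add: unm_rep_def)
    then show ?thesis using 3 by auto
  qed
next
  case (snoc x w)
  then obtain K M1 M2 where K: "K \<in> fin_prod procs Ms (map std_op w)"
    and M: "is_cmsc procs Ms M" "is_cmsc procs Ms M1" "is_cmsc procs Ms M2"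
    and iso: "cmsc_iso K M1" "cmsc_iso (std_op x) M2" and conc: "is_conc procs M1 M2 M"
    by (auto simp: fin_prod_snoc conc_def)
  have K': "is_cmsc procs Ms K" using fin_prod_is_cmsc[OF K] .
  have N: "is_cmsc procs Ms (std_op x)" by (rule is_cmsc_op_cmsc) (use \<open>0 \<in> Ms\<close> snoc.prems(3) in auto)
  have op: "op_unm x M2"
    by (rule op_unm_iso[OF iso(2) N M(3)]) (simp add: op_unm_op_cmsc)
  note step = is_conc_unm[OF M conc snoc.prems(4) op]
  have "lab K e = Send 0 1" if "e \<in> unm K" for e
  proof -
    obtain h where h: "unm M1 = h ` unm K"
      "\<And>e. e \<in> events K \<Longrightarrow> lab M1 (h e) = lab K e \<and> mark M1 (h e) = mark K e"
      by (rule cmsc_iso_unm[OF iso(1) K' M(2)]) blast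
    have "e \<in> events K" using that by (auto simp: unm_def)
    then show ?thesis using h step(1)[of "h e"] that by auto
  qed
  then obtain q es where q: "q_run w [] q" "unm_rep K es q"
    using snoc.IH[OF K \<open>0 \<in> Ms\<close>] snoc.prems(3) by auto
  obtain es1 where "unm_rep M1 es1 q" using unm_rep_iso[OF iso(1) K' M(2) q(2)] by blast
  then obtain q' es' where "opt_step q_step x q q'" "unm_rep M es' q'" using step(2) by blast
  then show ?case using q(1) by (auto simp: q_run_append)
qed

text \<open>One product is constructed: three fresh numbers become the events of the next operation,
  whose copy on them is isomorphic to \<open>std_op x\<close>. \<open>pre_cmsc\<close> is carried
  along for the next \<open>add_op\<close>.\<close>

lemma fin_prod_ops_complete:
  assumes "w \<noteq> []" and "q_run w [] q" and "0 \<in> Ms" and "\<And>x. x \<in> set w \<Longrightarrow> letters x \<subseteq> Ms"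
  shows "\<exists>M es. M \<in> fin_prod procs Ms (map std_op w) \<and> pre_cmsc procs Ms M \<and> unm_rep M es q"
  using assms
proof (induction w arbitrary: q rule: rev_nonempty_induct)
  case (single x)
  have "is_cmsc procs Ms (std_op x)" "pre_cmsc procs Ms (std_op x)"
    using single by (auto intro!: is_cmsc_op_cmsc pre_cmsc_op_cmsc)
  moreover have "\<exists>es'. unm_rep (std_op x) es' q"
    using unm_rep_add_op[OF pre_cmsc_empty _ _ _ _ single(2) unm_rep_empty, of "0 :: nat" 1 2 x q] single(1)
    by (auto simp: first_unm_def)
  ultimately show ?case using cmsc_iso_refl[of "std_op x"] by auto
next
  case (snoc x w)
  then obtain q0 where q0: "q_run w [] q0" "opt_step q_step x q0 q" by (auto simp: q_run_append)
  then obtain K es where K: "K \<in> fin_prod procs Ms (map std_op w)" "pre_cmsc procs Ms K" "unm_rep K es q0"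
    using snoc by fastforce
  have fin: "finite (events K)" using pre_cmscD(1)[OF K(2)] .
  obtain e0 where e0: "e0 \<notin> events K" using ex_new_if_finite[OF infinite_UNIV_nat fin] by blast
  obtain e1 where e1: "e1 \<notin> insert e0 (events K)"
    using ex_new_if_finite[OF infinite_UNIV_nat] fin by (metis finite_insert)
  obtain e2 where e2: "e2 \<notin> insert e1 (insert e0 (events K))"
    using ex_new_if_finite[OF infinite_UNIV_nat] fin by (metis finite_insert)
  have dis: "distinct [e0, e1, e2]" using e1 e2 by auto
  have fresh: "e0 \<notin> events K" "e1 \<notin> events K" "e2 \<notin> events K" using e0 e1 e2 by auto
  have let_x: "letters x \<subseteq> Ms" using snoc.prems(3) by simp
  let ?M = "add_op x (e0, e1, e2) (first_unm es) K"
  have pre: "pre_cmsc procs Ms ?M"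
    by (rule pre_cmsc_add_op[OF K(2) fresh dis \<open>0 \<in> Ms\<close> let_x K(3)])
      (use q0(2) K(3) in \<open>auto simp: unm_rep_def\<close>)
  have "events ?M \<noteq> {}" by (cases x rule: q_act_option_cases) auto
  then have M: "is_cmsc procs Ms ?M" by (rule is_cmsc_if_pre_cmsc[OF pre])
  have "is_conc procs K (op_cmsc x (e0, e1, e2)) ?M"
    by (rule is_conc_add_op[OF K(2) fresh dis \<open>0 \<in> Ms\<close> K(3) q0(2)])
  then have "?M \<in> conc procs Ms K (std_op x)"
    unfolding conc_def using M fin_prod_is_cmsc[OF K(1)] is_cmsc_op_cmsc[OF \<open>0 \<in> Ms\<close> let_x dis]
      cmsc_iso_refl[of K] cmsc_iso_op_cmsc[OF dis] by blast
  then have "?M \<in> fin_prod procs Ms (map std_op (w @ [x]))"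
    using K(1) snoc.hyps by (auto simp: fin_prod_snoc)
  then show ?case
    using pre unm_rep_add_op[OF K(2) fresh dis \<open>0 \<in> Ms\<close> K(3) q0(2)] by blast
qed

section \<open>Connectedness of products of operations\<close>

lemma connected_cmsc_iso:
  assumes "cmsc_iso M M'" and "connected_cmsc M" and "le M \<subseteq> events M \<times> events M"
  shows "connected_cmsc M'"
proof -
  obtain h where h: "bij_betw h (events M) (events M')"
     "\<And>e f. e\<in>events M \<Longrightarrow> f\<in>events M \<Longrightarrow> (e, f) \<in> le M \<longleftrightarrow> (h e, h f) \<in> le M'"
    using assms(1) unfolding cmsc_iso_def by blast
  have "(h e, h f) \<in> (le M' \<union> (le M')\<inverse>)\<^sup>*" if "(e, f) \<in> (le M \<union> (le M)\<inverse>)\<^sup>*" for e f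
    using that
  proof (induction rule: rtrancl_induct)
    case (step y z)
    then have "(h y, h z) \<in> le M' \<union> (le M')\<inverse>" using h(2) assms(3) by auto
    then show ?case by (rule rtrancl_into_rtrancl[OF step(3)])
  qed simp
  moreover have "events M' = h ` events M" using h(1) by (simp add: bij_betw_def)
  moreover have "(e, f) \<in> (le M \<union> (le M)\<inverse>)\<^sup>*" if "e \<in> events M" "f \<in> events M" for e f
    using that assms(2) unfolding connected_cmsc_def by blast
  ultimately show ?thesis unfolding connected_cmsc_def by auto
qed

text \<open>The message from \<open>e0\<close> to \<open>e1\<close> links the two processes; a third
  event is preceded by \<open>e0\<close> or \<open>e1\<close> on its own process.\<close>

lemma connected_op_cmsc:
  assumes "distinct [e0, e1, e2]"
  shows "connected_cmsc (op_cmsc x (e0, e1, e2))"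
proof -
  let ?R = "le (op_cmsc x (e0, e1, e2)) \<union> (le (op_cmsc x (e0, e1, e2)))\<inverse>"
  let ?M = "op_cmsc x (e0, e1, e2)"
  have new: "(x, x) \<in> le (add_event K x a sender m)"
    "(y, y) \<in> le K \<Longrightarrow> proc (lab K y) = proc a \<or> sender = Some y \<Longrightarrow> (y, x) \<in> le (add_event K x a sender m)"
    for K :: "('a, nat, nat) cmsc" and x y a sender m
    by (auto simp: add_event_def)
  have sync: "(e0, e0) \<in> le (add_sync empty_cmsc e0 e1)" "(e1, e1) \<in> le (add_sync empty_cmsc e0 e1)"
    "(e0, e1) \<in> le (add_sync empty_cmsc e0 e1)"
    unfolding add_sync_def using new subsetD[OF le_add_event] by metis+
  have 1: "(e0, e1) \<in> le ?M"
    using sync(3) by (cases x rule: q_act_option_cases) (simp_all add: subsetD[OF le_add_event])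
  have "e \<in> {e0, e1, e2} \<and> (e = e2 \<longrightarrow> (e0, e2) \<in> le ?M \<or> (e1, e2) \<in> le ?M)" if "e \<in> events ?M" for e
  proof (cases x rule: q_act_option_cases)
    case 1
    then show ?thesis using that assms by auto
  next
    case (2 a)
    have "(e0, e2) \<in> le ?M" unfolding 2 add_op.simps
      by (rule new(2)[OF sync(1)]) (use assms in simp)
    then show ?thesis using that 2 by auto
  next
    case (3 a)
    have "(e1, e2) \<in> le ?M" unfolding 3 add_op.simps
      by (rule new(2)[OF sync(2)]) (use assms in simp)
    then show ?thesis using that 3 by auto
  qed
  then have 2: "e = e0 \<or> (e1, e) \<in> ?R \<and> (e, e1) \<in> ?R \<or> (e0, e) \<in> ?R \<and> (e, e0) \<in> ?R" if "e \<in> events ?M" for e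
    using that 1 by blast
  have "(e, e0) \<in> ?R\<^sup>* \<and> (e0, e) \<in> ?R\<^sup>*" if e: "e \<in> events ?M" for e
  proof -
    have e1: "(e0, e1) \<in> ?R\<^sup>*" "(e1, e0) \<in> ?R\<^sup>*" using 1 by blast+
    consider "e = e0" | "(e1, e) \<in> ?R" "(e, e1) \<in> ?R" | "(e0, e) \<in> ?R" "(e, e0) \<in> ?R"
      using 2[OF e] by blast
    then show ?thesis
    proof cases
      case 2
      then show ?thesis
        by (intro conjI converse_rtrancl_into_rtrancl[OF 2(2) e1(2)] rtrancl_into_rtrancl[OF e1(1) 2(1)])
    qed (simp, blast)
  qed
  then show ?thesis unfolding connected_cmsc_def by (meson rtrancl_trans)
qed

text \<open>One process active in both factors suffices: its events in \<open>M1\<close> precede its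
  events in \<open>M2\<close>.\<close>

lemma connected_conc:
  assumes M: "is_cmsc P Ms M" "is_cmsc P Ms M1" "is_cmsc P Ms M2" and conc: "is_conc P M1 M2 M"
    and con: "connected_cmsc M1" "connected_cmsc M2"
    and p: "p \<in> P" "events_at P M1 p \<noteq> {}" "events_at P M2 p \<noteq> {}"
  shows "connected_cmsc M"
proof -
  let ?R = "(le M \<union> (le M)\<inverse>)\<^sup>*"
  have sub: "(le M1 \<union> (le M1)\<inverse>)\<^sup>* \<subseteq> ?R" "(le M2 \<union> (le M2)\<inverse>)\<^sup>* \<subseteq> ?R"
    using is_conc_le[OF M conc] by (auto intro!: rtrancl_mono)
  obtain u v where uv: "u \<in> events_at P M1 p" "v \<in> events_at P M2 p" using p by blast
  then have "(u, v) \<in> le_at P M p" using conc p(1) unfolding is_conc_def by blast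
  then have "(u, v) \<in> ?R" "(v, u) \<in> ?R" by (auto simp: le_at_def)
  moreover have "u \<in> events M1" "v \<in> events M2" using uv by (auto simp: events_at_def)
  ultimately have "(e, u) \<in> ?R \<and> (u, e) \<in> ?R" if "e \<in> events M" for e
  proof -
    have "e \<in> events M1 \<or> e \<in> events M2" using that conc by (auto simp: is_conc_def)
    then show ?thesis
    proof
      assume "e \<in> events M1"
      then show ?thesis using con(1) sub(1) \<open>u \<in> events M1\<close> unfolding connected_cmsc_def by blast
    next
      assume "e \<in> events M2"
      then have "(e, v) \<in> ?R" "(v, e) \<in> ?R"
        using con(2) sub(2) \<open>v \<in> events M2\<close> unfolding connected_cmsc_def by blast+
      then show ?thesis using \<open>(u, v) \<in> ?R\<close> \<open>(v, u) \<in> ?R\<close> by (meson rtrancl_trans)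
    qed
  qed
  then show ?thesis unfolding connected_cmsc_def by (meson rtrancl_trans)
qed

lemma events_at_iso:
  assumes "cmsc_iso M M'" "events_at P M p \<noteq> {}"
  shows "events_at P M' p \<noteq> {}"
  using assms unfolding cmsc_iso_def events_at_def bij_betw_def by fastforce

lemma events_at_op_cmsc:
  assumes "distinct [e0, e1, e2]"
  shows "events_at procs (op_cmsc x (e0, e1, e2)) 1 \<noteq> {}"
proof -
  have "e0 \<in> events_at procs (op_cmsc x (e0, e1, e2)) 1"
    using assms by (cases x rule: q_act_option_cases) (auto simp: events_at_def Act_at_def)
  then show ?thesis by blast
qed

text \<open>Process 1 is active in every operation through the send \<open>e0\<close>. Activity
  there is the part of the invariant that links consecutive factors.\<close>

lemma connected_fin_prod_ops:
  assumes "w \<noteq> []" and "M \<in> fin_prod procs Ms (map std_op w)" and "0 \<in> Ms"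
    and "\<And>x. x \<in> set w \<Longrightarrow> letters x \<subseteq> Ms"
  shows "connected_cmsc M \<and> events_at procs M 1 \<noteq> {}"
  using assms
proof (induction w arbitrary: M rule: rev_nonempty_induct)
  case (single x)
  then have iso: "cmsc_iso (std_op x) M" by auto
  have N: "is_cmsc procs Ms (std_op x)" by (rule is_cmsc_op_cmsc) (use single in auto)
  show ?case
    using connected_cmsc_iso[OF iso connected_op_cmsc is_cmsc_le(1)[OF N]] events_at_iso[OF iso events_at_op_cmsc]
    by simp
next
  case (snoc x w)
  then obtain K M1 M2 where K: "K \<in> fin_prod procs Ms (map std_op w)"
    and M: "is_cmsc procs Ms M" "is_cmsc procs Ms M1" "is_cmsc procs Ms M2"
    and iso: "cmsc_iso K M1" "cmsc_iso (std_op x) M2" and conc: "is_conc procs M1 M2 M"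
    by (auto simp: fin_prod_snoc conc_def)
  have N: "is_cmsc procs Ms (std_op x)" by (rule is_cmsc_op_cmsc) (use snoc in auto)
  have "connected_cmsc K \<and> events_at procs K 1 \<noteq> {}"
    using snoc.IH[OF K] snoc.prems by simp
  then have 1: "connected_cmsc M1" "events_at procs M1 1 \<noteq> {}"
    using connected_cmsc_iso[OF iso(1)] is_cmsc_le(1)[OF fin_prod_is_cmsc[OF K]] events_at_iso[OF iso(1)]
    by blast+
  have 2: "connected_cmsc M2" "events_at procs M2 1 \<noteq> {}"
    using connected_cmsc_iso[OF iso(2) connected_op_cmsc is_cmsc_le(1)[OF N]] events_at_iso[OF iso(2) events_at_op_cmsc]
    by simp_all
  have "connected_cmsc M" by (rule connected_conc[OF M conc 1(1) 2(1) _ 1(2) 2(2)]) simp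
  moreover have "events_at procs M1 1 \<subseteq> events_at procs M 1"
    using conc by (auto simp: is_conc_def events_at_def)
  ultimately show ?case using 1(2) by blast
qed

section \<open>Queue automata as HMSCs\<close>

text \<open>With \<open>fin_omega\<close> empty no infinite path is accepting, so infinite products
  never enter the language.\<close>

definition op_hmsc ::
  "('s \<times> q_act option \<times> 's) set \<Rightarrow> 's set \<Rightarrow> 's \<Rightarrow> nat set \<Rightarrow> 's set \<Rightarrow> ('s, nat, nat, nat) hmsc" where
  "op_hmsc A S i Ms F = \<lparr>states = S, init = i, msgs = Ms,
     trans_rel = (\<lambda>(s, x, t). (s, std_op x, t)) ` A, fin = F, fin_omega = {}\<rparr>"

lemma op_hmsc_simps [simp]:
  "states (op_hmsc A S i Ms F) = S" "init (op_hmsc A S i Ms F) = i" "msgs (op_hmsc A S i Ms F) = Ms"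
  "trans_rel (op_hmsc A S i Ms F) = (\<lambda>(s, x, t). (s, std_op x, t)) ` A" "fin (op_hmsc A S i Ms F) = F"
  "fin_omega (op_hmsc A S i Ms F) = {}"
  by (simp_all add: op_hmsc_def)

lemma is_hmsc_op_hmsc:
  assumes "finite A" "finite S" "i \<in> S" "finite Ms" "F \<subseteq> S" "0 \<in> Ms"
    and "\<And>s x t. (s, x, t) \<in> A \<Longrightarrow> s \<in> S \<and> t \<in> S \<and> letters x \<subseteq> Ms"
  shows "is_hmsc procs (op_hmsc A S i Ms F)"
proof -
  have "std_op x \<in> fcMSC procs Ms" if "letters x \<subseteq> Ms" for x
    using is_cmsc_op_cmsc[OF \<open>0 \<in> Ms\<close> that, of "0 :: nat" 1 2] pre_cmscD(1)[OF pre_cmsc_op_cmsc[OF \<open>0 \<in> Ms\<close> that, of "0 :: nat" 1 2]]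
    by (simp add: fcMSC_def)
  then show ?thesis using assms by (fastforce simp: is_hmsc_def)
qed

lemma op_hmsc_path:
  assumes "fin_path (op_hmsc A S i Ms F) r"
  obtains w where "w \<noteq> []" "set w \<subseteq> A" "r = map (\<lambda>(s, x, t). (s, std_op x, t)) w"
    "successively (\<lambda>t t'. tgt t = src t') w" "map msc_of r = map std_op (map msc_of w)"
    "src (hd r) = src (hd w)" "tgt (last r) = tgt (last w)"
proof -
  let ?f = "\<lambda>(s, x, t). (s, std_op x, t) :: _ \<times> (nat, nat, nat) cmsc \<times> _"
  have r: "r \<noteq> []" "set r \<subseteq> ?f ` A" "successively (\<lambda>t t'. tgt t = src t') r"
    using assms by (auto simp: fin_path_def)
  have f: "src (?f u) = src u" "tgt (?f u) = tgt u" "msc_of (?f u) = std_op (msc_of u)" for u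
    by (cases u; simp add: src_def tgt_def msc_of_def)+
  obtain w where w: "set w \<subseteq> A" "r = map ?f w"
  proof -
    have "r \<in> lists (?f ` A)" using r(2) by (simp add: lists_eq_set)
    then have "r \<in> map ?f ` lists A" by (simp only: lists_image)
    then show thesis using that by (auto simp: lists_eq_set)
  qed
  have ne: "w \<noteq> []" using r(1) w(2) by simp
  moreover have "successively (\<lambda>t t'. tgt t = src t') w"
    using r(3) unfolding w(2) successively_map f .
  moreover have "map msc_of r = map std_op (map msc_of w)"
    unfolding w(2) map_map comp_def f ..
  moreover have "src (hd r) = src (hd w)" "tgt (last r) = tgt (last w)"
    unfolding w(2) hd_map[OF ne] last_map[OF ne] f by simp_all
  ultimately show ?thesis using that[of w] w ne by blast
qed

lemma loop_connected_op_hmsc: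
  assumes "0 \<in> Ms" and "\<And>s x t. (s, x, t) \<in> A \<Longrightarrow> letters x \<subseteq> Ms"
  shows "loop_connected procs (op_hmsc A S i Ms F)"
  unfolding loop_connected_def
proof (intro ballI allI impI)
  fix r M
  assume path: "fin_path (op_hmsc A S i Ms F) r" and M: "M \<in> cmscs_fin procs (op_hmsc A S i Ms F) r"
  obtain w where w: "w \<noteq> []" "set w \<subseteq> A" "map msc_of r = map std_op (map msc_of w)"
  proof -
    from path show thesis by (rule op_hmsc_path) (rule that)
  qed
  have "M \<in> fin_prod procs Ms (map std_op (map msc_of w))"
    using M unfolding cmscs_fin_def w(3) by simp
  moreover have "letters x \<subseteq> Ms" if "x \<in> set (map msc_of w)" for x
    using that w(2) assms(2) by (fastforce simp: msc_of_def)
  ultimately show "connected_cmsc M"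
    using connected_fin_prod_ops[of "map msc_of w" M Ms] w(1) assms(1) by simp
qed

section \<open>Accepting paths and runs of the queue automaton\<close>

lemma q_run_conf_step:
  assumes "w \<noteq> []" "set w \<subseteq> A" "successively (\<lambda>t t'. tgt t = src t') w" "q_run (map msc_of w) q q'"
  shows "(conf_step q_step A)\<^sup>*\<^sup>* (src (hd w), q) (tgt (last w), q')"
  using assms
proof (induction w arbitrary: q)
  case (Cons u w)
  obtain s x t where u: "u = (s, x, t)" by (cases u)
  obtain q1 where q1: "opt_step q_step x q q1" "q_run (map msc_of w) q1 q'"
  proof -
    have "msc_of u = x" by (simp add: u msc_of_def)
    then show thesis using Cons.prems(4) that by auto
  qed
  have step: "conf_step q_step A (s, q) (t, q1)" using q1(1) Cons.prems(2) u by auto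
  show ?case
  proof (cases "w = []")
    case True
    then show ?thesis using r_into_rtranclp[of "conf_step q_step A", OF step] q1(2) u
      by (simp add: src_def tgt_def del: conf_step_iff)
  next
    case False
    then have "src (hd w) = t" "successively (\<lambda>t t'. tgt t = src t') w"
      using Cons.prems(3) u by (auto simp: successively_Cons tgt_def)
    then have "(conf_step q_step A)\<^sup>*\<^sup>* (t, q1) (tgt (last w), q')"
      using Cons.IH[OF False _ _ q1(2)] Cons.prems(2) by simp
    with step have "(conf_step q_step A)\<^sup>*\<^sup>* (s, q) (tgt (last w), q')"
      by (rule converse_rtranclp_into_rtranclp)
    then show ?thesis using False u by (simp add: src_def)
  qed
qed simp

lemma conf_step_q_run:
  assumes "(conf_step q_step A)\<^sup>*\<^sup>* (s, q) (t, q')"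
  shows "(s, q) = (t, q') \<or> (\<exists>w. w \<noteq> [] \<and> set w \<subseteq> A \<and> successively (\<lambda>t t'. tgt t = src t') w \<and>
     q_run (map msc_of w) q q' \<and> src (hd w) = s \<and> tgt (last w) = t)"
  using assms
proof (induction "(s, q)" arbitrary: s q rule: converse_rtranclp_induct)
  case (step c)
  obtain s1 q1 where c: "c = (s1, q1)" by force
  obtain x where x: "(s, x, s1) \<in> A" "opt_step q_step x q q1" using step(1) c by auto
  from step(3)[OF c] show ?case
  proof
    assume "(s1, q1) = (t, q')"
    then show ?thesis using x
      by (intro disjI2 exI[of _ "[(s, x, s1)]"]) (auto simp: msc_of_def src_def tgt_def)
  next
    assume "\<exists>w. w \<noteq> [] \<and> set w \<subseteq> A \<and> successively (\<lambda>t t'. tgt t = src t') w \<and>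
     q_run (map msc_of w) q1 q' \<and> src (hd w) = s1 \<and> tgt (last w) = t"
    then obtain w where w: "w \<noteq> []" "set w \<subseteq> A" "successively (\<lambda>t t'. tgt t = src t') w"
     "q_run (map msc_of w) q1 q'" "src (hd w) = s1" "tgt (last w) = t" by blast
    then show ?thesis using x
      by (intro disjI2 exI[of _ "(s, x, s1) # w"])
        (auto simp: msc_of_def src_def tgt_def successively_Cons)
  qed
qed simp

text \<open>Paths have at least one transition, while runs may be empty; \<open>i \<notin> F\<close>
  removes the difference. The final queue is empty because a member of \<open>MSC\<close> has no
  unmatched event.\<close>

lemma lang_op_hmsc_nonempty:
  assumes "0 \<in> Ms" and lets: "\<And>s x t. (s, x, t) \<in> A \<Longrightarrow> letters x \<subseteq> Ms" and "i \<notin> F"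
  shows "lang procs (op_hmsc A S i Ms F) \<noteq> {} \<longleftrightarrow>
    (\<exists>t\<in>F. (conf_step q_step A)\<^sup>*\<^sup>* (i, []) (t, []))"
proof
  let ?H = "op_hmsc A S i Ms F"
  assume "lang procs ?H \<noteq> {}"
  moreover have "\<not> accepting_inf ?H r" for r by (auto simp: accepting_inf_def)
  ultimately obtain r M where r: "accepting_fin ?H r" "M \<in> cmscs_fin procs ?H r" "M \<in> MSC procs Ms"
    by (auto simp: lang_def)
  obtain w where w: "w \<noteq> []" "set w \<subseteq> A" "successively (\<lambda>t t'. tgt t = src t') w"
    "map msc_of r = map std_op (map msc_of w)" "src (hd r) = src (hd w)" "tgt (last r) = tgt (last w)"
  proof -
    have "fin_path ?H r" using r(1) by (simp add: accepting_fin_def)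
    then show thesis by (rule op_hmsc_path) (rule that)
  qed
  have M: "M \<in> fin_prod procs Ms (map std_op (map msc_of w))" "unm M = {}"
    using r(2,3) unfolding cmscs_fin_def w(4) by (simp_all add: MSC_def)
  have l: "letters x \<subseteq> Ms" if "x \<in> set (map msc_of w)" for x
    using that w(2) lets by (fastforce simp: msc_of_def)
  obtain q es where q: "q_run (map msc_of w) [] q" "unm_rep M es q"
    using fin_prod_ops_sound[OF _ M(1) \<open>0 \<in> Ms\<close> l] w(1) M(2) by auto
  have "q = []" using q(2) M(2) by (auto simp: unm_rep_def)
  then have "(conf_step q_step A)\<^sup>*\<^sup>* (src (hd w), []) (tgt (last w), [])"
    using q_run_conf_step[OF w(1-3)] q(1) by simp
  then show "\<exists>t\<in>F. (conf_step q_step A)\<^sup>*\<^sup>* (i, []) (t, [])"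
    using r(1) w(5,6) by (auto simp: accepting_fin_def)
next
  let ?H = "op_hmsc A S i Ms F"
  let ?f = "\<lambda>(s, x, t). (s, std_op x, t) :: _ \<times> (nat, nat, nat) cmsc \<times> _"
  assume "\<exists>t\<in>F. (conf_step q_step A)\<^sup>*\<^sup>* (i, []) (t, [])"
  then obtain t w where t: "t \<in> F" and w: "w \<noteq> []" "set w \<subseteq> A" "successively (\<lambda>t t'. tgt t = src t') w"
     "q_run (map msc_of w) [] []" "src (hd w) = i" "tgt (last w) = t"
    using conf_step_q_run \<open>i \<notin> F\<close> by (metis prod.inject)
  have l: "letters x \<subseteq> Ms" if "x \<in> set (map msc_of w)" for x
    using that w(2) lets by (fastforce simp: msc_of_def)
  obtain M es where M: "M \<in> fin_prod procs Ms (map std_op (map msc_of w))" "unm_rep M es []"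
    using fin_prod_ops_complete[OF _ w(4) \<open>0 \<in> Ms\<close> l] w(1) by auto
  have f: "src (?f u) = src u" "tgt (?f u) = tgt u" "msc_of (?f u) = std_op (msc_of u)" for u
    by (cases u; simp add: src_def tgt_def msc_of_def)+
  have "set (map ?f w) \<subseteq> ?f ` A" using w(2) by (simp only: set_map image_mono)
  then have "fin_path ?H (map ?f w)"
    using w(1,3) unfolding fin_path_def successively_map f by simp
  moreover have "src (hd (map ?f w)) = i" "tgt (last (map ?f w)) = t"
    unfolding hd_map[OF w(1)] last_map[OF w(1)] f using w(5,6) by simp_all
  ultimately have "accepting_fin ?H (map ?f w)" using t by (simp add: accepting_fin_def)
  moreover have "M \<in> cmscs_fin procs ?H (map ?f w)"
    using M(1) unfolding cmscs_fin_def map_map comp_def f by simp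
  moreover have "M \<in> MSC procs Ms"
    using fin_prod_is_cmsc[OF M(1)] M(2) by (auto simp: MSC_def unm_rep_def)
  ultimately show "lang procs ?H \<noteq> {}" unfolding lang_def by auto
qed

section \<open>Computable functions\<close>

text \<open>Total functions on argument lists of fixed length. Only the existence of a term for
  \<open>diag_code\<close> matters, so closure properties replace explicit terms of type
  \<open>recf\<close>.\<close>

definition computable :: "nat \<Rightarrow> (nat list \<Rightarrow> nat) \<Rightarrow> bool" where
  "computable k F \<longleftrightarrow> (\<exists>f. \<forall>xs. length xs = k \<longrightarrow> rec_eval f xs (F xs))"

lemma computable_cong:
  assumes "computable k F" "\<And>xs. length xs = k \<Longrightarrow> F xs = G xs"
  shows "computable k G"
  using assms unfolding computable_def by metis

lemma computable_nth: "i < k \<Longrightarrow> computable k (\<lambda>xs. xs ! i)"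
  unfolding computable_def by (intro exI[of _ "Proj i"]) simp

lemma computable_comp:
  assumes F: "computable (length Gs) F" and Gs: "\<And>G. G \<in> set Gs \<Longrightarrow> computable k G"
  shows "computable k (\<lambda>xs. F (map (\<lambda>G. G xs) Gs))"
proof -
  obtain f where f: "\<And>ys. length ys = length Gs \<Longrightarrow> rec_eval f ys (F ys)"
    using F by (auto simp: computable_def)
  have "\<exists>gs. list_all2 (\<lambda>g G. \<forall>xs. length xs = k \<longrightarrow> rec_eval g xs (G xs)) gs Gs"
    using Gs
  proof (induction Gs)
    case (Cons G Gs)
    then obtain gs where "list_all2 (\<lambda>g G. \<forall>xs. length xs = k \<longrightarrow> rec_eval g xs (G xs)) gs Gs" by auto
    moreover obtain g where "\<forall>xs. length xs = k \<longrightarrow> rec_eval g xs (G xs)"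
      using Cons.prems[of G] by (auto simp: computable_def)
    ultimately show ?case by (intro exI[of _ "g # gs"]) simp
  qed simp
  then obtain gs where gs: "list_all2 (\<lambda>g G. \<forall>xs. length xs = k \<longrightarrow> rec_eval g xs (G xs)) gs Gs" ..
  have "rec_eval (Comp f gs) xs (F (map (\<lambda>G. G xs) Gs))" if "length xs = k" for xs
  proof (rule rec_eval.comp)
    show "list_all2 (\<lambda>g y. rec_eval g xs y) gs (map (\<lambda>G. G xs) Gs)"
      using gs that by (simp add: list_all2_conv_all_nth)
    show "rec_eval f (map (\<lambda>G. G xs) Gs) (F (map (\<lambda>G. G xs) Gs))" by (rule f) simp
  qed
  then show ?thesis unfolding computable_def by blast
qed

lemma computable_Suc: "computable k G \<Longrightarrow> computable k (\<lambda>xs. Suc (G xs))"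
proof -
  have "computable (length [G]) (\<lambda>ys. Suc (hd ys))"
    unfolding computable_def
    by (intro exI[of _ Succ]) (auto simp: length_Suc_conv rec_eval_Succ)
  then show "computable k G \<Longrightarrow> computable k (\<lambda>xs. Suc (G xs))"
    by (drule_tac computable_comp[where k = k]) auto
qed

lemma computable_const: "computable k (\<lambda>_. c)"
proof (induction c)
  case 0
  then show ?case unfolding computable_def by (intro exI[of _ Zero]) simp
qed (rule computable_Suc)

lemma computable_args:
  assumes F: "computable (length js) F" and "set js \<subseteq> {..<k}"
  shows "computable k (\<lambda>xs. F (map ((!) xs) js))"
proof -
  have "computable k (\<lambda>xs. F (map (\<lambda>G. G xs) (map (\<lambda>i xs. xs ! i) js)))"
    by (rule computable_comp) (use assms in \<open>auto intro: computable_nth\<close>)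
  then show ?thesis by (simp add: comp_def)
qed

text \<open>\<open>PrimRec\<close> recurses on its first argument; composition with \<open>N\<close>
  and the projections admits any computable recursion bound.\<close>

lemma computable_rec:
  assumes N: "computable k N" and A: "computable k A" and B: "computable (Suc (Suc k)) B"
  shows "computable k (\<lambda>xs. rec_nat (A xs) (\<lambda>n y. B (n # y # xs)) (N xs))"
proof -
  obtain a where a: "\<And>xs. length xs = k \<Longrightarrow> rec_eval a xs (A xs)"
    using A by (auto simp: computable_def)
  obtain b where b: "\<And>xs. length xs = Suc (Suc k) \<Longrightarrow> rec_eval b xs (B xs)"
    using B by (auto simp: computable_def)
  have *: "rec_eval (PrimRec a b) (n # xs) (rec_nat (A xs) (\<lambda>n y. B (n # y # xs)) n)"
    if "length xs = k" for n xs
    by (induction n) (use a b that in auto)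
  have "computable (Suc k) (\<lambda>zs. rec_nat (A (tl zs)) (\<lambda>n y. B (n # y # tl zs)) (hd zs))"
    unfolding computable_def using * by (intro exI[of _ "PrimRec a b"]) (auto simp: length_Suc_conv)
  then have "computable k (\<lambda>xs. rec_nat (A (tl (map (\<lambda>G. G xs) (N # map (\<lambda>i xs. xs ! i) [0..<k]))))
      (\<lambda>n y. B (n # y # tl (map (\<lambda>G. G xs) (N # map (\<lambda>i xs. xs ! i) [0..<k]))))
      (hd (map (\<lambda>G. G xs) (N # map (\<lambda>i xs. xs ! i) [0..<k]))))"
    by (intro computable_comp[where Gs = "N # map (\<lambda>i xs. xs ! i) [0..<k]"])
      (use N in \<open>auto intro: computable_nth\<close>)
  then show ?thesis
    by (rule computable_cong) (auto simp: comp_def map_nth)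
qed

lemma map_nth_drop2:
  assumes "length xs = Suc (Suc k)"
  shows "map ((!) xs) [2..<Suc (Suc k)] = tl (tl xs)"
proof -
  obtain a b ys where "xs = a # b # ys" "length ys = k"
    using assms by (auto simp: length_Suc_conv)
  then show ?thesis
    by (intro nth_equalityI) (simp_all del: upt_Suc)
qed

lemma computable_add:
  assumes "computable k F" "computable k G"
  shows "computable k (\<lambda>xs. F xs + G xs)"
proof -
  have "computable k (\<lambda>xs. rec_nat (G xs) (\<lambda>n y. Suc ((n # y # xs) ! 1)) (F xs))"
    by (rule computable_rec[OF assms computable_Suc[OF computable_nth]]) simp
  moreover have "rec_nat b (\<lambda>n. Suc) a = a + b" for a b by (induction a) auto
  ultimately show ?thesis by simp
qed

lemma computable_sum:
  assumes N: "computable k N" and F: "computable (Suc k) F"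
  shows "computable k (\<lambda>xs. \<Sum>i<N xs. F (i # xs))"
proof -
  \<comment> \<open>The recursion step receives the index, the partial sum and the parameters; the
    partial sum has to be hidden from \<open>F\<close>.\<close>
  have F': "computable (Suc (Suc k)) (\<lambda>zs. F (zs ! 0 # tl (tl zs)))"
    by (rule computable_cong[OF computable_args[where js = "0 # [2..<Suc (Suc k)]"]])
      (use F in \<open>auto simp: map_nth_drop2 simp del: upt_Suc\<close>)
  have "computable k (\<lambda>xs. rec_nat 0 (\<lambda>n y. (n # y # xs) ! 1 + F ((n # y # xs) ! 0 # tl (tl (n # y # xs)))) (N xs))"
    by (rule computable_rec[OF N computable_const computable_add[OF computable_nth F']]) simp
  moreover have "rec_nat 0 (\<lambda>n y. y + f n) a = (\<Sum>i<a. f i)" for a and f :: "nat \<Rightarrow> nat"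
    by (induction a) auto
  ultimately show ?thesis by simp
qed

lemma computable_pow2:
  assumes "computable k N"
  shows "computable k (\<lambda>xs. 2 ^ N xs)"
proof -
  have "computable k (\<lambda>xs. rec_nat 1 (\<lambda>n y. (n # y # xs) ! 1 + (n # y # xs) ! 1) (N xs))"
    by (rule computable_rec[OF assms computable_const computable_add[OF computable_nth computable_nth]]) auto
  moreover have "rec_nat 1 (\<lambda>n y. y + y) a = (2::nat) ^ a" for a
    by (induction a) auto
  ultimately show ?thesis by simp
qed

lemma computable_prod_encode:
  assumes F: "computable k F" and G: "computable k G"
  shows "computable k (\<lambda>xs. prod_encode (F xs, G xs))"
proof -
  have tri: "triangle a = (\<Sum>i<a. Suc i)" for a by (induction a) auto
  have "computable k (\<lambda>xs. \<Sum>i<F xs + G xs. Suc ((i # xs) ! 0))"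
    by (rule computable_sum[OF computable_add[OF F G] computable_Suc[OF computable_nth]]) simp
  then have "computable k (\<lambda>xs. (\<Sum>i<F xs + G xs. Suc ((i # xs) ! 0)) + F xs)"
    by (rule computable_add) (rule F)
  then show ?thesis by (simp add: prod_encode_def tri)
qed

lemma computable_list_encode_Cons:
  assumes "computable k F" "computable k (\<lambda>xs. list_encode (Fs xs))"
  shows "computable k (\<lambda>xs. list_encode (F xs # Fs xs))"
  using computable_Suc[OF computable_prod_encode[OF assms]] by simp

section \<open>A queue automaton that halts where a given recursive function is defined\<close>

instance q_act :: countable by countable_datatype
instance rex :: (countable) countable by countable_datatype

lemma conf_step_image:
  assumes "inj f"
  shows "(conf_step st ((\<lambda>(k, a, k'). (f k, a, f k')) ` T))\<^sup>*\<^sup>* (f k, x) (f k', x') \<longleftrightarrow> (conf_step st T)\<^sup>*\<^sup>* (k, x) (k', x')"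
proof
  let ?T = "(\<lambda>(k, a, k'). (f k, a, f k')) ` T"
  have "\<exists>k'. u = f k' \<and> (conf_step st T)\<^sup>*\<^sup>* (k, x) (k', x')" if "(conf_step st ?T)\<^sup>*\<^sup>* (f k, x) (u, x')" for u x'
    using that
  proof (induction "(u, x')" arbitrary: u x' rule: rtranclp_induct)
    case (step c)
    obtain v y where c: "c = (v, y)" by force
    then obtain k1 where k1: "v = f k1" "(conf_step st T)\<^sup>*\<^sup>* (k, x) (k1, y)" using step(3) by blast
    obtain a k2 where "(k1, a, k2) \<in> T" "u = f k2" "opt_step st a y x'"
      using step(2) assms unfolding c k1(1) by (auto dest: injD)
    then have "conf_step st T (k1, y) (k2, x')" by auto
    with k1(2) have "(conf_step st T)\<^sup>*\<^sup>* (k, x) (k2, x')" by (rule rtranclp.rtrancl_into_rtrancl)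
    with \<open>u = f k2\<close> show ?case by blast
  qed auto
  then show "(conf_step st ?T)\<^sup>*\<^sup>* (f k, x) (f k', x') \<Longrightarrow> (conf_step st T)\<^sup>*\<^sup>* (k, x) (k', x')"
    using assms by (blast dest: injD)
next
  let ?T = "(\<lambda>(k, a, k'). (f k, a, f k')) ` T"
  assume "(conf_step st T)\<^sup>*\<^sup>* (k, x) (k', x')"
  then show "(conf_step st ?T)\<^sup>*\<^sup>* (f k, x) (f k', x')"
  proof (induction "(k', x')" arbitrary: k' x' rule: rtranclp_induct)
    case (step c)
    obtain v y where c: "c = (v, y)" by force
    have "(conf_step st ?T)\<^sup>*\<^sup>* (f k, x) (f v, y)" using step(3) c by blast
    moreover have "conf_step st ?T (f v, y) (f k', x')"
      using step(2) unfolding c by (force simp: image_iff)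
    ultimately show ?case by (rule rtranclp.rtrancl_into_rtrancl)
  qed simp
qed

lemma count_list_replicate: "count_list (replicate n a) b = (if a = b then n else 0)"
  by (induction n) auto

text \<open>The initial queue is \<open>n\<close> in unary, as units of register 0, followed by the
  marker. Odd control states leave the even ones to the transitions that write this input.\<close>

lemma ex_queue_automaton:
  "\<exists>A :: (nat \<times> q_act option \<times> nat) set. finite A \<and> (\<forall>s x t. (s, x, t) \<in> A \<longrightarrow> odd s \<and> odd t) \<and>
    (\<forall>n. (conf_step q_step A)\<^sup>*\<^sup>* (1, replicate n 1 @ [0]) (3, []) \<longleftrightarrow> (\<exists>y. rec_eval g [n] y))"
proof -
  let ?c = "compile g [0] 1 2"
  have "finite (rex_atoms r)" for r :: "ctr_act rex" by (induction r) auto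
  then have "finite (insert 0 (ctr_reg ` rex_atoms ?c))" by simp
  \<comment> \<open>The queue has finitely many letters, so \<open>B\<close> has to exceed the input
    register and all registers that the compiled program touches.\<close>
  then obtain B where B: "\<forall>x\<in>insert 0 (ctr_reg ` rex_atoms ?c). x < B"
    using finite_nat_set_iff_bounded by blast
  let ?p = "Seq (bind_rex (queue_impl B) ?c) (drain B)"
  \<comment> \<open>Lists of programs are countable, which numbers the control states: the initial
    list becomes 1, the final one 3, all others odd numbers from 5 on.\<close>
  define f where "f k = (if k = [?p] then 1 else if k = [] then 3 else 2 * to_nat k + 5)" for k :: "q_act rex list"
  have "inj f" by (rule injI) (auto simp: f_def split: if_splits)
  define A where "A = (\<lambda>(k, a, k'). (f k, a, f k')) ` rex_trans ?p []"
  show ?thesis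
  proof (intro exI[of _ A] conjI allI impI)
    show "finite A" by (simp add: A_def)
    show "odd s" "odd t" if "(s, x, t) \<in> A" for s x t
      using that by (auto simp: A_def f_def split: if_splits)
    show "(conf_step q_step A)\<^sup>*\<^sup>* (1, replicate n 1 @ [0]) (3, []) \<longleftrightarrow> (\<exists>y. rec_eval g [n] y)" for n
    proof -
      let ?q = "replicate n 1 @ [0 :: nat]" and ?s = "(\<lambda>_. 0)(0 := n) :: nat \<Rightarrow> nat"
      have f: "f [?p] = 1" "f [] = 3" by (auto simp: f_def)
      have "0 < B" using B by simp
      then have rep: "queue_rep B ?q ?s"
        by (auto simp: queue_rep_def count_list_replicate split: if_splits)
      have "(conf_step q_step A)\<^sup>*\<^sup>* (1, ?q) (3, []) \<longleftrightarrow> (conf_step q_step (rex_trans ?p []))\<^sup>*\<^sup>* ([?p], ?q) ([], [])"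
        using conf_step_image[OF \<open>inj f\<close>, of q_step "rex_trans ?p []" "[?p]" ?q "[]" "[]"]
        unfolding A_def f .
      also have "\<dots> \<longleftrightarrow> qexec ?p ?q []"
        using conf_step_rex_sound[of q_step ?p "[]" "[?p]" ?q "[]"] conf_step_rex_complete[of q_step ?p ?q "[]" "[]"]
        by auto
      also have "\<dots> \<longleftrightarrow> (\<exists>s'. cexec ?c ?s s')"
      proof
        assume "qexec ?p ?q []"
        then obtain q1 where "qexec (bind_rex (queue_impl B) ?c) ?q q1" by auto
        then show "\<exists>s'. cexec ?c ?s s'"
          using exec_bind_rex_sound[of ?c "queue_rep B" q_step "queue_impl B" ctr_step, OF _ rep]
            queue_impl_sound B by blast
      next
        assume "\<exists>s'. cexec ?c ?s s'"
        then obtain s' where "cexec ?c ?s s'" ..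
        then obtain q1 where q1: "qexec (bind_rex (queue_impl B) ?c) ?q q1" "queue_rep B q1 s'"
          using exec_bind_rex_complete[of ?c "queue_rep B" ctr_step q_step "queue_impl B", OF _ rep]
            queue_impl_complete B by blast
        then have "qexec (drain B) q1 []" by (intro qexec_drain) (simp add: queue_rep_def)
        then show "qexec ?p ?q []" using q1(1) by auto
      qed
      also have "\<dots> \<longleftrightarrow> (\<exists>y. rec_eval g [n] y)"
        by (subst cexec_compile) auto
      finally show ?thesis .
    qed
  qed
qed

section \<open>The diagonal argument\<close>

text \<open>In state \<open>2 * i\<close> exactly \<open>i\<close> ones have been written; the
  marker is written on entering state 1, the initial state of the automaton that follows.\<close>

definition init_trans :: "nat \<Rightarrow> (nat \<times> q_act option \<times> nat) set" where
  "init_trans n = insert (2 * n, Some (Write 0), 1) ((\<lambda>i. (2 * i, Some (Write 1), 2 * i + 2)) ` {..<n})"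

lemma finite_init_trans [simp]: "finite (init_trans n)"
  by (simp add: init_trans_def)

text \<open>No transition of \<open>A\<close> leaves an even state and none of
  \<open>init_trans n\<close> leaves an odd one, so a run that reaches 3 has written exactly the
  input before entering \<open>A\<close> at 1.\<close>

lemma init_trans_run:
  assumes A: "\<And>s x t. (s, x, t) \<in> A \<Longrightarrow> odd s \<and> odd t"
  shows "(conf_step q_step (A \<union> init_trans n))\<^sup>*\<^sup>* (0, []) (3, []) \<longleftrightarrow>
    (conf_step q_step A)\<^sup>*\<^sup>* (1, replicate n 1 @ [0]) (3, [])"
proof
  let ?R = "conf_step q_step (A \<union> init_trans n)" and ?q = "replicate n 1 @ [0 :: nat]"
  have "(\<exists>i. s = 2 * i \<and> q = replicate i 1) \<or> odd s \<and> (conf_step q_step A)\<^sup>*\<^sup>* (1, ?q) (s, q)"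
    if "?R\<^sup>*\<^sup>* (0, []) (s, q)" for s q
    using that
  proof (induction "(s, q)" arbitrary: s q rule: rtranclp_induct)
    case (step c)
    obtain s1 q1 where c: "c = (s1, q1)" by force
    obtain x where x: "(s1, x, s) \<in> A \<union> init_trans n" "opt_step q_step x q1 q"
      using step(2) unfolding c by auto
    from step(3)[OF c] show ?case
    proof (elim disjE exE conjE)
      fix i assume i: "s1 = 2 * i" "q1 = replicate i 1"
      then have "(s1, x, s) \<in> init_trans n" using x(1) A by fastforce
      then consider "i = n" "x = Some (Write 0)" "s = 1" | "x = Some (Write 1)" "s = 2 * Suc i"
        unfolding init_trans_def i by auto
      then show ?thesis
      proof cases
        case 1
        then show ?thesis using x(2) i by simp
      next
        case 2
        then show ?thesis using x(2) i by (intro disjI1 exI[of _ "Suc i"]) (simp add: replicate_append_same)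
      qed
    next
      assume s1: "odd s1" "(conf_step q_step A)\<^sup>*\<^sup>* (1, ?q) (s1, q1)"
      then have "(s1, x, s) \<in> A" using x(1) by (auto simp: init_trans_def)
      moreover from this have "conf_step q_step A (s1, q1) (s, q)" using x(2) by auto
      ultimately show ?thesis using s1(2) A by (meson rtranclp.rtrancl_into_rtrancl)
    qed
  qed auto
  then show "?R\<^sup>*\<^sup>* (0, []) (3, []) \<Longrightarrow> (conf_step q_step A)\<^sup>*\<^sup>* (1, ?q) (3, [])"
    by fastforce
next
  let ?R = "conf_step q_step (A \<union> init_trans n)" and ?q = "replicate n 1 @ [0 :: nat]"
  have "?R\<^sup>*\<^sup>* (0, []) (2 * i, replicate i 1)" if "i \<le> n" for i
    using that
  proof (induction i)
    case (Suc i)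
    have "?R (2 * i, replicate i 1) (2 * Suc i, replicate (Suc i) 1)"
      using Suc.prems by (auto simp: init_trans_def replicate_append_same intro!: exI[of _ "Some (Write 1)"])
    then show ?case using Suc by (meson Suc_leD rtranclp.rtrancl_into_rtrancl)
  qed simp
  then have "?R\<^sup>*\<^sup>* (0, []) (2 * n, replicate n 1)" by blast
  moreover have "?R (2 * n, replicate n 1) (1, ?q)"
    by (auto simp: init_trans_def intro!: exI[of _ "Some (Write 0)"])
  moreover assume "(conf_step q_step A)\<^sup>*\<^sup>* (1, ?q) (3, [])"
  then have "?R\<^sup>*\<^sup>* (1, ?q) (3, [])" by (rule conf_step_mono[rotated]) simp
  ultimately show "?R\<^sup>*\<^sup>* (0, []) (3, [])"
    by (meson rtranclp.rtrancl_into_rtrancl rtranclp_trans)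
qed

abbreviation std_trans :: "nat \<times> q_act option \<times> nat \<Rightarrow> nat \<times> (nat, nat, nat) cmsc \<times> nat" where
  "std_trans \<equiv> \<lambda>(s, x, t). (s, std_op x, t)"

definition trans_num :: "(nat \<times> q_act option \<times> nat) set \<Rightarrow> nat" where
  "trans_num A = set_encode (trans_code ` std_trans ` A)"

text \<open>For \<open>n = trans_num A\<close> the states of \<open>A\<close> are at most
  \<open>n\<close>, the even states are at most \<open>2 * n\<close>, and 3 must belong even for
  small \<open>n\<close>: hence \<open>2 * n + 4\<close>. Letters of \<open>A\<close> are at most
  \<open>n\<close>, and 0 and 1 must be present: hence \<open>n + 2\<close>.\<close>

definition diag_hmsc :: "(nat \<times> q_act option \<times> nat) set \<Rightarrow> nat \<Rightarrow> (nat, nat, nat, nat) hmsc" where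
  "diag_hmsc A n = op_hmsc (A \<union> init_trans n) {..<2 * n + 4} 0 {..<n + 2} {3}"

text \<open>The summand \<open>n\<close> is the contribution of \<open>A\<close> itself when \<open>n = trans_num A\<close>; the sources of its
  transitions are odd and those of \<open>init_trans n\<close> even, so the two sets of codes are disjoint.\<close>

definition diag_code :: "nat \<Rightarrow> nat" where
  "diag_code n = list_encode [set_encode procs, 2 ^ (2 * n + 4) - 1, 0, 2 ^ (n + 2) - 1,
     n + ((\<Sum>i<n. 2 ^ list_encode [2 * i, cmsc_code (std_op (Some (Write 1))), 2 * i + 2])
        + 2 ^ list_encode [2 * n, cmsc_code (std_op (Some (Write 0))), 1]), set_encode {3}, 0]"

lemma trans_code_std_trans:
  "trans_code (std_trans (s, x, t)) = list_encode [s, cmsc_code (std_op x), t]"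
  by (simp add: trans_code_def src_def tgt_def msc_of_def)

lemma set_encode_lessThan: "set_encode {..<n} = 2 ^ n - 1"
  by (induction n) (auto simp: set_encode_def lessThan_Suc)

text \<open>\<open>set_encode\<close> adds up powers of two, hence is additive on disjoint sets of
  transition codes.\<close>

lemma hmsc_code_diag_hmsc:
  assumes "finite A" and A: "\<And>s x t. (s, x, t) \<in> A \<Longrightarrow> odd s \<and> odd t" and n: "n = trans_num A"
  shows "hmsc_code (procs, diag_hmsc A n) = diag_code n"
proof -
  let ?c = "\<lambda>u. trans_code (std_trans u)"
  \<comment> \<open>The source is a component of the code, so transitions with different sources
    have different codes; both disjointness arguments below rest on this.\<close>
  have src: "fst u = fst v" if "?c u = ?c v" for u v
    using that by (cases u; cases v) (auto simp: trans_code_def src_def list_encode_eq simp del: list_encode.simps)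
  let ?I = "(\<lambda>i. (2 * i, Some (Write 1), 2 * i + 2)) ` {..<n} :: (nat \<times> q_act option \<times> nat) set"
  have I: "set_encode (?c ` ?I) = (\<Sum>i<n. 2 ^ list_encode [2 * i, cmsc_code (std_op (Some (Write 1))), 2 * i + 2])"
  proof -
    have "inj_on (\<lambda>i. ?c (2 * i, Some (Write 1), 2 * i + 2)) {..<n}"
      by (rule inj_onI, drule src) simp
    then show ?thesis
      unfolding set_encode_def image_image
      by (subst sum.reindex) (simp_all add: trans_code_def src_def tgt_def msc_of_def comp_def del: list_encode.simps)
  qed
  have "?c (2 * n, Some (Write 0), 1) \<notin> ?c ` ?I"
  proof
    assume "?c (2 * n, Some (Write 0), 1) \<in> ?c ` ?I"
    then obtain u where u: "?c (2 * n, Some (Write 0), 1) = ?c u" "u \<in> ?I" by (rule imageE)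
    then have "2 * n = fst u" using src[OF u(1)] by simp
    then show False using u(2) by auto
  qed
  then have "set_encode (?c ` init_trans n) = 2 ^ list_encode [2 * n, cmsc_code (std_op (Some (Write 0))), 1] + set_encode (?c ` ?I)"
    unfolding init_trans_def image_insert
    by (subst set_encode_insert) (auto simp: trans_code_def src_def tgt_def msc_of_def simp del: list_encode.simps)
  moreover have "?c ` A \<inter> ?c ` init_trans n = {}"
  proof -
    have "odd (fst u)" if "u \<in> A" for u using that A by (cases u) auto
    moreover have "even (fst u)" if "u \<in> init_trans n" for u using that by (auto simp: init_trans_def)
    ultimately have "fst u \<noteq> fst v" if "u \<in> A" "v \<in> init_trans n" for u v
      using that by metis
    then have "?c u \<noteq> ?c v" if "u \<in> A" "v \<in> init_trans n" for u v
      using that src by blast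
    then show ?thesis by blast
  qed
  then have "set_encode (?c ` (A \<union> init_trans n)) = set_encode (?c ` A) + set_encode (?c ` init_trans n)"
    unfolding set_encode_def image_Un using \<open>finite A\<close> by (intro sum.union_disjoint) auto
  ultimately have "set_encode (trans_code ` std_trans ` (A \<union> init_trans n)) =
    n + ((\<Sum>i<n. 2 ^ list_encode [2 * i, cmsc_code (std_op (Some (Write 1))), 2 * i + 2])
        + 2 ^ list_encode [2 * n, cmsc_code (std_op (Some (Write 0))), 1])"
    using I n unfolding trans_num_def image_image by simp
  then show ?thesis
    unfolding hmsc_code_def diag_hmsc_def diag_code_def prod.case op_hmsc_simps set_encode_lessThan
    by (simp del: list_encode.simps)
qed

text \<open>The two cMSC codes that occur are fixed numbers, so nothing about cMSCs has to be
  computed, only list codes, powers and sums.\<close>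

lemma computable_diag_code: "computable 1 (\<lambda>xs. diag_code (hd xs))"
proof -
  have dbl: "computable k (\<lambda>xs. 2 * F xs)" if "computable k F" for k F
    using computable_add[OF that that] by (simp add: mult_2)
  \<comment> \<open>Subtraction is avoided: \<open>2 ^ a - 1\<close> is the sum of the smaller
    powers of two.\<close>
  have pred: "computable k (\<lambda>xs. 2 ^ F xs - 1)" if "computable k F" for k F
  proof -
    have "computable k (\<lambda>xs. \<Sum>i<F xs. 2 ^ ((i # xs) ! 0))"
      by (rule computable_sum[OF that computable_pow2[OF computable_nth]]) simp
    moreover have "(\<Sum>i<a. 2 ^ i) = (2::nat) ^ a - 1" for a by (induction a) auto
    ultimately show ?thesis by simp
  qed
  have n: "computable 1 (\<lambda>xs. xs ! 0)" by (rule computable_nth) simp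
  have i: "computable (Suc 1) (\<lambda>xs. xs ! 0)" by (rule computable_nth) simp
  let ?c = "\<lambda>a. cmsc_code (std_op (Some (Write a)))"
  have "computable 1 (\<lambda>xs. \<Sum>j<xs ! 0. 2 ^ list_encode [2 * (j # xs) ! 0, ?c 1, 2 * (j # xs) ! 0 + 2])"
    by (intro computable_sum[where F = "\<lambda>xs. 2 ^ list_encode [2 * xs ! 0, ?c 1, 2 * xs ! 0 + 2]"] n
      computable_pow2 computable_list_encode_Cons dbl computable_add computable_const i)
  then have "computable 1 (\<lambda>xs. xs ! 0 + ((\<Sum>j<xs ! 0. 2 ^ list_encode [2 * j, ?c 1, 2 * j + 2]) +
      2 ^ list_encode [2 * xs ! 0, ?c 0, 1]))" (is "computable 1 ?T")
    by (intro computable_add n computable_pow2 computable_list_encode_Cons dbl computable_const)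
      (simp del: list_encode.simps)
  then have "computable 1 (\<lambda>xs. list_encode [set_encode procs, 2 ^ (2 * xs ! 0 + 4) - 1, 0,
      2 ^ (xs ! 0 + 2) - 1, ?T xs, set_encode {3}, 0])"
    by (intro computable_list_encode_Cons pred computable_add[of 1 "\<lambda>xs. 2 * xs ! 0"]
      computable_add[of 1 "\<lambda>xs. xs ! 0" "\<lambda>xs. 2"] dbl n computable_const)
  then show ?thesis
    by (rule computable_cong) (auto simp: diag_code_def length_Suc_conv One_nat_def simp del: list_encode.simps)
qed

section \<open>Numbers occurring in a code are bounded by the code\<close>

lemma mem_le_set_encode: "finite A \<Longrightarrow> a \<in> A \<Longrightarrow> a \<le> set_encode A"
proof -
  assume "finite A" "a \<in> A"
  then have "2 ^ a \<le> set_encode A" unfolding set_encode_def by (intro member_le_sum) auto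
  then show "a \<le> set_encode A" using less_exp[of a] by linarith
qed

lemma mem_le_list_encode: "a \<in> set xs \<Longrightarrow> a \<le> list_encode xs"
proof (induction xs)
  case (Cons b xs)
  have "b \<le> prod_encode (b, list_encode xs)" "list_encode xs \<le> prod_encode (b, list_encode xs)"
    by (rule le_prod_encode_1, rule le_prod_encode_2)
  then show ?case using Cons by fastforce
qed simp

text \<open>Justifies the state and message sets of \<open>diag_hmsc\<close>, which must contain
  those of \<open>A\<close> although they are chosen from \<open>n\<close> alone.\<close>

lemma trans_num_bounds:
  assumes "finite A" "(s, x, t) \<in> A"
  shows "s \<le> trans_num A" "t \<le> trans_num A" "letters x \<subseteq> {..trans_num A}"
proof -
  have "trans_code (std_trans (s, x, t)) \<le> trans_num A"
    unfolding trans_num_def by (intro mem_le_set_encode finite_imageI imageI assms)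
  then have c: "list_encode [s, cmsc_code (std_op x), t] \<le> trans_num A"
    unfolding trans_code_std_trans .
  show "s \<le> trans_num A" "t \<le> trans_num A"
    using c mem_le_list_encode[of s "[s, cmsc_code (std_op x), t]"]
      mem_le_list_encode[of t "[s, cmsc_code (std_op x), t]"] by auto
  have "a \<le> trans_num A" if "a \<in> letters x" for a
  proof -
    \<comment> \<open>Event 2 of \<open>std_op x\<close> is unmatched and carries the letter, which
      therefore enters the code.\<close>
    have "mark (std_op x) 2 = Some a" using that by (cases x rule: q_act_option_cases) auto
    then have m: "(2, a) \<in> Map.graph (mark (std_op x))" by (auto simp: Map.graph_def)
    have "finite (dom (mark (std_op x)))" by (cases x rule: q_act_option_cases) auto
    then have fin: "finite (prod_encode ` Map.graph (mark (std_op x)))" by (simp add: finite_graph_iff_finite_dom)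
    have "a \<le> prod_encode (2, a)" by (rule le_prod_encode_2)
    also have "\<dots> \<le> set_encode (prod_encode ` Map.graph (mark (std_op x)))"
      using m fin by (intro mem_le_set_encode) auto
    also have "\<dots> \<le> cmsc_code (std_op x)"
      unfolding cmsc_code_def by (intro mem_le_list_encode) simp
    also have "\<dots> \<le> list_encode [s, cmsc_code (std_op x), t]" by (intro mem_le_list_encode) simp
    finally show ?thesis using c by simp
  qed
  then show "letters x \<subseteq> {..trans_num A}" by blast
qed

theorem theorem4:
  shows "\<not> decidable_on hmsc_code
    {(P :: nat set, H :: (nat, nat, nat, nat) hmsc).
       finite P \<and> P \<noteq> {} \<and> card P \<ge> 2 \<and> is_hmsc P H \<and> loop_connected P H}
    (\<lambda>(P, H). lang P H \<noteq> {})"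
proof
  assume "decidable_on hmsc_code
    {(P :: nat set, H :: (nat, nat, nat, nat) hmsc).
       finite P \<and> P \<noteq> {} \<and> card P \<ge> 2 \<and> is_hmsc P H \<and> loop_connected P H}
    (\<lambda>(P, H). lang P H \<noteq> {})"
  then obtain d where d: "\<And>P H. finite P \<Longrightarrow> P \<noteq> {} \<Longrightarrow> card P \<ge> 2 \<Longrightarrow> is_hmsc P H \<Longrightarrow> loop_connected P H \<Longrightarrow>
      rec_eval d [hmsc_code (P, H)] (if lang P H \<noteq> {} then 1 else 0)"
    unfolding decidable_on_def by auto
  obtain c where "\<And>xs. length xs = 1 \<Longrightarrow> rec_eval c xs (diag_code (hd xs))"
    using computable_diag_code unfolding computable_def by blast
  from this[of "[n]" for n] have c: "rec_eval c [n] (diag_code n)" for n by simp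
  have c': "rec_eval c [n] y \<longleftrightarrow> y = diag_code n" for n y
    using c rec_eval_functional by blast
  \<comment> \<open>The body of \<open>Mu\<close> ignores the search variable, since
    \<open>Proj 1\<close> is the input. So \<open>g\<close> stops at 0 if \<open>d\<close> answers 0
    on the code and has no value otherwise.\<close>
  define g where "g = Mu (Comp d [Comp c [Proj 1]])"
  have g: "(\<exists>y. rec_eval g [n] y) \<longleftrightarrow> rec_eval d [diag_code n] 0" for n
  proof -
    have "rec_eval (Comp d [Comp c [Proj 1]]) [i, n] y \<longleftrightarrow> rec_eval d [diag_code n] y" for i y
      by (auto simp: rec_eval_Comp list_all2_Cons1 c')
    then show ?thesis
      unfolding g_def rec_eval_Mu by auto
  qed
  obtain A :: "(nat \<times> q_act option \<times> nat) set" where A: "finite A" "\<And>s x t. (s, x, t) \<in> A \<Longrightarrow> odd s \<and> odd t"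
    and run: "\<And>n. (conf_step q_step A)\<^sup>*\<^sup>* (1, replicate n 1 @ [0]) (3, []) \<longleftrightarrow> (\<exists>y. rec_eval g [n] y)"
    using ex_queue_automaton[of g] by blast
  \<comment> \<open>Self-application: \<open>A\<close> receives the number of its own transitions as
    input.\<close>
  define n where "n = trans_num A"
  let ?H = "diag_hmsc A n"
  have bounds: "s < 2 * n + 4 \<and> t < 2 * n + 4 \<and> letters x \<subseteq> {..<n + 2}" if "(s, x, t) \<in> A \<union> init_trans n" for s x t
    using that trans_num_bounds[OF A(1), of s x t] unfolding n_def[symmetric]
    by (fastforce simp: init_trans_def)
  have H: "is_hmsc procs ?H"
    unfolding diag_hmsc_def by (rule is_hmsc_op_hmsc) (use A(1) bounds in auto)
  moreover have "loop_connected procs ?H"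
    unfolding diag_hmsc_def by (rule loop_connected_op_hmsc) (use bounds in auto)
  ultimately have "rec_eval d [diag_code n] (if lang procs ?H \<noteq> {} then 1 else 0)"
    using d[of procs ?H] by (simp add: hmsc_code_diag_hmsc[OF A n_def])
  \<comment> \<open>The language is nonempty iff \<open>g\<close> halts on \<open>n\<close>, that
    is, iff \<open>d\<close> declares this very language empty.\<close>
  moreover have "lang procs ?H \<noteq> {} \<longleftrightarrow> rec_eval d [diag_code n] 0"
  proof -
    have "lang procs ?H \<noteq> {} \<longleftrightarrow> (\<exists>t\<in>{3}. (conf_step q_step (A \<union> init_trans n))\<^sup>*\<^sup>* (0, []) (t, []))"
      unfolding diag_hmsc_def by (rule lang_op_hmsc_nonempty) (use bounds in auto)
    also have "\<dots> \<longleftrightarrow> (\<exists>y. rec_eval g [n] y)"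
      using init_trans_run[of A n, OF A(2)] run by simp
    finally show ?thesis unfolding g .
  qed
  ultimately show False using rec_eval_functional[of d "[diag_code n]" 0 1]
    by (auto split: if_splits)
qed

end
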